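(* Consider a smooth pure exchange economy with $m$ consumers and $l$ goods, reduced excess demand $\bar z\colon S\times\Omega\to\mathbb R^{l-1}$, equilibrium manifold $E=\bar z^{-1}(0)\subset S\times\Omega$, natural projection $\pi\colon E\to\Omega$ and set of crisis transitions $\mathcal B\subset E$ (all as defined in the context). If $e=(p,\omega)\in E$ verifies (i) $\operatorname{Ker}D\bar z_\omega(p)$ is odd-dimensional; (ii) there exists a vector $v\in\operatorname{Ker}D\bar z_\omega(p)$ such that $$D^2\bar z_\omega(p)[v,u]\notin\operatorname{Im}D\bar z_\omega(p)\quad\text{for all } u\in\operatorname{Ker}D\bar z_\omega(p),\ u\neq0,$$ then $e$ is an unavoidable crisis: $e\in\mathcal B$, and in every neighbourhood of $e$ in $E$ there exist two regular equilibria $e_\pm=(p_\pm,\omega_\pm)$ belonging to different path components of $E\setminus\mathcal B$ (equivalently, every continuous path in $E$ between $e_+$ and $e_-$ must intersect $\mathcal B$).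
   Context: Economy. $X=\mathbb R^l_{++}$ is the strictly positive orthant; $S=\{(p_1,\dots,p_l)\in\mathbb R^l_{++} : p_l=1\}$ is the set of normalized prices, identified with an open subset of $\mathbb R^{l-1}$. Each consumer $i=1,\dots,m$ has a fixed smooth utility function $u_i\colon X\to\mathbb R$ such that: (monotonicity) $\nabla u_i(x)\in\mathbb R^l_{++}$ for every $x\in X$; (strict quasi-concavity) the Hessian $D^2u_i(x)$ is negative definite on the tangent hyperplane at $x$ to the indifference surface through $x$; (necessity) for every $r\in\mathbb R$ the indifference surface $\{x\in X: u_i(x)=r\}$ is closed in $\mathbb R^l$. For an endowment $\omega_i\in X$ and $p\in S$, the demand $x_i(p,\omega_i)\in X$ is the unique maximizer of $u_i$ on $\{x\in X: p\cdot x\le p\cdot\omega_i\}$; it satisfies $p\cdot x_i(p,\omega_i)=p\cdot\omega_i$ and depends smoothly on $(p,\omega_i)$. An economy is $\omega=(\omega_1,\dots,\omega_m)\in\Omega=\mathbb R^{ml}_{++}$. The excess demand is $z\colon S\times\Omega\to\mathbb R^l$, $z(p,\omega)=\sum_{i=1}^m(x_i(p,\omega_i)-\omega_i)$; it satisfies $p\cdot z(p,\omega)=0$. The reduced excess demand $\bar z\colon S\times\Omega\to\mathbb R^{l-1}$ is obtained from $z$ by deleting the last coordinate, and $\bar z_\omega(p)=\bar z(p,\omega)$; $D\bar z_\omega(p)$ and $D^2\bar z_\omega(p)$ are its first and second differentials in the $l-1$ free price variables. An equilibrium is a pair $(p,\omega)$ with $z(p,\omega)=0$. The equilibrium manifold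 $E=\{(p,\omega)\in S\times\Omega: z(p,\omega)=0\}=\bar z^{-1}(0)$ is a smooth $ml$-dimensional submanifold of $S\times\Omega$, diffeomorphic to Euclidean space; the natural projection $\pi\colon E\to\Omega$, $\pi(p,\omega)=\omega$, is smooth and proper. A regular equilibrium is a point $e\in E$ at which $D\pi(e)$ is an isomorphism. A crisis transition (crisis) is a point $e_*=(p_*,\omega_* )\in E$ such that on no neighbourhood of $\omega_*$ does there exist a continuous selection $\omega\mapsto p(\omega)$ of equilibrium prices with $p(\omega_* )=p_*$; equivalently, $\pi$ is not a local homeomorphism at $e_*$. $\mathcal B\subset E$ denotes the set of crisis transitions. *)

theory Defs
  imports "HOL-Analysis.Analysis"
begin

section \<open>Smooth maps, second differentials, tangent vectors\<close>

text \<open>On an open set of a Euclidean space, \<open>Ck_on k A f\<close> is membership in the class $C^k$: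
  testing the differential in each fixed direction \<open>v\<close> suffices in finite dimension.\<close>

primrec Ck_on :: "nat \<Rightarrow> 'a::euclidean_space set \<Rightarrow> ('a \<Rightarrow> 'b::real_normed_vector) \<Rightarrow> bool" where
  "Ck_on 0 A f \<longleftrightarrow> continuous_on A f"
| "Ck_on (Suc k) A f \<longleftrightarrow> (\<forall>x\<in>A. f differentiable (at x)) \<and>
     (\<forall>v. Ck_on k A (\<lambda>x. frechet_derivative f (at x) v))"

definition smooth_on :: "'a::euclidean_space set \<Rightarrow> ('a \<Rightarrow> 'b::real_normed_vector) \<Rightarrow> bool" where
  "smooth_on A f \<longleftrightarrow> (\<forall>k. Ck_on k A f)"

definition second_derivative ::
    "('a::euclidean_space \<Rightarrow> 'b::real_normed_vector) \<Rightarrow> 'a \<Rightarrow> 'a \<Rightarrow> 'a \<Rightarrow> 'b" where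
  "second_derivative f x v w =
     frechet_derivative (\<lambda>y. frechet_derivative f (at y) v) (at x) w"

definition gradient :: "(real ^ 'k \<Rightarrow> real) \<Rightarrow> real ^ 'k \<Rightarrow> real ^ 'k" where
  "gradient f x = (\<chi> j. frechet_derivative f (at x) (axis j 1))"

text \<open>The tangent space of an embedded submanifold \<open>M\<close> of a Euclidean space, as the set of
  velocities at \<open>a\<close> of smooth curves lying in \<open>M\<close>.\<close>

definition tangent_space :: "'a::euclidean_space set \<Rightarrow> 'a \<Rightarrow> 'a set" where
  "tangent_space M a = {w. \<exists>c (\<epsilon>::real). 0 < \<epsilon> \<and> smooth_on {-\<epsilon><..<\<epsilon>} c \<and>
     c ` {-\<epsilon><..<\<epsilon>} \<subseteq> M \<and> c 0 = a \<and> (c has_vector_derivative w) (at 0)}"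

section \<open>The exchange economy\<close>

text \<open>The goods are indexed by \<open>'n option\<close>, where \<open>None\<close> is the last good (the numeraire), so
  that $l = \mbox{CARD}('n) + 1$ and $\mathbb{R}^{l-1}$ is \<open>real ^ 'n\<close>. The consumers are indexed
  by \<open>'m\<close>.\<close>

type_synonym 'n goods_bundle = "real ^ ('n option)"
type_synonym ('n, 'm) endowments = "(real ^ ('n option)) ^ 'm"

definition pos_orthant :: "(real ^ 'k) set" where
  "pos_orthant = {x. \<forall>j. 0 < x $ j}"

definition Omega :: "('n::finite, 'm::finite) endowments set" where
  "Omega = {\<omega>. \<forall>i. \<omega> $ i \<in> pos_orthant}"

definition admissible_utility :: "(('n::finite) goods_bundle \<Rightarrow> real) \<Rightarrow> bool" where
  "admissible_utility U \<longleftrightarrow>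
     smooth_on pos_orthant U \<and>
     (\<forall>x\<in>pos_orthant. gradient U x \<in> pos_orthant) \<and>
     (\<forall>x\<in>pos_orthant. \<forall>h. h \<noteq> 0 \<and> gradient U x \<bullet> h = 0 \<longrightarrow> second_derivative U x h h < 0) \<and>
     (\<forall>r. closed {x \<in> pos_orthant. U x = r})"

text \<open>A normalized price vector is represented by its first $l-1$ coordinates, so that the set
  \<open>S\<close> of normalized prices is the positive orthant \<open>pos_orthant\<close> of \<open>real ^ 'n\<close>;
  \<open>full_price\<close> restores the last coordinate 1.\<close>

definition full_price :: "(real ^ 'n) \<Rightarrow> ('n::finite) goods_bundle" where
  "full_price p = (\<chi> j. case j of None \<Rightarrow> 1 | Some k \<Rightarrow> p $ k)"

definition budget_set :: "(real ^ 'n) \<Rightarrow> ('n::finite) goods_bundle \<Rightarrow> 'n goods_bundle set" where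
  "budget_set p a = {x \<in> pos_orthant. full_price p \<bullet> x \<le> full_price p \<bullet> a}"

definition demand ::
    "(('n::finite) goods_bundle \<Rightarrow> real) \<Rightarrow> real ^ 'n \<Rightarrow> 'n goods_bundle \<Rightarrow> 'n goods_bundle" where
  "demand U p a = (THE x. x \<in> budget_set p a \<and> (\<forall>y\<in>budget_set p a. U y \<le> U x))"

definition excess_demand ::
    "(('m::finite) \<Rightarrow> ('n::finite) goods_bundle \<Rightarrow> real) \<Rightarrow> real ^ 'n \<Rightarrow> ('n, 'm) endowments \<Rightarrow> 'n goods_bundle"
  where "excess_demand u p \<omega> = (\<Sum>i\<in>UNIV. demand (u i) p (\<omega> $ i) - \<omega> $ i)"

text \<open>The argument order makes \<open>reduced_excess_demand u \<omega>\<close> the map $\bar z_\omega$ of the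
  $l-1$ free prices.\<close>

definition reduced_excess_demand ::
    "(('m::finite) \<Rightarrow> ('n::finite) goods_bundle \<Rightarrow> real) \<Rightarrow> ('n, 'm) endowments \<Rightarrow> real ^ 'n \<Rightarrow> real ^ 'n"
  where "reduced_excess_demand u \<omega> p = (\<chi> k. excess_demand u p \<omega> $ Some k)"

definition equilibria ::
    "(('m::finite) \<Rightarrow> ('n::finite) goods_bundle \<Rightarrow> real) \<Rightarrow> ((real ^ 'n) \<times> ('n, 'm) endowments) set" where
  "equilibria u = {(p, \<omega>). p \<in> pos_orthant \<and> \<omega> \<in> Omega \<and> excess_demand u p \<omega> = 0}"

text \<open>The natural projection of \<open>equilibria u\<close> is the restriction of the linear map \<open>snd\<close>, so
  its differential at \<open>e\<close> is the restriction of the differential of \<open>snd\<close> to the tangent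
  space at \<open>e\<close>; the tangent space of the open set \<open>Omega\<close> is the whole space.\<close>

definition regular_equilibrium ::
    "(('m::finite) \<Rightarrow> ('n::finite) goods_bundle \<Rightarrow> real) \<Rightarrow> (real ^ 'n) \<times> ('n, 'm) endowments \<Rightarrow> bool" where
  "regular_equilibrium u e \<longleftrightarrow> e \<in> equilibria u \<and>
     bij_betw (frechet_derivative snd (at e)) (tangent_space (equilibria u) e)
       (UNIV :: ('n, 'm) endowments set)"

definition crises ::
    "(('m::finite) \<Rightarrow> ('n::finite) goods_bundle \<Rightarrow> real) \<Rightarrow> ((real ^ 'n) \<times> ('n, 'm) endowments) set" where
  "crises u = {(p, \<omega>). (p, \<omega>) \<in> equilibria u \<and>
     \<not> (\<exists>V s. open V \<and> \<omega> \<in> V \<and> V \<subseteq> Omega \<and> continuous_on V s \<and> s \<omega> = p \<and>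
          (\<forall>\<omega>'\<in>V. (s \<omega>', \<omega>') \<in> equilibria u))}"

definition unavoidable_crisis ::
    "(('m::finite) \<Rightarrow> ('n::finite) goods_bundle \<Rightarrow> real) \<Rightarrow> (real ^ 'n) \<times> ('n, 'm) endowments \<Rightarrow> bool" where
  "unavoidable_crisis u e \<longleftrightarrow> e \<in> crises u \<and>
     (\<forall>N. openin (top_of_set (equilibria u)) N \<and> e \<in> N \<longrightarrow>
        (\<exists>e1\<in>N. \<exists>e2\<in>N. regular_equilibrium u e1 \<and> regular_equilibrium u e2 \<and>
           e1 \<in> equilibria u - crises u \<and> e2 \<in> equilibria u - crises u \<and>
           \<not> path_component (equilibria u - crises u) e1 e2))"

end

theory Submission
  imports Defs "HOL-Homology.Homology"
begin

text \<open>The crisis set separates equilibria at which the Jacobian of the reduced excess demand in the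
  prices has opposite signs: near an equilibrium that is not a crisis the projection is injective,
  so along a path avoiding the crises the price stays an isolated zero of the excess demand, and the
  homotopy class of the excess demand on a small sphere around it does not change; at a regular
  equilibrium this class is that of the derivative, which by Brouwer degree remembers the sign of the
  determinant. On the other hand, along a curve of equilibria with velocity \<open>(v, 0)\<close> the
  Jacobian matrix has derivative $D^2\bar z_\omega(p)[v, \cdot]$ at \<open>(p, \<omega>)\<close>, so by (ii)
  its determinant vanishes to the exact order given by the dimension of the kernel, which is odd, and
  hence changes sign.\<close>

section \<open>Calculus of maps of class $C^k$\<close>

text \<open>A singular price derivative alone does not make a crisis: the root of p^3 = a depends
  continuously on a. So the determinant may vanish along a path that avoids the crises, and what is
  carried along the path is a homotopy class on small spheres instead of the sign itself. A further
  obstacle is that a point outside the crises only comes with one continuous selection of prices,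
  without uniqueness; that nearby equilibria lie on its graph is extracted from invariance of
  domain. The separation result also yields that the given equilibrium is a crisis: otherwise the
  nearby equilibria would lie on a graph over a ball of economies, which is path connected and free
  of crises, so both signs could not occur there. The smooth structure is obtained from explicit
  maps: demand, given only as a maximizer, is recovered as the inverse of a smooth map read off from
  the first-order conditions, and curves of equilibria come from a retraction built on Walras'
  law.\<close>

lemma Ck_on_imp_continuous_on: "Ck_on k A f \<Longrightarrow> continuous_on A f"
  by (cases k) (auto intro!: continuous_at_imp_continuous_on differentiable_imp_continuous_within)

lemma Ck_on_SucD: "Ck_on (Suc k) A f \<Longrightarrow> Ck_on k A f"
proof (induction k arbitrary: f)
  case 0
  then show ?case using Ck_on_imp_continuous_on by fastforce
next
  case (Suc k)
  then have "Ck_on (Suc k) A (\<lambda>x. frechet_derivative f (at x) v)" for v by simp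
  with Suc.IH have "Ck_on k A (\<lambda>x. frechet_derivative f (at x) v)" for v by blast
  with Suc.prems show ?case by simp
qed

text \<open>Agreement on an open set passes to all directional derivatives, so the induction has to
  vary both functions.\<close>

lemma Ck_on_cong:
  assumes "open A" "\<And>x. x \<in> A \<Longrightarrow> f x = g x" "Ck_on k A f"
  shows "Ck_on k A g"
  using assms(2,3)
proof (induction k arbitrary: f g)
  case 0
  then show ?case by (metis Ck_on.simps(1) continuous_on_cong)
next
  case (Suc k)
  have D: "(g has_derivative frechet_derivative f (at x)) (at x)" if "x \<in> A" for x
  proof (rule has_derivative_transform_within_open[of f _ x UNIV A])
    show "(f has_derivative frechet_derivative f (at x)) (at x)"
      using Suc.prems that frechet_derivative_works by auto
  qed (use \<open>open A\<close> that Suc.prems in auto)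
  then have E: "frechet_derivative g (at x) = frechet_derivative f (at x)" if "x \<in> A" for x
    using frechet_derivative_at that by metis
  have "Ck_on k A (\<lambda>x. frechet_derivative g (at x) v)" for v
    using Suc.IH[of "\<lambda>x. frechet_derivative f (at x) v" "\<lambda>x. frechet_derivative g (at x) v"]
      E Suc.prems by simp
  with D show ?case by (auto simp: differentiable_def)
qed

lemma Ck_on_SucI:
  assumes "open A" "\<And>x. x \<in> A \<Longrightarrow> (f has_derivative f' x) (at x)"
    "\<And>v. Ck_on k A (\<lambda>x. f' x v)"
  shows "Ck_on (Suc k) A f"
proof -
  have "frechet_derivative f (at x) = f' x" if "x \<in> A" for x
    using assms(2)[OF that] frechet_derivative_at by metis
  then have "Ck_on k A (\<lambda>x. frechet_derivative f (at x) v)" for v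
    using Ck_on_cong[OF \<open>open A\<close> _ assms(3)[of v]] by simp
  then show ?thesis using assms(2) by (auto simp: differentiable_def)
qed

lemma Ck_on_Suc_has_derivative:
  assumes "Ck_on (Suc k) A f" "x \<in> A"
  shows "(f has_derivative frechet_derivative f (at x)) (at x)"
  using assms frechet_derivative_works by auto

lemma Ck_on_Suc_frechet: "Ck_on (Suc k) A f \<Longrightarrow> Ck_on k A (\<lambda>x. frechet_derivative f (at x) v)"
  by simp

lemma Ck_on_const: "Ck_on k A (\<lambda>_. c)"
proof (induction k arbitrary: c)
  case (Suc k)
  have "frechet_derivative (\<lambda>_::'a. c) (at x) = (\<lambda>_. 0)" for x
    using frechet_derivative_at[of "\<lambda>_. c" "\<lambda>_. 0"] by (metis has_derivative_const)
  with Suc show ?case by simp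
qed simp

lemma Ck_on_bounded_linear:
  assumes "bounded_linear L" "open A" "Ck_on k A f"
  shows "Ck_on k A (\<lambda>x. L (f x))"
  using assms(3)
proof (induction k arbitrary: f)
  case 0
  then show ?case using assms(1) by (simp add: bounded_linear.continuous_on)
next
  case (Suc k)
  show ?case
  proof (rule Ck_on_SucI[OF \<open>open A\<close>])
    show "((\<lambda>x. L (f x)) has_derivative (\<lambda>v. L (frechet_derivative f (at x) v))) (at x)"
      if "x \<in> A" for x
      using bounded_linear.has_derivative[OF assms(1) Ck_on_Suc_has_derivative[OF Suc.prems that]] .
  qed (use Suc in auto)
qed

lemma Ck_on_linear: "bounded_linear L \<Longrightarrow> open A \<Longrightarrow> Ck_on k A L"
proof (cases k)
  case 0
  assume "bounded_linear L"
  then show ?thesis using 0 by (simp add: linear_continuous_on)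
next
  case (Suc j)
  assume L: "bounded_linear L" "open A"
  show ?thesis unfolding Suc
    by (rule Ck_on_SucI[where f'="\<lambda>_. L"])
      (auto simp: L bounded_linear_imp_has_derivative Ck_on_const)
qed

lemma Ck_on_add:
  assumes "open A" "Ck_on k A f" "Ck_on k A g"
  shows "Ck_on k A (\<lambda>x. f x + g x)"
  using assms(2,3)
proof (induction k arbitrary: f g)
  case 0
  then show ?case by (simp add: continuous_on_add)
next
  case (Suc k)
  show ?case
    by (rule Ck_on_SucI[OF \<open>open A\<close> has_derivative_add[OF Ck_on_Suc_has_derivative[OF Suc.prems(1)]
            Ck_on_Suc_has_derivative[OF Suc.prems(2)]]])
      (use Suc in auto)
qed

lemma Ck_on_sum:
  assumes "open A" "\<And>i. i \<in> I \<Longrightarrow> Ck_on k A (f i)"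
  shows "Ck_on k A (\<lambda>x. \<Sum>i\<in>I. f i x)"
  using assms(2)
  by (induction I rule: infinite_finite_induct) (auto intro!: Ck_on_add Ck_on_const assms(1))

lemma Ck_on_bilinear:
  assumes "bounded_bilinear B" "open A" "Ck_on k A f" "Ck_on k A g"
  shows "Ck_on k A (\<lambda>x. B (f x) (g x))"
  using assms(3,4)
proof (induction k arbitrary: f g)
  case 0
  then show ?case using bounded_bilinear.continuous_on[OF assms(1)] by simp
next
  case (Suc k)
  show ?case
  proof (rule Ck_on_SucI[OF \<open>open A\<close> bounded_bilinear.FDERIV[OF assms(1)
            Ck_on_Suc_has_derivative[OF Suc.prems(1)] Ck_on_Suc_has_derivative[OF Suc.prems(2)]]])
    fix v
    show "Ck_on k A (\<lambda>x. B (f x) (frechet_derivative g (at x) v) + B (frechet_derivative f (at x) v) (g x))"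
      by (intro Ck_on_add \<open>open A\<close> Suc.IH Ck_on_Suc_frechet[OF Suc.prems(1)]
            Ck_on_Suc_frechet[OF Suc.prems(2)] Ck_on_SucD[OF Suc.prems(1)] Ck_on_SucD[OF Suc.prems(2)])
  qed auto
qed

lemmas Ck_on_scaleR = Ck_on_bilinear[OF bounded_bilinear_scaleR]
lemmas Ck_on_mult = Ck_on_bilinear[OF bounded_bilinear_mult]
lemmas Ck_on_inner = Ck_on_bilinear[OF bounded_bilinear_inner]

lemma Ck_on_diff:
  assumes "open A" "Ck_on k A f" "Ck_on k A g"
  shows "Ck_on k A (\<lambda>x. f x - g x)"
  using Ck_on_add[OF assms(1,2) Ck_on_bounded_linear[OF bounded_linear_minus[OF bounded_linear_ident] assms(1,3)]]
  by simp

lemma Ck_on_prod: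
  fixes f :: "'i \<Rightarrow> 'a::euclidean_space \<Rightarrow> real"
  assumes "open A" "\<And>i. i \<in> I \<Longrightarrow> Ck_on k A (f i)"
  shows "Ck_on k A (\<lambda>x. \<Prod>i\<in>I. f i x)"
  using assms(2)
  by (induction I rule: infinite_finite_induct) (auto intro!: Ck_on_mult Ck_on_const assms(1))

lemma Ck_on_inverse:
  fixes f :: "'a::euclidean_space \<Rightarrow> real"
  assumes "open A" "Ck_on k A f" "\<And>x. x \<in> A \<Longrightarrow> f x \<noteq> 0"
  shows "Ck_on k A (\<lambda>x. inverse (f x))"
  using assms(2)
proof (induction k)
  case 0
  then show ?case using assms(3) by (auto intro: continuous_on_inverse)
next
  case (Suc k)
  show ?case
  proof (rule Ck_on_SucI[OF \<open>open A\<close>])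
    show "((\<lambda>x. inverse (f x)) has_derivative
        (\<lambda>h. - (inverse (f x) * (frechet_derivative f (at x) h * inverse (f x))))) (at x)" if "x \<in> A" for x
      using Deriv.has_derivative_inverse[OF assms(3)[OF that] Ck_on_Suc_has_derivative[OF Suc.prems that]]
      by (simp add: mult.assoc)
    show "Ck_on k A (\<lambda>x. - (inverse (f x) * (frechet_derivative f (at x) v * inverse (f x))))" for v
      by (intro Ck_on_bounded_linear[OF bounded_linear_minus[OF bounded_linear_ident]]
          Ck_on_mult \<open>open A\<close> Suc.IH Ck_on_SucD[OF Suc.prems] Ck_on_Suc_frechet[OF Suc.prems])
  qed
qed

lemma Ck_on_divide:
  fixes f g :: "'a::euclidean_space \<Rightarrow> real"
  assumes "open A" "Ck_on k A f" "Ck_on k A g" "\<And>x. x \<in> A \<Longrightarrow> g x \<noteq> 0"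
  shows "Ck_on k A (\<lambda>x. f x / g x)"
  unfolding divide_inverse by (intro Ck_on_mult Ck_on_inverse assms)

lemma Ck_on_vec_nth:
  assumes "open A" "Ck_on k A f"
  shows "Ck_on k A (\<lambda>x. f x $ i)"
  by (rule Ck_on_bounded_linear[OF bounded_linear_vec_nth assms])

lemma bounded_linear_axis: "bounded_linear (axis i :: 'a::euclidean_space \<Rightarrow> 'a ^ 'k::finite)"
  unfolding linear_conv_bounded_linear[symmetric]
  by (rule linearI) (auto simp: axis_def vec_eq_iff)

lemma vec_eq_sum_axis: "x = (\<Sum>i\<in>UNIV. axis i (x $ i))"
  by (simp add: vec_eq_iff axis_def if_distrib if_distribR cong: if_cong)

lemma Ck_on_vecI:
  fixes f :: "'a::euclidean_space \<Rightarrow> 'b::euclidean_space ^ 'k::finite"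
  assumes "open A" "\<And>i. Ck_on k A (\<lambda>x. f x $ i)"
  shows "Ck_on k A f"
proof -
  have "Ck_on k A (\<lambda>x. \<Sum>i\<in>UNIV. axis i (f x $ i))"
    by (intro Ck_on_sum Ck_on_bounded_linear[OF bounded_linear_axis] assms)
  then show ?thesis by (simp flip: vec_eq_sum_axis)
qed

lemma Ck_on_det:
  fixes M :: "'a::euclidean_space \<Rightarrow> real ^ 'k ^ 'k"
  assumes "open A" "\<And>i j. Ck_on k A (\<lambda>x. M x $ i $ j)"
  shows "Ck_on k A (\<lambda>x. det (M x))"
  unfolding det_def by (intro Ck_on_sum Ck_on_mult Ck_on_prod Ck_on_const assms)

text \<open>In the chain rule the outer differential is evaluated in a direction that moves with the
  point, whereas \<open>Ck_on\<close> tests fixed directions only. Expanding over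
  \<open>Basis\<close> reduces to fixed ones.\<close>

lemma has_derivative_eq_sum_Basis:
  assumes "(f has_derivative f') F"
  shows "f' v = (\<Sum>b\<in>Basis. (v \<bullet> b) *\<^sub>R f' b)"
proof -
  have "linear f'" using assms has_derivative_linear by blast
  then show ?thesis
    by (metis (no_types, lifting) euclidean_representation linear_sum linear.scaleR sum.cong)
qed

lemma Ck_on_compose:
  fixes f :: "'a::euclidean_space \<Rightarrow> 'b::euclidean_space"
  assumes "open A" "open B" "f ` A \<subseteq> B" "Ck_on k A f" "Ck_on k B g"
  shows "Ck_on k A (\<lambda>x. g (f x))"
  using assms(4,5)
proof (induction k arbitrary: g)
  case 0
  then show ?case using assms(3) by (auto intro: continuous_on_compose2)
next
  case (Suc k)
  have D: "((\<lambda>x. g (f x)) has_derivative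
      (\<lambda>v. \<Sum>b\<in>Basis. (frechet_derivative f (at x) v \<bullet> b) *\<^sub>R frechet_derivative g (at (f x)) b)) (at x)"
    if "x \<in> A" for x
  proof -
    have g: "(g has_derivative frechet_derivative g (at (f x))) (at (f x))"
      using Ck_on_Suc_has_derivative[OF Suc.prems(2)] assms(3) that by auto
    show ?thesis
      using has_derivative_compose[OF Ck_on_Suc_has_derivative[OF Suc.prems(1) that] g]
      by (subst (asm) has_derivative_eq_sum_Basis[OF g])
  qed
  show ?case
    by (rule Ck_on_SucI[OF \<open>open A\<close> D])
      (auto intro!: Ck_on_sum Ck_on_scaleR \<open>open A\<close> Ck_on_inner Ck_on_const Suc.IH
        Ck_on_SucD[OF Suc.prems(1)] Ck_on_Suc_frechet[OF Suc.prems(2)] Ck_on_Suc_frechet[OF Suc.prems(1)])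
qed

text \<open>The differential of the inverse is the inverse matrix of the differential of
  \<open>f\<close> at \<open>g y\<close>. By Cramer's rule its entries are quotients of determinants
  in entries that are as regular as \<open>g\<close>, so \<open>g\<close> gains one class at every
  step of the induction.\<close>

lemma Ck_on_local_inverse:
  fixes f :: "real ^ 'k \<Rightarrow> real ^ 'k"
  assumes f: "\<And>j. Ck_on j X f" and X: "open X" and Y: "open Y" and gX: "g ` Y \<subseteq> X"
    and contg: "continuous_on Y g" and fg: "\<And>y. y \<in> Y \<Longrightarrow> f (g y) = y"
    and inj: "\<And>x h. x \<in> X \<Longrightarrow> frechet_derivative f (at x) h = 0 \<Longrightarrow> h = 0"
  shows "Ck_on k Y g"
proof -
  define M where "M x = matrix (frechet_derivative f (at x))" for x
  \<comment> \<open>Cramer's solution of the linear system with matrix \<open>M (g y)\<close> and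
    right-hand side \<open>v\<close>.\<close>
  define S where "S y v = (\<chi> l. det (\<chi> i j. if j = l then v $ i else M (g y) $ i $ j) / det (M (g y)))"
    for y v
  have df: "(f has_derivative frechet_derivative f (at x)) (at x)" if "x \<in> X" for x
    using f[of "Suc 0"] that by (rule Ck_on_Suc_has_derivative)
  have fM: "frechet_derivative f (at x) h = M x *v h" if "x \<in> X" for x h
    unfolding M_def using df[OF that] by (simp add: has_derivative_linear matrix_works)
  have detM: "det (M x) \<noteq> 0" if "x \<in> X" for x
  proof -
    have "inj ((*v) (M x))"
      by (subst linear_injective_0) (use inj[OF that] fM[OF that] in auto)
    then show ?thesis using det_nz_iff_inj[OF matrix_vector_mul_linear, of "M x"] by simp
  qed
  have gin: "g y \<in> X" if "y \<in> Y" for y using gX that by blast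
  have S: "M (g y) *v S y v = v" if "y \<in> Y" for y v
    using cramer[OF detM[OF gin[OF that]]] unfolding S_def by blast
  have Sinv: "S y (M (g y) *v v) = v" if "y \<in> Y" for y v
    using cramer[OF detM[OF gin[OF that]]] unfolding S_def by metis
  have linS: "linear (S y)" if y: "y \<in> Y" for y
  proof -
    obtain B where B: "B ** M (g y) = mat 1"
      using detM[OF gin[OF y]] invertible_det_nz invertible_def by metis
    have "S y v = B *v v" for v
      using S[OF y, of v] B by (metis matrix_vector_mul_assoc matrix_vector_mul_lid)
    then have "S y = (*v) B" by blast
    then show ?thesis by simp
  qed
  have dg: "(g has_derivative S y) (at y)" if "y \<in> Y" for y
  proof (rule has_derivative_inverse_basic[where f=f and f'="frechet_derivative f (at (g y))" and T=Y])
    show "bounded_linear (S y)" using linS[OF that] linear_conv_bounded_linear by blast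
    show "S y \<circ> frechet_derivative f (at (g y)) = id"
      using Sinv[OF that] fM[OF gin[OF that]] by auto
    show "isCont g y" using contg Y that continuous_on_eq_continuous_at by blast
  qed (use fg Y that df gin in auto)
  show ?thesis
  proof (induction k)
    case 0
    then show ?case using contg by simp
  next
    case (Suc k)
    have M: "Ck_on k Y (\<lambda>y. M (g y) $ i $ j)" for i j
    proof -
      have "Ck_on k X (\<lambda>x. M x $ i $ j)"
        unfolding M_def matrix_def
        using Ck_on_vec_nth[OF X Ck_on_Suc_frechet[OF f[of "Suc k"]]] by simp
      from Ck_on_compose[OF Y X gX Suc this] show ?thesis .
    qed
    show ?case
    proof (rule Ck_on_SucI[OF Y dg])
      show "Ck_on k Y (\<lambda>y. S y v)" for v
      proof (rule Ck_on_vecI[OF Y])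
        fix l
        have "Ck_on k Y (\<lambda>y. (\<chi> i j. if j = l then v $ i else M (g y) $ i $ j) $ i $ j)" for i j
          by (cases "j = l") (simp_all add: Ck_on_const M)
        then have "Ck_on k Y (\<lambda>y. det (\<chi> i j. if j = l then v $ i else M (g y) $ i $ j) / det (M (g y)))"
          by (intro Ck_on_divide Y Ck_on_det M) (use detM gin in auto)
        then show "Ck_on k Y (\<lambda>y. S y v $ l)" by (simp add: S_def)
      qed
    qed auto
  qed
qed

section \<open>Demand\<close>

text \<open>One-sided, because the critical point in the application may be the left end of a
  segment.\<close>

lemma second_order_strict_local_max:
  fixes g g' :: "real \<Rightarrow> real"
  assumes S: "open S" "t0 \<in> S" and g: "\<And>t. t \<in> S \<Longrightarrow> (g has_real_derivative g' t) (at t)"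
    and g0: "g' t0 = 0" and g'': "(g' has_real_derivative c) (at t0)" and c: "c < 0"
  shows "\<exists>d>0. \<forall>t. t0 < t \<and> t < t0 + d \<longrightarrow> g t < g t0"
proof -
  obtain d1 where d1: "d1 > 0" "\<And>h. h > 0 \<Longrightarrow> h < d1 \<Longrightarrow> g' (t0 + h) < g' t0"
    using DERIV_neg_dec_right[OF g'' c] by blast
  obtain d2 where d2: "d2 > 0" "ball t0 d2 \<subseteq> S" using S open_contains_ball by blast
  have "g t < g t0" if t: "t0 < t" "t < t0 + min d1 d2" for t
  proof -
    have "s \<in> S" if "t0 \<le> s" "s \<le> t" for s
      using d2(2) that t by (intro subsetD[OF d2(2)]) (auto simp: dist_real_def)
    then obtain s where s: "t0 < s" "s < t" "g t - g t0 = (t - t0) * g' s"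
      using MVT2[OF t(1), of g g'] g by blast
    have "g' s < 0" using d1(2)[of "s - t0"] s t g0 by simp
    then show ?thesis using s t mult_pos_neg[of "t - t0" "g' s"] by linarith
  qed
  then show ?thesis using d1 d2 by (intro exI[of _ "min d1 d2"]) auto
qed

lemma open_pos_orthant: "open (pos_orthant :: (real ^ 'k::finite) set)"
proof -
  have "pos_orthant = (\<Inter>j. {x :: real ^ 'k. 0 < x $ j})" by (auto simp: pos_orthant_def)
  also have "open \<dots>" by (intro open_INT) (auto intro!: open_Collect_less continuous_intros)
  finally show ?thesis .
qed

lemma convex_pos_orthant: "convex (pos_orthant :: (real ^ 'k::finite) set)"
proof (rule convexI)
  fix x y :: "real ^ 'k" and u v :: real
  assume *: "x \<in> pos_orthant" "y \<in> pos_orthant" "0 \<le> u" "0 \<le> v" "u + v = 1"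
  have "0 < u * x $ j + v * y $ j" for j
    using * by (cases "u = 0") (auto simp: pos_orthant_def less_imp_le intro!: add_pos_nonneg)
  then show "u *\<^sub>R x + v *\<^sub>R y \<in> pos_orthant" by (simp add: pos_orthant_def)
qed

lemma inner_pos_orthant:
  fixes x y :: "real ^ 'k::finite"
  assumes "x \<in> pos_orthant" "y \<in> pos_orthant"
  shows "0 < x \<bullet> y"
  using assms unfolding inner_vec_def pos_orthant_def by (auto intro!: sum_pos)

context

  \<comment> \<open>Utility: order conditions and maximization under a budget\<close>
  fixes U :: "real ^ ('n::finite option) \<Rightarrow> real"
  assumes U: "admissible_utility U"
begin

lemma Ck_on_utility: "Ck_on k pos_orthant U"
  using U unfolding admissible_utility_def smooth_on_def by blast

lemma has_derivative_utility:
  assumes "x \<in> pos_orthant"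
  shows "(U has_derivative (\<lambda>h. gradient U x \<bullet> h)) (at x)"
proof -
  have D: "(U has_derivative frechet_derivative U (at x)) (at x)"
    using Ck_on_Suc_has_derivative[OF Ck_on_utility assms] .
  have "frechet_derivative U (at x) h = gradient U x \<bullet> h" for h
  proof -
    have lin: "linear (frechet_derivative U (at x))" using D has_derivative_linear by blast
    have "h = (\<Sum>j\<in>UNIV. h $ j *\<^sub>R axis j 1)"
      using basis_expansion[of h] by (simp add: scalar_mult_eq_scaleR)
    then have "frechet_derivative U (at x) h = frechet_derivative U (at x) (\<Sum>j\<in>UNIV. h $ j *\<^sub>R axis j 1)"
      by (rule arg_cong)
    then show ?thesis
      by (simp add: linear_sum[OF lin] linear_scale[OF lin] inner_vec_def gradient_def mult.commute)
  qed
  then have "frechet_derivative U (at x) = (\<lambda>h. gradient U x \<bullet> h)" by (rule ext)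
  with D show ?thesis by simp
qed

lemma frechet_utility:
  assumes "x \<in> pos_orthant"
  shows "frechet_derivative U (at x) = (\<lambda>h. gradient U x \<bullet> h)"
  using frechet_derivative_at[OF has_derivative_utility[OF assms]] by simp

lemma Ck_on_gradient: "Ck_on k pos_orthant (gradient U)"
  unfolding gradient_def
  by (rule Ck_on_vecI[OF open_pos_orthant]) (simp add: Ck_on_Suc_frechet[OF Ck_on_utility])

lemma has_derivative_gradient:
  assumes "x \<in> pos_orthant"
  shows "(gradient U has_derivative frechet_derivative (gradient U) (at x)) (at x)"
  using Ck_on_Suc_has_derivative[OF Ck_on_gradient assms] .

lemma gradient_pos: "x \<in> pos_orthant \<Longrightarrow> gradient U x \<in> pos_orthant"
  using U unfolding admissible_utility_def by blast

lemma second_derivative_utility: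
  assumes x: "x \<in> pos_orthant"
  shows "second_derivative U x h k = frechet_derivative (gradient U) (at x) k \<bullet> h"
proof -
  have "((\<lambda>y. gradient U y \<bullet> h) has_derivative (\<lambda>k. frechet_derivative (gradient U) (at x) k \<bullet> h)) (at x)"
    by (rule has_derivative_inner_left[OF has_derivative_gradient[OF x]])
  then have "((\<lambda>y. frechet_derivative U (at y) h) has_derivative
      (\<lambda>k. frechet_derivative (gradient U) (at x) k \<bullet> h)) (at x)"
    by (rule has_derivative_transform_within_open[OF _ open_pos_orthant x]) (simp add: frechet_utility)
  then show ?thesis unfolding second_derivative_def
    by (simp flip: frechet_derivative_at)
qed

lemma hessian_neg:
  assumes "x \<in> pos_orthant" "h \<noteq> 0" "gradient U x \<bullet> h = 0"
  shows "frechet_derivative (gradient U) (at x) h \<bullet> h < 0"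
proof -
  have "second_derivative U x h h < 0"
    using U assms unfolding admissible_utility_def by blast
  then show ?thesis by (simp add: second_derivative_utility assms)
qed

lemma has_derivative_utility_line:
  assumes "x + t *\<^sub>R h \<in> pos_orthant"
  shows "((\<lambda>t. U (x + t *\<^sub>R h)) has_real_derivative gradient U (x + t *\<^sub>R h) \<bullet> h) (at t)"
proof -
  have "((\<lambda>t. x + t *\<^sub>R h) has_derivative (\<lambda>s. s *\<^sub>R h)) (at t)"
    by (auto intro!: derivative_eq_intros)
  from has_derivative_compose[OF this has_derivative_utility[OF assms]]
  show ?thesis by (simp add: has_field_derivative_def mult_commute_abs)
qed

lemma has_derivative_gradient_line:
  assumes "x + t *\<^sub>R h \<in> pos_orthant"
  shows "((\<lambda>t. gradient U (x + t *\<^sub>R h) \<bullet> h) has_real_derivative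
    frechet_derivative (gradient U) (at (x + t *\<^sub>R h)) h \<bullet> h) (at t)"
proof -
  have "((\<lambda>t. x + t *\<^sub>R h) has_derivative (\<lambda>s. s *\<^sub>R h)) (at t)"
    by (auto intro!: derivative_eq_intros)
  from has_derivative_inner_left[OF has_derivative_compose[OF this has_derivative_gradient[OF assms]], of h]
  show ?thesis
    using linear_scale[OF has_derivative_linear[OF has_derivative_gradient[OF assms]]]
    by (simp add: has_field_derivative_def mult_commute_abs)
qed

lemma utility_strict_mono:
  assumes x: "x \<in> pos_orthant" and d: "d \<in> pos_orthant"
  shows "U x < U (x + d)"
proof -
  have in_pos: "x + t *\<^sub>R d \<in> pos_orthant" if "0 \<le> t" for t
    using x d that by (simp add: pos_orthant_def add_pos_nonneg less_imp_le)
  then obtain s where "0 < s" "s < 1" "U (x + 1 *\<^sub>R d) - U (x + 0 *\<^sub>R d) = (1 - 0) * (gradient U (x + s *\<^sub>R d) \<bullet> d)"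
    using MVT2[of 0 1 "\<lambda>t. U (x + t *\<^sub>R d)" "\<lambda>t. gradient U (x + t *\<^sub>R d) \<bullet> d"]
      has_derivative_utility_line by (metis zero_less_one)
  moreover from this have "0 < gradient U (x + s *\<^sub>R d) \<bullet> d"
    using inner_pos_orthant[OF gradient_pos[OF in_pos] d] by simp
  ultimately show ?thesis by simp
qed

text \<open>At an interior minimum of \<open>U\<close> on the segment from \<open>x\<close> to \<open>y\<close>, as at \<open>x\<close> itself,
  the direction of the segment is tangent to the indifference surface, which by the second-order
  condition is incompatible with minimality.\<close>

lemma critical_point_strict_max_hyperplane:
  assumes x: "x \<in> pos_orthant" and y: "y \<in> pos_orthant" "y \<noteq> x"
    and tangent: "gradient U x \<bullet> (y - x) = 0"
  shows "U y < U x"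
proof (rule ccontr)
  define h where "h = y - x"
  define g where "g t = U (x + t *\<^sub>R h)" for t
  define S where "S = {t. x + t *\<^sub>R h \<in> pos_orthant}"
  assume "\<not> U y < U x"
  then have ends: "g 0 \<le> g 1" by (simp add: g_def h_def)
  have "open S" unfolding S_def
    by (rule open_vimage[OF open_pos_orthant, unfolded vimage_def]) (auto intro!: continuous_intros)
  have inS: "{0..1} \<subseteq> S"
  proof
    fix t :: real assume "t \<in> {0..1}"
    then have "(1 - t) *\<^sub>R x + t *\<^sub>R y \<in> pos_orthant"
      using convexD[OF convex_pos_orthant x y(1)] by simp
    then show "t \<in> S" by (simp add: S_def h_def algebra_simps)
  qed
  have g1: "(g has_real_derivative gradient U (x + t *\<^sub>R h) \<bullet> h) (at t)" if "t \<in> S" for t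
    using has_derivative_utility_line that unfolding g_def S_def by blast
  have contg: "continuous_on {0..1} g"
    using g1 inS by (meson DERIV_isCont continuous_at_imp_continuous_on subsetD)
  obtain t1 where t1: "t1 \<in> {0..1}" "\<And>t. t \<in> {0..1} \<Longrightarrow> g t1 \<le> g t"
    using continuous_attains_inf[OF compact_Icc _ contg] by auto
  \<comment> \<open>A minimum at the right end is exchanged for the left end, which is then a
    minimum too by \<open>ends\<close>. This leaves room to the right of \<open>t0\<close>.\<close>
  define t0 where "t0 = (if t1 = 1 then 0 else t1)"
  have t0: "0 \<le> t0" "t0 < 1" "\<And>t. t \<in> {0..1} \<Longrightarrow> g t0 \<le> g t"
    using t1 ends unfolding t0_def by (auto intro: order_trans)
  have t0S: "t0 \<in> S" using t0 inS by auto
  have crit: "gradient U (x + t0 *\<^sub>R h) \<bullet> h = 0"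
  proof (cases "t0 = 0")
    case True
    then show ?thesis using tangent by (simp add: h_def)
  next
    case False
    then have "0 < min t0 (1 - t0)" using t0 by simp
    then show ?thesis
      by (rule DERIV_local_min[OF g1[OF t0S]]) (use t0 in \<open>auto simp: abs_less_iff\<close>)
  qed
  have "h \<noteq> 0" using y by (simp add: h_def)
  obtain d where d: "d > 0" "\<And>t. t0 < t \<Longrightarrow> t < t0 + d \<Longrightarrow> g t < g t0"
    using second_order_strict_local_max[OF \<open>open S\<close> t0S g1 crit has_derivative_gradient_line hessian_neg]
      t0S \<open>h \<noteq> 0\<close> crit unfolding S_def by blast
  have "g (t0 + min d (1 - t0) / 2) < g t0" using d t0 by (intro d(2)) (auto simp: min_def)
  moreover have "t0 + min d (1 - t0) / 2 \<in> {0..1}" using t0 d(1) by (auto simp: min_def field_simps)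
  ultimately show False using t0(3) by force
qed

text \<open>A bundle strictly inside the budget is raised along the diagonal until it costs as much
  as \<open>x\<close>. This increases its utility and brings it to the hyperplane case, or to
  \<open>x\<close> itself.\<close>

lemma critical_point_strict_max:
  assumes x: "x \<in> pos_orthant" and y: "y \<in> pos_orthant" "y \<noteq> x" and P: "P \<in> pos_orthant"
    and c: "gradient U x = c *\<^sub>R P" and budget: "P \<bullet> y \<le> P \<bullet> x"
  shows "U y < U x"
proof (cases "P \<bullet> y = P \<bullet> x")
  case True
  then show ?thesis
    using critical_point_strict_max_hyperplane[OF x y] c by (simp add: inner_diff_right)
next
  case False
  define s where "s = (P \<bullet> x - P \<bullet> y) / (P \<bullet> 1)"
  have one: "(1 :: real ^ 'n option) \<in> pos_orthant" by (simp add: pos_orthant_def)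
  have "0 < P \<bullet> 1" using inner_pos_orthant[OF P one] .
  then have "s > 0" "s * (P \<bullet> 1) = P \<bullet> x - P \<bullet> y" using False budget by (auto simp: s_def)
  define y' where "y' = y + s *\<^sub>R 1"
  have d: "s *\<^sub>R (1 :: real ^ 'n option) \<in> pos_orthant" using \<open>s > 0\<close> by (simp add: pos_orthant_def)
  have less: "U y < U y'" unfolding y'_def by (rule utility_strict_mono[OF y(1) d])
  have y': "y' \<in> pos_orthant" using y(1) d by (simp add: y'_def pos_orthant_def add_pos_pos)
  show ?thesis
  proof (cases "y' = x")
    case False
    have "P \<bullet> y' = P \<bullet> x"
      using \<open>s * (P \<bullet> 1) = _\<close> by (simp add: y'_def inner_add_right)
    then have "U y' < U x"
      using critical_point_strict_max_hyperplane[OF x y' False] c by (simp add: inner_diff_right)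
    with less show ?thesis by simp
  qed (use less in simp)
qed

text \<open>A sequence in an upper level set that approached the boundary of the orthant could be
  rescaled to one in an indifference surface that does the same.\<close>

lemma closed_upper_level_set:
  assumes a: "a \<in> pos_orthant"
  shows "closed {x \<in> pos_orthant. U a \<le> U x}"
  unfolding closed_sequential_limits
proof (intro allI impI, elim conjE)
  fix X x assume X: "\<forall>k. X k \<in> {x \<in> pos_orthant. U a \<le> U x}" and lim: "X \<longlonglongrightarrow> x"
  have Xp: "X k \<in> pos_orthant" and XU: "U a \<le> U (X k)" for k using X by auto
  have "\<exists>t. 0 < t \<and> t \<le> 1 \<and> U (t *\<^sub>R X k) = U a" for k
  proof -
    define m where "m = Min (range (($) a))"
    have m: "0 < m" "\<And>j. m \<le> a $ j"
      using a by (auto simp: m_def pos_orthant_def)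
    \<comment> \<open>Small enough that the rescaled point lies strictly below \<open>a\<close> in
      every coordinate, hence below its utility level; the intermediate value theorem then finds a
      scaling on the indifference surface.\<close>
    define s where "s = min 1 (m / (norm (X k) + 1))"
    have s: "0 < s" "s \<le> 1" using m by (auto simp: s_def intro!: divide_pos_pos add_nonneg_pos)
    have "s * X k $ j < a $ j" for j
    proof -
      have "X k $ j \<le> norm (X k)" using component_le_norm_cart abs_le_D1 by blast
      then have "s * X k $ j \<le> s * norm (X k)" using s by simp
      also have "\<dots> < s * (norm (X k) + 1)" using s by simp
      also have "\<dots> \<le> m / (norm (X k) + 1) * (norm (X k) + 1)"
        by (intro mult_right_mono) (auto simp: s_def)
      also have "\<dots> = m" by (simp add: add_nonneg_eq_0_iff)
      finally show ?thesis using m(2)[of j] by simp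
    qed
    then have "a - s *\<^sub>R X k \<in> pos_orthant" by (simp add: pos_orthant_def)
    moreover have pos: "t *\<^sub>R X k \<in> pos_orthant" if "0 < t" for t
      using Xp[of k] that by (simp add: pos_orthant_def)
    ultimately have low: "U (s *\<^sub>R X k) \<le> U a"
      using utility_strict_mono[OF pos[OF s(1)], of "a - s *\<^sub>R X k"] by simp
    have "continuous_on {s..1} (\<lambda>t. U (t *\<^sub>R X k))"
      by (rule continuous_on_compose2[OF Ck_on_imp_continuous_on[OF Ck_on_utility[of 0]]])
        (use pos s in \<open>auto intro!: continuous_intros\<close>)
    with low XU[of k] s obtain t where "s \<le> t" "t \<le> 1" "U (t *\<^sub>R X k) = U a"
      using IVT'[of "\<lambda>t. U (t *\<^sub>R X k)" s "U a" 1] by auto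
    then show ?thesis using s by (intro exI[of _ t]) auto
  qed
  then obtain T where T: "\<And>k. 0 < T k" "\<And>k. T k \<le> 1" "\<And>k. U (T k *\<^sub>R X k) = U a" by metis
  have "\<forall>k. T k \<in> {0..1}" using T by (auto simp: less_imp_le)
  then obtain \<tau> r where r: "strict_mono r" "(T \<circ> r) \<longlonglongrightarrow> \<tau>"
    using compact_Icc[of 0 "1::real"] unfolding compact_def by metis
  have "(\<lambda>k. T (r k) *\<^sub>R X (r k)) \<longlonglongrightarrow> \<tau> *\<^sub>R x"
    using r(2) LIMSEQ_subseq_LIMSEQ[OF lim r(1)] by (auto intro!: tendsto_scaleR simp: o_def)
  moreover have "closed {x \<in> pos_orthant. U x = U a}"
    using U unfolding admissible_utility_def by blast
  moreover have "T (r k) *\<^sub>R X (r k) \<in> {x \<in> pos_orthant. U x = U a}" for k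
    using T Xp[of "r k"] by (auto simp: pos_orthant_def)
  \<comment> \<open>The necessity condition puts the limit of the rescaled points inside the open
    orthant. Hence no coordinate of the nonnegative vector \<open>x\<close> can vanish.\<close>
  ultimately have "\<tau> *\<^sub>R x \<in> {x \<in> pos_orthant. U x = U a}"
    using closed_sequentially[of "{x \<in> pos_orthant. U x = U a}" "\<lambda>k. T (r k) *\<^sub>R X (r k)"] by blast
  then have "\<tau> *\<^sub>R x \<in> pos_orthant" by simp
  moreover have "0 \<le> x $ j" for j
    using Xp by (intro LIMSEQ_le_const[OF tendsto_vec_nth[OF lim]]) (auto simp: pos_orthant_def less_imp_le)
  ultimately have x: "x \<in> pos_orthant"
    unfolding pos_orthant_def by (auto simp: less_le)
  have "isCont U x"
    using Ck_on_imp_continuous_on[OF Ck_on_utility[of 0]] x open_pos_orthant continuous_on_eq_continuous_at by blast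
  then have "(\<lambda>k. U (X k)) \<longlonglongrightarrow> U x" using lim isCont_tendsto_compose by blast
  then have "U a \<le> U x" using XU by (intro LIMSEQ_le_const) auto
  with x show "x \<in> {x \<in> pos_orthant. U a \<le> U x}" by simp
qed

text \<open>The budget set is not closed in the whole space, as the orthant is open. Cutting it down
  to the bundles at least as good as one affordable bundle makes it compact without losing any
  maximizer.\<close>

lemma utility_maximizer_exists:
  assumes P: "P \<in> pos_orthant" and w: "0 < w"
  shows "\<exists>x\<in>pos_orthant. P \<bullet> x \<le> w \<and> (\<forall>y\<in>pos_orthant. P \<bullet> y \<le> w \<longrightarrow> U y \<le> U x)"
proof -
  \<comment> \<open>The bundle on the diagonal that costs exactly \<open>w\<close>.\<close>
  define a :: "real ^ 'n option" where "a = (w / (P \<bullet> 1)) *\<^sub>R 1"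
  have one: "(1 :: real ^ 'n option) \<in> pos_orthant" by (simp add: pos_orthant_def)
  have P1: "0 < P \<bullet> 1" using inner_pos_orthant[OF P one] .
  have a: "a \<in> pos_orthant" "P \<bullet> a = w" using P1 w by (auto simp: a_def pos_orthant_def)
  define B where "B = {x \<in> pos_orthant. U a \<le> U x} \<inter> {x. P \<bullet> x \<le> w}"
  have "closed B" unfolding B_def
    by (intro closed_Int closed_upper_level_set a closed_halfspace_le)
  moreover have "bounded B"
  proof -
    have "norm x \<le> (\<Sum>j\<in>UNIV. w / P $ j)" if "x \<in> B" for x
    proof -
      have x: "\<And>j. 0 < x $ j" "P \<bullet> x \<le> w" using that by (auto simp: B_def pos_orthant_def)
      have Pj: "0 < P $ j" for j using P by (simp add: pos_orthant_def)
      have "\<bar>x $ j\<bar> \<le> w / P $ j" for j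
      proof -
        have "P $ j * x $ j \<le> (\<Sum>i\<in>UNIV. P $ i * x $ i)"
          using x(1) Pj by (intro member_le_sum) (auto simp: less_imp_le)
        also have "\<dots> \<le> w" using x(2) by (simp add: inner_vec_def)
        finally show ?thesis using x(1)[of j] Pj[of j] by (simp add: pos_le_divide_eq mult.commute)
      qed
      then show ?thesis by (intro order_trans[OF norm_le_l1_cart sum_mono])
    qed
    then show ?thesis using boundedI by blast
  qed
  ultimately have "compact B" using compact_eq_bounded_closed by blast
  moreover have "a \<in> B" using a by (simp add: B_def)
  moreover have "continuous_on B U"
    by (rule continuous_on_subset[OF Ck_on_imp_continuous_on[OF Ck_on_utility[of 0]]]) (auto simp: B_def)
  ultimately obtain x where x: "x \<in> B" "\<And>y. y \<in> B \<Longrightarrow> U y \<le> U x"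
    using continuous_attains_sup[of B U] by blast
  have "U y \<le> U x" if "y \<in> pos_orthant" "P \<bullet> y \<le> w" for y
  proof (cases "U a \<le> U y")
    case True
    then show ?thesis using that x(2) by (simp add: B_def)
  next
    case False
    then show ?thesis using x(2)[OF \<open>a \<in> B\<close>] by simp
  qed
  with x(1) show ?thesis by (auto simp: B_def)
qed

text \<open>Every direction orthogonal to \<open>P\<close> stays within the budget, so the gradient
  vanishes on all of them and must be parallel to \<open>P\<close>. Unspent income could buy a
  little more of every good.\<close>

lemma utility_maximizer_critical:
  assumes P: "P \<in> pos_orthant" and x: "x \<in> pos_orthant" "P \<bullet> x \<le> w"
    and max: "\<And>y. y \<in> pos_orthant \<Longrightarrow> P \<bullet> y \<le> w \<Longrightarrow> U y \<le> U x"
  shows "P \<bullet> x = w" "\<exists>c. gradient U x = c *\<^sub>R P"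
proof -
  have zero: "gradient U x \<bullet> d = 0" if "P \<bullet> d = 0" for d
  proof -
    define g where "g t = U (x + t *\<^sub>R d)" for t
    have D: "(g has_real_derivative gradient U (x + 0 *\<^sub>R d) \<bullet> d) (at 0)"
      unfolding g_def by (rule has_derivative_utility_line) (use x in simp)
    have "open {t. x + t *\<^sub>R d \<in> pos_orthant}"
      by (rule open_vimage[OF open_pos_orthant, unfolded vimage_def]) (auto intro!: continuous_intros)
    moreover have "0 \<in> {t. x + t *\<^sub>R d \<in> pos_orthant}" using x by simp
    ultimately obtain e where e: "e > 0" "ball 0 e \<subseteq> {t. x + t *\<^sub>R d \<in> pos_orthant}"
      using open_contains_ball by blast
    have "\<forall>t. \<bar>0 - t\<bar> < e \<longrightarrow> g t \<le> g 0"
      using e(2) that x by (auto simp: g_def inner_add_right subset_iff intro!: max)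
    from DERIV_local_max[OF D e(1) this] show ?thesis by simp
  qed
  \<comment> \<open>The coefficient of the orthogonal projection of the gradient to the line of
    \<open>P\<close>; the remainder \<open>d\<close> costs nothing and is therefore orthogonal to
    the gradient as well.\<close>
  define c where "c = gradient U x \<bullet> P / (P \<bullet> P)"
  have PP: "P \<bullet> P \<noteq> 0" using inner_pos_orthant[OF P P] by simp
  define d where "d = gradient U x - c *\<^sub>R P"
  have Pd: "P \<bullet> d = 0" using PP by (simp add: d_def c_def inner_diff_right inner_commute)
  have "d \<bullet> d = gradient U x \<bullet> d - c * (P \<bullet> d)" by (simp add: d_def inner_diff_left)
  also have "\<dots> = 0" using zero[OF Pd] Pd by simp
  finally show "\<exists>c. gradient U x = c *\<^sub>R P" by (auto simp: d_def)
  show "P \<bullet> x = w"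
  proof (rule ccontr)
    assume "P \<bullet> x \<noteq> w"
    define s where "s = (w - P \<bullet> x) / (P \<bullet> 1)"
    have one: "(1 :: real ^ 'n option) \<in> pos_orthant" by (simp add: pos_orthant_def)
    have P1: "0 < P \<bullet> 1" using inner_pos_orthant[OF P one] .
    then have s: "0 < s" "s * (P \<bullet> 1) = w - P \<bullet> x" using x \<open>P \<bullet> x \<noteq> w\<close> by (auto simp: s_def)
    have "s *\<^sub>R (1 :: real ^ 'n option) \<in> pos_orthant" using s by (simp add: pos_orthant_def)
    moreover from this have "x + s *\<^sub>R 1 \<in> pos_orthant" using x by (simp add: pos_orthant_def add_pos_pos)
    moreover have "P \<bullet> (x + s *\<^sub>R 1) \<le> w" using s by (simp add: inner_add_right)
    ultimately show False using utility_strict_mono[OF x(1), of "s *\<^sub>R 1"] max[of "x + s *\<^sub>R 1"] by simp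
  qed
qed

end

section \<open>Demand as the inverse of a smooth map\<close>

text \<open>\<open>supporting_budget U x\<close> collects the normalized prices and the income at which \<open>x\<close> is
  demanded, with the income in the slot of the numeraire; demand is its inverse.\<close>

definition supporting_budget :: "(real ^ ('n::finite option) \<Rightarrow> real) \<Rightarrow> real ^ 'n option \<Rightarrow> real ^ 'n option" where
  "supporting_budget U x = (\<chi> j. case j of None \<Rightarrow> gradient U x \<bullet> x / gradient U x $ None
     | Some k \<Rightarrow> gradient U x $ Some k / gradient U x $ None)"

text \<open>The part of \<open>p\<close> and \<open>a\<close> that demand depends on, in the layout
  of \<open>supporting_budget\<close>.\<close>

definition budget :: "real ^ 'n \<Rightarrow> real ^ ('n::finite option) \<Rightarrow> real ^ 'n option" where
  "budget p a = (\<chi> j. case j of None \<Rightarrow> full_price p \<bullet> a | Some k \<Rightarrow> p $ k)"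

lemma full_price_pos: "p \<in> pos_orthant \<Longrightarrow> full_price p \<in> pos_orthant"
  by (auto simp: pos_orthant_def full_price_def split: option.split)

lemma budget_pos: "p \<in> pos_orthant \<Longrightarrow> 0 < full_price p \<bullet> a \<Longrightarrow> budget p a \<in> pos_orthant"
  by (auto simp: pos_orthant_def budget_def split: option.split)

text \<open>The whole income is placed on the numeraire, so \<open>a\<close> lies on the boundary of
  the orthant. This is why the facts on demand assume a positive income rather than a positive
  endowment.\<close>

lemma pos_orthant_budgetE:
  assumes "q \<in> pos_orthant"
  obtains p a where "p \<in> pos_orthant" "0 < full_price p \<bullet> a" "q = budget p a"
proof
  define p where "p = (\<chi> k. q $ Some k)"
  define a :: "real ^ 'a option" where "a = axis None (q $ None)"
  have *: "full_price p \<bullet> a = q $ None" by (simp add: a_def inner_axis full_price_def)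
  show "p \<in> pos_orthant" using assms by (simp add: p_def pos_orthant_def)
  show "0 < full_price p \<bullet> a" using assms * by (simp add: pos_orthant_def)
  have "budget p a $ j = q $ j" for j
    by (cases j) (simp_all add: budget_def * flip: p_def, simp add: p_def)
  then show "q = budget p a" by (simp add: vec_eq_iff)
qed

context
  fixes U :: "real ^ ('n::finite option) \<Rightarrow> real"
  assumes U: "admissible_utility U"
begin

text \<open>The right-hand side is the Lagrange condition with budget balance. As the numeraire has
  price 1, the multiplier can only be the numeraire component of the gradient.\<close>

lemma supporting_budget_eq_iff:
  assumes x: "x \<in> pos_orthant"
  shows "supporting_budget U x = budget p a \<longleftrightarrow>
    (\<exists>c. gradient U x = c *\<^sub>R full_price p) \<and> full_price p \<bullet> x = full_price p \<bullet> a"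
proof -
  define g where "g = gradient U x"
  have gN: "0 < g $ None" using gradient_pos[OF U x] by (simp add: g_def pos_orthant_def)
  have 1: "supporting_budget U x = budget p a \<longleftrightarrow>
      (\<forall>k. g $ Some k = g $ None * p $ k) \<and> g \<bullet> x = g $ None * (full_price p \<bullet> a)"
    using gN unfolding supporting_budget_def budget_def vec_eq_iff
    by (auto simp: split_option_all g_def[symmetric] field_simps)
  have 2: "(\<exists>c. g = c *\<^sub>R full_price p) \<longleftrightarrow> g = (g $ None) *\<^sub>R full_price p"
    by (auto simp: full_price_def vec_eq_iff)
  have 3: "g = (g $ None) *\<^sub>R full_price p \<longleftrightarrow> (\<forall>k. g $ Some k = g $ None * p $ k)"
    by (auto simp: full_price_def vec_eq_iff split_option_all)
  show ?thesis unfolding 1 g_def[symmetric] 2 unfolding 3[symmetric]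
    using gN by (metis inner_scaleR_left less_irrefl mult_left_cancel)
qed

text \<open>The maximizers in the budget set are exactly the solutions of the first-order system: it
  is necessary by \<open>utility_maximizer_critical\<close> and sufficient by
  \<open>critical_point_strict_max\<close>. Existence and uniqueness then resolve the definite
  description in \<open>demand\<close>.\<close>

lemma demand_properties:
  assumes p: "p \<in> pos_orthant" and a: "0 < full_price p \<bullet> a"
  shows "demand U p a \<in> pos_orthant" "supporting_budget U (demand U p a) = budget p a"
    and "\<And>x. x \<in> pos_orthant \<Longrightarrow> supporting_budget U x = budget p a \<Longrightarrow> x = demand U p a"
proof -
  note P = full_price_pos[OF p]
  have max: "x \<in> budget_set p a \<and> (\<forall>y\<in>budget_set p a. U y \<le> U x) \<longleftrightarrow>
      x \<in> pos_orthant \<and> supporting_budget U x = budget p a" (is "?L x \<longleftrightarrow> ?R x") for x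
  proof
    assume "?L x"
    then show "?R x"
      using supporting_budget_eq_iff utility_maximizer_critical[OF U P, of x "full_price p \<bullet> a"]
      by (auto simp: budget_set_def)
  next
    assume R: "?R x"
    then obtain c where c: "x \<in> pos_orthant" "gradient U x = c *\<^sub>R full_price p"
        "full_price p \<bullet> x = full_price p \<bullet> a"
      using supporting_budget_eq_iff by blast
    have "U y \<le> U x" if "y \<in> budget_set p a" for y
      using critical_point_strict_max[OF U c(1) _ _ P c(2), of y] that c
      by (cases "y = x") (auto simp: budget_set_def less_imp_le)
    then show "?L x" using c by (auto simp: budget_set_def)
  qed
  \<comment> \<open>Of two distinct solutions with the same cost, each would be strictly better than
    the other.\<close>
  have unique: "x = y" if x: "?R x" and y: "?R y" for x y
  proof (rule ccontr)
    assume ne: "x \<noteq> y"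
    obtain c where c: "gradient U x = c *\<^sub>R full_price p" "full_price p \<bullet> x = full_price p \<bullet> a"
      using x supporting_budget_eq_iff by blast
    obtain d where d: "gradient U y = d *\<^sub>R full_price p" "full_price p \<bullet> y = full_price p \<bullet> a"
      using y supporting_budget_eq_iff by blast
    show False
      using critical_point_strict_max[OF U _ _ _ P c(1), of y]
        critical_point_strict_max[OF U _ _ _ P d(1), of x] x y ne c d by auto
  qed
  obtain x where x: "?R x"
    using utility_maximizer_exists[OF U P a] max unfolding budget_set_def by auto
  have "demand U p a = x"
    unfolding demand_def max by (rule the_equality) (use x unique in auto)
  with x unique show "demand U p a \<in> pos_orthant" "supporting_budget U (demand U p a) = budget p a"
    and "\<And>x. x \<in> pos_orthant \<Longrightarrow> supporting_budget U x = budget p a \<Longrightarrow> x = demand U p a"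
    by auto
qed

lemma demand_budget:
  assumes "p \<in> pos_orthant" "0 < full_price p \<bullet> a"
  shows "full_price p \<bullet> demand U p a = full_price p \<bullet> a"
  using demand_properties(1,2)[OF assms] supporting_budget_eq_iff by blast

text \<open>Surjectivity is the existence of demand, injectivity its uniqueness.\<close>

lemma bij_betw_supporting_budget: "bij_betw (supporting_budget U) pos_orthant pos_orthant"
proof (rule bij_betw_imageI)
  have pos: "supporting_budget U x \<in> pos_orthant" if "x \<in> pos_orthant" for x
    using gradient_pos[OF U that] inner_pos_orthant[OF gradient_pos[OF U that] that]
    by (auto simp: pos_orthant_def supporting_budget_def split: option.split)
  show "inj_on (supporting_budget U) pos_orthant"
  proof (rule inj_onI)
    fix x y assume x: "x \<in> pos_orthant" and y: "y \<in> pos_orthant"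
      and eq: "supporting_budget U x = supporting_budget U y"
    obtain p a where "p \<in> pos_orthant" "0 < full_price p \<bullet> a" "supporting_budget U x = budget p a"
      using pos_orthant_budgetE[OF pos[OF x]] .
    then show "x = y" using demand_properties(3) x y eq by metis
  qed
  show "supporting_budget U ` pos_orthant = pos_orthant"
  proof (intro equalityI subsetI)
    fix q :: "real ^ 'n option" assume "q \<in> pos_orthant"
    then show "q \<in> supporting_budget U ` pos_orthant"
      by (elim pos_orthant_budgetE) (metis demand_properties(1,2) image_eqI)
  qed (use pos in auto)
qed

lemma Ck_on_supporting_budget: "Ck_on k pos_orthant (supporting_budget U)"
proof (rule Ck_on_vecI[OF open_pos_orthant])
  fix j
  have "gradient U x $ None \<noteq> 0" if "x \<in> pos_orthant" for x
    using gradient_pos[OF U that] by (auto simp: pos_orthant_def less_le)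
  then show "Ck_on k pos_orthant (\<lambda>x. supporting_budget U x $ j)"
    by (cases j) (auto simp: supporting_budget_def intro!: Ck_on_divide open_pos_orthant Ck_on_vec_nth
      Ck_on_gradient[OF U] Ck_on_inner Ck_on_linear[OF bounded_linear_ident])
qed

text \<open>If the prices supporting \<open>x\<close> are stationary in direction \<open>h\<close>, then the gradient moves
  parallel to itself; if the income is stationary as well, then \<open>h\<close> is tangent to the indifference
  surface, and the Hessian vanishes on it.\<close>

lemma supporting_budget_derivative_inj:
  assumes x: "x \<in> pos_orthant" and h: "frechet_derivative (supporting_budget U) (at x) h = 0"
  shows "h = 0"
proof (rule ccontr)
  assume "h \<noteq> 0"
  define g where "g = gradient U"
  define G where "G = supporting_budget U"
  define g' where "g' = frechet_derivative g (at x)"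
  define G' where "G' = frechet_derivative G (at x)"
  have dg: "(g has_derivative g') (at x)"
    unfolding g_def g'_def using has_derivative_gradient[OF U x] .
  have dG: "(G has_derivative G') (at x)"
    unfolding G_def G'_def using Ck_on_Suc_has_derivative[OF Ck_on_supporting_budget x] .
  have G'h: "G' h = 0" using h by (simp add: G'_def G_def)
  have gpos: "0 < g y $ None" if "y \<in> pos_orthant" for y
    using gradient_pos[OF U that] by (simp add: g_def pos_orthant_def)
  define \<mu> where "\<mu> = g' h $ None / g x $ None"
  have mu: "g' h $ None = \<mu> * g x $ None" using gpos[OF x] by (simp add: \<mu>_def)
  \<comment> \<open>Differentiating the identity \<open>eq\<close> in direction \<open>h\<close>,
    where the differential of \<open>G\<close> vanishes, shows that the gradient changes by the
    factor \<open>\<mu>\<close> in every component.\<close>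
  have price: "g' h $ Some k = \<mu> * g x $ Some k" for k
  proof -
    have eq: "G y $ Some k * g y $ None = g y $ Some k" if "y \<in> pos_orthant" for y
      using gpos[OF that] by (simp add: G_def supporting_budget_def g_def)
    have "((\<lambda>y. G y $ Some k * g y $ None) has_derivative
        (\<lambda>h. G x $ Some k * g' h $ None + G' h $ Some k * g x $ None)) (at x)"
      by (intro has_derivative_mult bounded_linear.has_derivative[OF bounded_linear_vec_nth] dg dG)
    then have "((\<lambda>y. g y $ Some k) has_derivative
        (\<lambda>h. G x $ Some k * g' h $ None + G' h $ Some k * g x $ None)) (at x)"
      by (rule has_derivative_transform_within_open[OF _ open_pos_orthant x]) (rule eq)
    from has_derivative_unique[OF this bounded_linear.has_derivative[OF bounded_linear_vec_nth dg]]
    have "g' h $ Some k = G x $ Some k * g' h $ None + G' h $ Some k * g x $ None" by metis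
    then show ?thesis using G'h eq[OF x] mu by (simp add: algebra_simps)
  qed
  have g'h: "g' h = \<mu> *\<^sub>R g x"
    using mu price by (simp add: vec_eq_iff split_option_all)
  \<comment> \<open>The same for the income identity: its two product rules differ only by the term
    \<open>g x \<bullet> h\<close> once the multiples of \<open>\<mu>\<close> cancel.\<close>
  have "((\<lambda>y. G y $ None * g y $ None) has_derivative
      (\<lambda>h. G x $ None * g' h $ None + G' h $ None * g x $ None)) (at x)"
    by (intro has_derivative_mult bounded_linear.has_derivative[OF bounded_linear_vec_nth] dg dG)
  moreover have "G y $ None * g y $ None = g y \<bullet> y" if "y \<in> pos_orthant" for y
    using gpos[OF that] by (simp add: G_def supporting_budget_def g_def)
  ultimately have D: "((\<lambda>y. g y \<bullet> y) has_derivative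
      (\<lambda>h. G x $ None * g' h $ None + G' h $ None * g x $ None)) (at x)"
    by (elim has_derivative_transform_within_open[OF _ open_pos_orthant x])
  have "((\<lambda>y. g y \<bullet> y) has_derivative (\<lambda>h. g x \<bullet> h + g' h \<bullet> x)) (at x)"
    by (intro has_derivative_inner dg has_derivative_ident)
  from fun_cong[OF has_derivative_unique[OF this D], of h]
  have "g x \<bullet> h + g' h \<bullet> x = G x $ None * g' h $ None + G' h $ None * g x $ None" .
  moreover have "G x $ None * g x $ None = g x \<bullet> x"
    using gpos[OF x] by (simp add: G_def supporting_budget_def g_def)
  ultimately have "g x \<bullet> h = 0"
    using G'h g'h by (simp add: algebra_simps)
  then show False
    using hessian_neg[OF U x \<open>h \<noteq> 0\<close>] g'h by (simp add: g_def g'_def)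
qed

text \<open>A continuous injection of an open set into a space of the same dimension has a
  continuous inverse, by invariance of domain. This is the continuity from which
  \<open>Ck_on_local_inverse\<close> starts.\<close>

lemma continuous_on_inv_supporting_budget:
  "continuous_on pos_orthant (inv_into pos_orthant (supporting_budget U))"
proof -
  have "continuous_on (supporting_budget U ` pos_orthant) (inv_into pos_orthant (supporting_budget U))"
    using bij_betw_supporting_budget
    by (intro continuous_on_inverse_open[OF open_pos_orthant Ck_on_imp_continuous_on[OF Ck_on_supporting_budget[of 0]]])
      (auto simp: bij_betw_def)
  then show ?thesis using bij_betw_supporting_budget by (simp add: bij_betw_def)
qed

lemma Ck_on_inv_supporting_budget:
  "Ck_on k pos_orthant (inv_into pos_orthant (supporting_budget U))"
proof (rule Ck_on_local_inverse[OF Ck_on_supporting_budget open_pos_orthant open_pos_orthant _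
      continuous_on_inv_supporting_budget _ supporting_budget_derivative_inj])
  show "inv_into pos_orthant (supporting_budget U) ` pos_orthant \<subseteq> pos_orthant"
    using bij_betw_supporting_budget by (metis bij_betw_def bij_betw_inv_into order_refl)
  show "supporting_budget U (inv_into pos_orthant (supporting_budget U) y) = y" if "y \<in> pos_orthant" for y
    using bij_betw_supporting_budget that by (metis bij_betw_inv_into_right)
qed

lemma demand_eq_inv:
  assumes "p \<in> pos_orthant" "0 < full_price p \<bullet> a"
  shows "demand U p a = inv_into pos_orthant (supporting_budget U) (budget p a)"
  using demand_properties(1,2)[OF assms] bij_betw_supporting_budget
  by (metis bij_betw_inv_into_left)

end

lemma Ck_on_full_price:
  assumes "open A" "Ck_on k A f"
  shows "Ck_on k A (\<lambda>x. full_price (f x))"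
proof (rule Ck_on_vecI[OF assms(1)])
  fix j show "Ck_on k A (\<lambda>x. full_price (f x) $ j)"
    by (cases j) (auto simp: full_price_def intro!: Ck_on_const Ck_on_vec_nth assms)
qed

lemma Ck_on_budget:
  assumes "open A" "Ck_on k A f" "Ck_on k A g"
  shows "Ck_on k A (\<lambda>x. budget (f x) (g x))"
proof (rule Ck_on_vecI[OF assms(1)])
  fix j show "Ck_on k A (\<lambda>x. budget (f x) (g x) $ j)"
    by (cases j) (auto simp: budget_def intro!: Ck_on_inner Ck_on_full_price Ck_on_vec_nth assms)
qed

lemma Ck_on_demand:
  assumes "admissible_utility U" "open A" "Ck_on k A f" "Ck_on k A g"
    and "\<And>x. x \<in> A \<Longrightarrow> f x \<in> pos_orthant" "\<And>x. x \<in> A \<Longrightarrow> 0 < full_price (f x) \<bullet> g x"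
  shows "Ck_on k A (\<lambda>x. demand U (f x) (g x))"
proof -
  have "Ck_on k A (\<lambda>x. budget (f x) (g x))" by (rule Ck_on_budget[OF assms(2-4)])
  then have "Ck_on k A (\<lambda>x. inv_into pos_orthant (supporting_budget U) (budget (f x) (g x)))"
    by (rule Ck_on_compose[OF assms(2) open_pos_orthant _ _ Ck_on_inv_supporting_budget[OF assms(1)], rotated])
      (use assms budget_pos in auto)
  then show ?thesis
    by (rule Ck_on_cong[OF assms(2), rotated]) (use assms demand_eq_inv in metis)
qed

section \<open>Orientation of linear isomorphisms of the punctured space\<close>

abbreviation homotopic_punctured :: "('a::real_normed_vector \<Rightarrow> 'a) \<Rightarrow> ('a \<Rightarrow> 'a) \<Rightarrow> bool" where
  "homotopic_punctured \<equiv> homotopic_with_canon (\<lambda>_. True) (-{0}) (-{0})"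

text \<open>The identity for the empty set and a reflection in a hyperplane for a singleton; these
  two serve as representatives of the two orientations.\<close>

definition reflect :: "'k set \<Rightarrow> real ^ 'k \<Rightarrow> real ^ 'k::finite" where
  "reflect N x = (\<chi> i. if i \<in> N then - x $ i else x $ i)"

lemma homotopic_puncturedI:
  fixes h :: "real \<Rightarrow> 'a::real_normed_vector \<Rightarrow> 'a"
  assumes "continuous_on UNIV (\<lambda>z. h (fst z) (snd z))"
    and "\<And>t x. 0 \<le> t \<Longrightarrow> t \<le> 1 \<Longrightarrow> x \<noteq> 0 \<Longrightarrow> h t x \<noteq> 0"
    and "\<And>x. h 0 x = f x" "\<And>x. h 1 x = g x"
  shows "homotopic_punctured f g"
proof -
  have zero: "x = 0" if "0 \<le> t" "t \<le> 1" "h t x = 0" for t x using assms(2) that by blast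
  have "continuous_on ({0..1} \<times> -{0}) (\<lambda>z. h (fst z) (snd z))"
    by (rule continuous_on_subset[OF assms(1)]) simp
  moreover have "(\<lambda>z. h (fst z) (snd z)) \<in> {0..1} \<times> -{0} \<rightarrow> -{0}" using zero by auto
  ultimately have "continuous_map (prod_topology (top_of_set {0..1}) (top_of_set (-{0}))) (top_of_set (-{0}))
      (\<lambda>z. h (fst z) (snd z))"
    by (simp only: prod_topology_subtopology_eu continuous_map_subtopology_eu)
  then show ?thesis
    unfolding homotopic_with_def
    by (intro exI[of _ "\<lambda>z. h (fst z) (snd z)"]) (simp add: assms(3,4))
qed

lemma homotopic_punctured_compose:
  assumes "homotopic_punctured f f'" "homotopic_punctured g g'"
  shows "homotopic_punctured (g \<circ> f) (g' \<circ> f')"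
  using homotopic_compose[OF assms] .

text \<open>In the plane of the coordinates \<open>m\<close> and \<open>n\<close>, rotating the axis
  of a reflection passes from the sign change of \<open>n\<close> (angle parameter 0) through the
  exchange of the coordinates (pi/2) to the sign change of \<open>m\<close> (pi).\<close>

lemma homotopic_reflect_singletons:
  fixes m n :: "'k::finite"
  assumes "m \<noteq> n"
  shows "homotopic_punctured (\<lambda>x :: real ^ 'k. \<chi> i. x $ Transposition.transpose m n i) (reflect {n})"
    and "homotopic_punctured (reflect {m}) (reflect {n} :: real ^ 'k \<Rightarrow> _)"
proof -
  define h :: "real \<Rightarrow> real ^ 'k \<Rightarrow> real ^ 'k" where
    "h \<theta> x = (\<chi> i. if i = m then cos \<theta> * x $ m + sin \<theta> * x $ n
       else if i = n then sin \<theta> * x $ m - cos \<theta> * x $ n else x $ i)" for \<theta> x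
  have nz: "h \<theta> x \<noteq> 0" if "x \<noteq> 0" for \<theta> x
  proof
    assume "h \<theta> x = 0"
    then have z: "h \<theta> x $ i = 0" for i by simp
    define a b where "a = x $ m" and "b = x $ n"
    have 1: "cos \<theta> * a + sin \<theta> * b = 0" and 2: "sin \<theta> * a - cos \<theta> * b = 0"
      using z[of m] z[of n] assms by (auto simp: h_def a_def b_def)
    \<comment> \<open>Each of these plane reflections is its own inverse; applying it again recovers
      \<open>a\<close> and \<open>b\<close>.\<close>
    have "((cos \<theta>)\<^sup>2 + (sin \<theta>)\<^sup>2) * a =
        cos \<theta> * (cos \<theta> * a + sin \<theta> * b) + sin \<theta> * (sin \<theta> * a - cos \<theta> * b)"
      "((cos \<theta>)\<^sup>2 + (sin \<theta>)\<^sup>2) * b =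
        sin \<theta> * (cos \<theta> * a + sin \<theta> * b) - cos \<theta> * (sin \<theta> * a - cos \<theta> * b)"
      by (simp_all only: power2_eq_square) (simp_all only: algebra_simps)
    then have "a = 0" "b = 0" unfolding 1 2 by simp_all
    moreover have "x $ i = 0" if "i \<noteq> m" "i \<noteq> n" for i using z[of i] that by (simp add: h_def)
    ultimately have "x = 0" unfolding vec_eq_iff a_def b_def by (metis zero_index)
    with that show False by simp
  qed
  have cont: "continuous_on UNIV (\<lambda>z. h (c * fst z) (snd z))" for c
    unfolding h_def
  proof (rule continuous_on_vec_lambda)
    fix i
    show "continuous_on UNIV (\<lambda>z :: real \<times> (real ^ 'k).
        if i = m then cos (c * fst z) * snd z $ m + sin (c * fst z) * snd z $ n
        else if i = n then sin (c * fst z) * snd z $ m - cos (c * fst z) * snd z $ n else snd z $ i)"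
      by (cases "i = m"; cases "i = n") (auto intro!: continuous_intros)
  qed
  have 0: "h 0 x = reflect {n} x" for x
    using assms by (auto simp: h_def reflect_def vec_eq_iff)
  have "homotopic_punctured (reflect {n}) (\<lambda>x :: real ^ 'k. \<chi> i. x $ Transposition.transpose m n i)"
  proof (rule homotopic_puncturedI[of "\<lambda>t. h (pi / 2 * t)", OF cont])
    show "h (pi/2 * 1) x = (\<chi> i. x $ Transposition.transpose m n i)" for x
      using assms by (auto simp: h_def vec_eq_iff transpose_def)
  qed (use nz 0 in auto)
  then show "homotopic_punctured (\<lambda>x :: real ^ 'k. \<chi> i. x $ Transposition.transpose m n i) (reflect {n})"
    by (rule homotopic_with_symD)
  have "homotopic_punctured (reflect {n}) (reflect {m} :: real ^ 'k \<Rightarrow> _)"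
  proof (rule homotopic_puncturedI[of "\<lambda>t. h (pi * t)", OF cont])
    show "h (pi * 1) x = reflect {m} x" for x
      using assms by (auto simp: h_def vec_eq_iff reflect_def)
  qed (use nz 0 in auto)
  then show "homotopic_punctured (reflect {m}) (reflect {n} :: real ^ 'k \<Rightarrow> _)"
    by (rule homotopic_with_symD)
qed

lemma linear_reflect: "linear (reflect N)"
  by (rule linearI) (auto simp: reflect_def vec_eq_iff)

lemma reflect_reflect [simp]: "reflect N (reflect N x) = x"
  by (simp add: reflect_def vec_eq_iff)

lemma reflect_nonzero: "x \<noteq> 0 \<Longrightarrow> reflect N x \<noteq> 0"
  by (metis reflect_reflect linear_0 linear_reflect)

lemma homotopic_punctured_refl:
  fixes f :: "real ^ 'k \<Rightarrow> real ^ 'k"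
  assumes "linear f" "\<And>x. x \<noteq> 0 \<Longrightarrow> f x \<noteq> 0"
  shows "homotopic_punctured f f"
  using assms linear_continuous_on[of f] by (auto simp: linear_conv_bounded_linear)

lemma homotopic_punctured_reflect_refl: "homotopic_punctured (reflect N) (reflect N)"
  by (rule homotopic_punctured_refl[OF linear_reflect reflect_nonzero])

text \<open>Each sign change can be moved to the coordinate \<open>k\<close>, where two of them
  cancel.\<close>

lemma homotopic_reflect:
  fixes k :: "'k::finite"
  shows "homotopic_punctured (reflect N) (reflect (if even (card N) then {} else {k}) :: real ^ 'k \<Rightarrow> _)"
proof (induction N rule: finite_induct[OF finite])
  case 1
  then show ?case using homotopic_punctured_reflect_refl[of "{}"] by simp
next
  case (2 a N)
  have a: "homotopic_punctured (reflect {a}) (reflect {k} :: real ^ 'k \<Rightarrow> _)"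
    using homotopic_reflect_singletons(2)[of a k] homotopic_punctured_reflect_refl[of "{k}"]
    by (cases "a = k") auto
  have 1: "reflect {a} \<circ> reflect N = reflect (insert a N)"
    using 2 by (auto simp: reflect_def fun_eq_iff vec_eq_iff)
  have 2: "reflect {k} \<circ> reflect (if even (card N) then {} else {k}) =
      reflect (if even (card (insert a N)) then {} else {k})"
    using 2 by (auto simp: reflect_def fun_eq_iff vec_eq_iff)
  show ?case using homotopic_punctured_compose[OF "2.IH" a] unfolding 1 2 .
qed

lemma homotopic_matrix_path:
  fixes H :: "real \<Rightarrow> real ^ 'k ^ 'k"
  assumes "continuous_on UNIV H" "\<And>t. 0 \<le> t \<Longrightarrow> t \<le> 1 \<Longrightarrow> det (H t) \<noteq> 0"
  shows "homotopic_punctured ((*v) (H 0)) ((*v) (H 1))"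
proof (rule homotopic_puncturedI[of "\<lambda>t x. H t *v x"])
  have H: "continuous_on UNIV (\<lambda>z :: real \<times> (real ^ 'k). H (fst z))"
    using continuous_on_compose2[of UNIV H UNIV "fst :: real \<times> (real ^ 'k) \<Rightarrow> real", OF assms(1) continuous_on_fst[OF continuous_on_id]]
    by simp
  show "continuous_on UNIV (\<lambda>z :: real \<times> (real ^ 'k). H (fst z) *v snd z)"
    unfolding matrix_vector_mult_def
  proof (rule continuous_on_vec_lambda)
    fix i
    show "continuous_on UNIV (\<lambda>z :: real \<times> (real ^ 'k). \<Sum>j\<in>UNIV. H (fst z) $ i $ j * snd z $ j)"
      by (intro continuous_on_sum continuous_on_mult continuous_on_component[OF continuous_on_snd[OF continuous_on_id]]
          continuous_on_component[OF continuous_on_component[OF H]])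
  qed
  show "H t *v x \<noteq> 0" if "0 \<le> t" "t \<le> 1" "x \<noteq> 0" for t x
    using assms(2)[OF that(1,2)] that(3) matrix_left_invertible_ker[of "H t"]
    by (auto simp: invertible_det_nz[symmetric] invertible_left_inverse)
qed auto

text \<open>Sorts the invertible matrices into two homotopy classes by the sign of the determinant,
  through a factorization into elementary ones. Classes compose along products, diagonal matrices
  deform to their signs, a swap turns into a reflection, and a shear shrinks to the
  identity.\<close>

lemma homotopic_matrix:
  fixes A :: "real ^ 'k ^ 'k" and k :: 'k
  shows "det A \<noteq> 0 \<Longrightarrow> homotopic_punctured ((*v) A) (reflect (if det A > 0 then {} else {k}))"
proof (induction A rule: induct_matrix_elementary)
  case (1 A B)
  then have "det A \<noteq> 0" "det B \<noteq> 0" by (auto simp: det_mul)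
  then have *: "homotopic_punctured ((*v) A \<circ> (*v) B)
      (reflect (if det A > 0 then {} else {k}) \<circ> reflect (if det B > 0 then {} else {k}))"
    using 1 by (intro homotopic_punctured_compose) auto
  have "reflect (if det A > 0 then {} else {k}) \<circ> reflect (if det B > 0 then {} else {k})
      = reflect (if det (A ** B) > 0 then {} else {k})"
    using \<open>det A \<noteq> 0\<close> \<open>det B \<noteq> 0\<close>
    by (auto simp: reflect_def fun_eq_iff vec_eq_iff det_mul zero_less_mult_iff)
  with * show ?case by (simp only: matrix_vector_mult_matrix_matrix_mult_compose)
next
  case (2 A i)
  then show ?case using det_zero_row(1) by blast
next
  case (3 A)
  define N where "N = {i. A $ i $ i < 0}"
  have nz: "A $ i $ i \<noteq> 0" for i using 3 by (simp add: det_diagonal)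
  \<comment> \<open>On the segment from \<open>A\<close> to its sign matrix no diagonal entry
    changes sign, so the determinant stays nonzero.\<close>
  define S where "S = (\<chi> i j. if i = j then sgn (A $ i $ i) else 0 :: real ^ 'k ^ 'k)"
  define H where "H t = (1 - t) *\<^sub>R A + t *\<^sub>R S" for t
  have "homotopic_punctured ((*v) (H 0)) ((*v) (H 1))"
  proof (rule homotopic_matrix_path)
    show "continuous_on UNIV H" unfolding H_def by (intro continuous_intros)
    fix t :: real assume t: "0 \<le> t" "t \<le> 1"
    have "det (H t) = (\<Prod>i\<in>UNIV. (1 - t) * A $ i $ i + t * sgn (A $ i $ i))"
      by (subst det_diagonal) (auto simp: H_def S_def 3)
    moreover have "(1 - t) * A $ i $ i + t * sgn (A $ i $ i) \<noteq> 0" for i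
    proof (cases "A $ i $ i > 0")
      case True
      then have "0 < (1 - t) * A $ i $ i + t"
        using t by (cases "t = 0") (auto intro!: add_nonneg_pos)
      then show ?thesis using True by simp
    next
      case False
      then have "A $ i $ i < 0" using nz[of i] by linarith
      then have "(1 - t) * A $ i $ i - t < 0"
        using t mult_nonneg_nonpos[of "1 - t" "A $ i $ i"] by (cases "t = 0") auto
      then show ?thesis using False nz[of i] by (simp add: algebra_simps)
    qed
    ultimately show "det (H t) \<noteq> 0" by simp
  qed
  then have A: "homotopic_punctured ((*v) A) ((*v) S)" by (simp add: H_def)
  have S: "(*v) S = reflect N"
  proof (rule ext)
    fix x
    have "(S *v x) $ i = reflect N x $ i" for i
    proof -
      have "(S *v x) $ i = (\<Sum>j\<in>UNIV. if j = i then sgn (A $ i $ i) * x $ i else 0)"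
        unfolding matrix_vector_mult_def S_def by (simp only: vec_lambda_beta) (intro sum.cong; auto)
      also have "\<dots> = reflect N x $ i" using nz[of i] by (simp add: reflect_def N_def sgn_real_def)
      finally show ?thesis .
    qed
    then show "S *v x = reflect N x" by (simp add: vec_eq_iff)
  qed
  have sgn_prod: "sgn (\<Prod>i\<in>I. f i) = (\<Prod>i\<in>I. sgn (f i))" for I :: "'k set" and f :: "'k \<Rightarrow> real"
    by (induction I rule: infinite_finite_induct) (auto simp: sgn_mult)
  have "sgn (det A) = det S"
    by (simp add: det_diagonal 3 S_def sgn_prod)
  also have "\<dots> = (\<Prod>i\<in>UNIV. if i \<in> N then -1 else 1)"
    using nz by (auto simp: det_diagonal S_def N_def sgn_real_def intro!: prod.cong)
  also have "\<dots> = (-1) ^ card N" by (simp add: prod.If_cases)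
  finally have "det A > 0 \<longleftrightarrow> even (card N)"
    by (auto simp: sgn_real_def minus_one_power_iff split: if_splits)
  then show ?case using homotopic_with_trans[OF A[unfolded S] homotopic_reflect[of N k]] by simp
next
  case (4 m n)
  let ?A = "\<chi> i j. mat 1 $ i $ Transposition.transpose m n j :: real ^ 'k ^ 'k"
  have "det ?A = -1"
    using det_permute_columns[of "Transposition.transpose m n" "mat 1 :: real ^ 'k ^ 'k"] 4(1)
    by (simp add: permutes_swap_id sign_swap_id)
  moreover have "(*v) ?A = (\<lambda>x. \<chi> i. x $ Transposition.transpose m n i)"
  proof (rule ext)
    fix x :: "real ^ 'k"
    have "i = Transposition.transpose m n j \<longleftrightarrow> j = Transposition.transpose m n i" for i j
      by (metis transpose_involutory)
    then have "(?A *v x) $ i = (\<Sum>j\<in>UNIV. if j = Transposition.transpose m n i then x $ j else 0)" for i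
      unfolding matrix_vector_mult_def mat_def by (simp only: vec_lambda_beta) (intro sum.cong; auto)
    then show "?A *v x = (\<chi> i. x $ Transposition.transpose m n i)" by (simp add: vec_eq_iff)
  qed
  moreover have "homotopic_punctured (reflect {n}) (reflect {k} :: real ^ 'k \<Rightarrow> _)"
    using homotopic_reflect[of "{n}" k] by simp
  ultimately show ?case
    using homotopic_with_trans[OF homotopic_reflect_singletons(1)[OF 4(1)]] by simp
next
  case (5 m n c)
  define H :: "real \<Rightarrow> real ^ 'k ^ 'k" where
    "H t = (\<chi> i j. if i = m \<and> j = n then t * c else of_bool (i = j))" for t
  have det: "det (H t) = 1" for t
  proof -
    have "H t = (\<chi> i. if i = m then row m (mat 1) + (t * c) *s row n (mat 1) else row i (mat 1))"
      using 5(1) by (auto simp: H_def vec_eq_iff row_def mat_def)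
    then show ?thesis using det_row_operation[OF 5(1), of "mat 1 :: real ^ 'k ^ 'k" "t * c"] by simp
  qed
  have "homotopic_punctured ((*v) (H 0)) ((*v) (H 1))"
  proof (rule homotopic_matrix_path)
    have "continuous_on UNIV (\<lambda>t. if i = m \<and> j = n then t * c else of_bool (i = j))" for i j
      by (cases "i = m \<and> j = n") (auto intro!: continuous_intros)
    then show "continuous_on UNIV H" unfolding H_def by (intro continuous_on_vec_lambda)
  qed (simp add: det)
  moreover have "H 0 = mat 1" using 5(1) by (auto simp: H_def mat_def vec_eq_iff)
  then have "(*v) (H 0) = reflect {}" by (auto simp: reflect_def fun_eq_iff)
  ultimately have "homotopic_punctured ((*v) (H 1)) (reflect {})"
    by (auto intro: homotopic_with_symD)
  moreover have "H 1 = (\<chi> i j. if i = m \<and> j = n then c else of_bool (i = j))" by (simp only: H_def mult_1)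
  ultimately show ?case using det[of 1] by simp
qed

text \<open>Transported to the standard sphere, the two maps have Brouwer degree 1 and -1.\<close>

lemma not_homotopic_id_reflect:
  fixes k :: "'k::finite"
  shows "\<not> homotopic_with_canon (\<lambda>_. True) (sphere 0 1) (-{0}) (reflect {}) (reflect {k} :: real ^ 'k \<Rightarrow> _)"
proof
  assume hom: "homotopic_with_canon (\<lambda>_. True) (sphere 0 1) (-{0}) (reflect {}) (reflect {k} :: real ^ 'k \<Rightarrow> _)"
  define n where "n = CARD('k)"
  have "n > 0" by (simp add: n_def)
  obtain b0 where b0: "bij_betw b0 {..<n} (UNIV :: 'k set)"
    using ex_bij_betw_nat_finite[OF finite, of "UNIV :: 'k set"] unfolding n_def atLeast0LessThan by blast
  \<comment> \<open>The enumeration of the coordinates is adjusted so that \<open>k\<close> has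
    index 0, the coordinate for which the degree of a reflection is available.\<close>
  define b where "b = Transposition.transpose k (b0 0) \<circ> b0"
  have b: "bij_betw b {..<n} UNIV" unfolding b_def
    by (rule bij_betw_trans[OF b0]) (use permutes_bij[OF permutes_swap_id[of k UNIV "b0 0"]] in simp)
  have bk: "b 0 = k" by (simp add: b_def)
  define c where "c = inv_into {..<n} b"
  have bc: "b (c i) = i" "c i < n" for i
    using bij_betw_inv_into_right[OF b] bij_betwE[OF bij_betw_inv_into[OF b]] by (auto simp: c_def)
  have cb: "c (b j) = j" if "j < n" for j
    using b that unfolding c_def by (simp add: bij_betw_inv_into_left)
  define \<phi> :: "(nat \<Rightarrow> real) \<Rightarrow> real ^ 'k" where "\<phi> x = (\<chi> i. x (c i))" for x
  \<comment> \<open>Normalizing makes this defined on the whole punctured space, through which the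
    homotopy runs, and not just on the unit sphere.\<close>
  define \<psi> :: "real ^ 'k \<Rightarrow> nat \<Rightarrow> real" where "\<psi> y j = (if j < n then y $ b j / norm y else 0)" for y j
  \<comment> \<open>\<open>nsphere d\<close> uses the coordinates 0 to d, so the unit sphere of an
    n-dimensional space is \<open>nsphere (n - 1)\<close>.\<close>
  have nn: "{..n - 1} = {..<n}" using \<open>n > 0\<close> by auto
  have sum_b: "(\<Sum>j\<in>{..<n}. g (b j)) = (\<Sum>i\<in>UNIV. g i)" for g :: "'k \<Rightarrow> real"
    by (rule sum.reindex_bij_betw[OF b])
  have sph: "nsphere (n - 1) = subtopology (powertop_real UNIV) {x. (\<Sum>j<n. (x j)\<^sup>2) = 1 \<and> (\<forall>j\<ge>n. x j = 0)}"
  proof -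
    have "n - 1 < j \<longleftrightarrow> n \<le> j" for j using \<open>n > 0\<close> by auto
    then show ?thesis unfolding nsphere nn by simp
  qed
  have top: "(\<Sum>j<n. (x j)\<^sup>2) = 1" "\<And>j. n \<le> j \<Longrightarrow> x j = 0" if "x \<in> topspace (nsphere (n - 1))" for x
    using that unfolding sph by simp_all
  have norm_phi: "norm (\<phi> x) = 1" if "x \<in> topspace (nsphere (n - 1))" for x
  proof -
    have "(norm (\<phi> x))\<^sup>2 = (\<Sum>i\<in>UNIV. (x (c i))\<^sup>2)"
      unfolding power2_norm_eq_inner by (simp add: inner_vec_def \<phi>_def power2_eq_square)
    also have "\<dots> = (\<Sum>j<n. (x j)\<^sup>2)" using sum_b[of "\<lambda>i. (x (c i))\<^sup>2"] cb by simp
    also have "\<dots> = 1" using top(1)[OF that] .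
    finally show ?thesis by (simp add: power2_eq_1_iff) (metis norm_ge_zero not_one_le_zero neg_0_le_iff_le order.trans zero_le_one)
  qed
  have "continuous_map (nsphere (n - 1)) euclidean \<phi>"
  proof -
    have "continuous_map (nsphere (n - 1)) euclidean (\<lambda>x. x (c i) *\<^sub>R (axis i 1 :: real ^ 'k))" for i
    proof -
      have "continuous_map euclideanreal euclidean (\<lambda>r. r *\<^sub>R (axis i 1 :: real ^ 'k))"
        unfolding continuous_map_iff_continuous2 by (intro continuous_intros)
      from continuous_map_compose[OF continuous_map_nsphere_projection this]
      show ?thesis by (simp only: o_def)
    qed
    then have "continuous_map (nsphere (n - 1)) euclidean (\<lambda>x. \<Sum>i\<in>UNIV. x (c i) *\<^sub>R (axis i 1 :: real ^ 'k))"
      by (intro continuous_map_sum) auto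
    moreover have "(\<Sum>i\<in>UNIV. x (c i) *\<^sub>R (axis i 1 :: real ^ 'k)) = \<phi> x" for x
      using basis_expansion[of "\<phi> x"] by (simp add: \<phi>_def scalar_mult_eq_scaleR)
    ultimately show ?thesis by simp
  qed
  then have phi: "continuous_map (nsphere (n - 1)) (top_of_set (sphere 0 1)) \<phi>"
    using norm_phi by (auto simp: continuous_map_in_subtopology)
  have psi: "continuous_map (top_of_set (-{0})) (nsphere (n - 1)) \<psi>"
    unfolding sph continuous_map_in_subtopology continuous_map_componentwise_UNIV
  proof (intro conjI allI)
    show "continuous_map (top_of_set (-{0})) euclideanreal (\<lambda>y. \<psi> y j)" for j
      by (cases "j < n") (auto simp: \<psi>_def intro!: continuous_intros)
    have "(\<Sum>j<n. (\<psi> y j)\<^sup>2) = 1" if "y \<noteq> 0" for y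
    proof -
      have "(\<Sum>j<n. (\<psi> y j)\<^sup>2) = (\<Sum>j<n. (y $ b j / norm y)\<^sup>2)" by (simp add: \<psi>_def)
      also have "\<dots> = (\<Sum>i\<in>UNIV. (y $ i)\<^sup>2) / (norm y)\<^sup>2"
        unfolding sum_b[of "\<lambda>i. (y $ i / norm y)\<^sup>2"] by (simp add: power_divide sum_divide_distrib)
      also have "(\<Sum>i\<in>UNIV. (y $ i)\<^sup>2) = (norm y)\<^sup>2"
        unfolding power2_norm_eq_inner by (simp add: inner_vec_def power2_eq_square)
      finally show ?thesis using that by simp
    qed
    then show "\<psi> \<in> topspace (top_of_set (-{0})) \<rightarrow> {x. (\<Sum>j<n. (x j)\<^sup>2) = 1 \<and> (\<forall>j\<ge>n. x j = 0)}"
      by (auto simp: \<psi>_def[abs_def])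
  qed
  have "homotopic_with (\<lambda>_. True) (nsphere (n - 1)) (nsphere (n - 1))
      (\<psi> \<circ> (reflect {} \<circ> \<phi>)) (\<psi> \<circ> (reflect {k} \<circ> \<phi>))"
    by (intro homotopic_with_compose_continuous_map_left[OF _ psi]
        homotopic_with_compose_continuous_map_right[OF _ phi]) (use hom in auto)
  from Brouwer_degree2_homotopic[OF this]
  have "Brouwer_degree2 (n - 1) (\<psi> \<circ> (reflect {} \<circ> \<phi>)) = Brouwer_degree2 (n - 1) (\<psi> \<circ> (reflect {k} \<circ> \<phi>))" .
  moreover have "Brouwer_degree2 (n - 1) (\<psi> \<circ> (reflect {} \<circ> \<phi>)) = Brouwer_degree2 (n - 1) id"
  proof (rule Brouwer_degree2_eq)
    fix x assume x: "x \<in> topspace (nsphere (n - 1))"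
    with top(2) show "(\<psi> \<circ> (reflect {} \<circ> \<phi>)) x = id x"
      using norm_phi[OF x] cb by (auto simp: \<psi>_def reflect_def \<phi>_def fun_eq_iff)
  qed
  moreover have "Brouwer_degree2 (n - 1) (\<psi> \<circ> (reflect {k} \<circ> \<phi>)) =
      Brouwer_degree2 (n - 1) (\<lambda>x i. if i = 0 then - x i else x i)"
  proof (rule Brouwer_degree2_eq)
    fix x assume x: "x \<in> topspace (nsphere (n - 1))"
    note top(2)[OF x]
    moreover have "norm (reflect {k} (\<phi> x)) = norm (\<phi> x)"
      unfolding norm_eq_sqrt_inner inner_vec_def reflect_def by (intro arg_cong[of _ _ sqrt] sum.cong) auto
    moreover have "b j = k \<longleftrightarrow> j = 0" if "j < n" for j using cb[OF that] cb[OF \<open>n > 0\<close>] bk by auto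
    ultimately show "(\<psi> \<circ> (reflect {k} \<circ> \<phi>)) x = (\<lambda>i. if i = 0 then - x i else x i)"
      using norm_phi[OF x] cb \<open>n > 0\<close> by (auto simp: \<psi>_def reflect_def \<phi>_def fun_eq_iff not_less)
  qed
  ultimately show False by (simp add: Brouwer_degree2_reflection)
qed

text \<open>Phrased on the sphere, since a path of isolated zeros supplies a homotopy only on small
  spheres around them.\<close>

lemma homotopic_linear_sphere_imp_same_orientation:
  fixes A B :: "real ^ 'k ^ 'k"
  assumes hom: "homotopic_with_canon (\<lambda>_. True) (sphere 0 1) (-{0}) ((*v) A) ((*v) B)"
    and A: "det A < 0" and B: "0 < det B"
  shows False
proof -
  define k :: 'k where "k = undefined"
  have sub: "sphere 0 1 \<subseteq> -{0 :: real ^ 'k}" by auto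
  have "homotopic_with_canon (\<lambda>_. True) (sphere 0 1) (-{0}) ((*v) A) (reflect {k})"
    using homotopic_with_subset_left[OF homotopic_matrix[of A k] sub] A by simp
  moreover have "homotopic_with_canon (\<lambda>_. True) (sphere 0 1) (-{0}) ((*v) B) (reflect {})"
    using homotopic_with_subset_left[OF homotopic_matrix[of B k] sub] B by simp
  ultimately have "homotopic_with_canon (\<lambda>_. True) (sphere 0 1) (-{0}) (reflect {}) (reflect {k})"
    using hom by (meson homotopic_with_symD homotopic_with_trans)
  then show False using not_homotopic_id_reflect by blast
qed

section \<open>Local analysis near a singular zero\<close>

lemma C1_locally_injective:
  fixes f :: "'a::euclidean_space \<Rightarrow> 'b::euclidean_space"
  assumes S: "open S" "a \<in> S" and f: "Ck_on (Suc 0) S f"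
    and inj: "\<And>h. frechet_derivative f (at a) h = 0 \<Longrightarrow> h = 0"
  obtains r where "r > 0" "ball a r \<subseteq> S" "inj_on f (ball a r)"
proof -
  define D where "D x = frechet_derivative f (at x)" for x
  have D: "(f has_derivative D x) (at x)" if "x \<in> S" for x
    unfolding D_def using Ck_on_Suc_has_derivative[OF f that] .
  have lin: "linear (D a)" using D[OF S(2)] has_derivative_linear by blast
  have "inj (D a)" using inj lin linear_injective_0[of "D a"] by (simp add: D_def)
  then obtain g' where g': "linear g'" "g' \<circ> D a = id"
    using linear_injective_left_inverse[OF lin] by blast
  \<comment> \<open>\<open>Ck_on\<close> gives continuity of the differential in each fixed
    direction, while local injectivity asks for it in operator norm. With a bound of
    \<open>e / (2 * n)\<close> in each of the \<open>n\<close> basis directions the sum is at most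
    half of \<open>e\<close>, hence strictly below \<open>e\<close>.\<close>
  have *: "\<exists>d>0. \<forall>x. dist a x < d \<longrightarrow> onorm (\<lambda>v. D x v - D a v) < e" if "e > 0" for e
  proof -
    define n where "n = card (Basis :: 'a set)"
    have n: "n > 0" by (simp add: n_def)
    have "\<forall>b\<in>Basis. \<forall>\<^sub>F x in nhds a. norm (D x b - D a b) < e / (2 * n)"
    proof
      fix b :: 'a
      have "continuous_on S (\<lambda>x. D x b)" using f by (simp add: D_def)
      then have "isCont (\<lambda>x. D x b) a" using S continuous_on_eq_continuous_at by blast
      then have "filterlim (\<lambda>x. D x b) (nhds (D a b)) (nhds a)"
        unfolding isCont_def using tendsto_at_iff_tendsto_nhds[of "\<lambda>x. D x b" a] by blast
      from tendstoD[OF this, of "e / (2 * n)"]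
      show "\<forall>\<^sub>F x in nhds a. norm (D x b - D a b) < e / (2 * n)" using \<open>e > 0\<close> n by (simp add: dist_norm)
    qed
    then have "\<forall>\<^sub>F x in nhds a. \<forall>b\<in>Basis. norm (D x b - D a b) < e / (2 * n)"
      by (intro eventually_ball_finite) auto
    moreover have "\<forall>\<^sub>F x in nhds a. x \<in> S" using S eventually_nhds by blast
    ultimately have "\<forall>\<^sub>F x in nhds a. x \<in> S \<and> (\<forall>b\<in>Basis. norm (D x b - D a b) < e / (2 * n))"
      by eventually_elim auto
    then obtain d where d: "d > 0"
      "\<And>x. dist x a < d \<Longrightarrow> x \<in> S \<and> (\<forall>b\<in>Basis. norm (D x b - D a b) < e / (2 * n))"
      unfolding eventually_nhds_metric by blast
    have "onorm (\<lambda>v. D x v - D a v) < e" if "dist a x < d" for x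
    proof -
      have x: "x \<in> S" "\<And>b. b \<in> Basis \<Longrightarrow> norm (D x b - D a b) < e / (2 * n)"
        using d(2)[of x] that by (auto simp: dist_commute)
      have "norm (D x v - D a v) \<le> e / 2 * norm v" for v
      proof -
        have "D x v - D a v = (\<Sum>b\<in>Basis. (v \<bullet> b) *\<^sub>R (D x b - D a b))"
          using has_derivative_eq_sum_Basis[OF D[OF x(1)], of v] has_derivative_eq_sum_Basis[OF D[OF S(2)], of v]
          by (simp add: scaleR_diff_right sum_subtractf)
        also have "norm \<dots> \<le> (\<Sum>b\<in>(Basis :: 'a set). norm v * (e / (2 * n)))"
        proof (rule sum_norm_le)
          fix b :: 'a assume b: "b \<in> Basis"
          show "norm ((v \<bullet> b) *\<^sub>R (D x b - D a b)) \<le> norm v * (e / (2 * n))"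
            unfolding norm_scaleR by (rule mult_mono[OF Basis_le_norm[OF b] less_imp_le[OF x(2)[OF b]]]) auto
        qed
        also have "\<dots> = e / 2 * norm v" using n by (simp add: n_def)
        finally show ?thesis .
      qed
      then have "onorm (\<lambda>v. D x v - D a v) \<le> e / 2" using \<open>e > 0\<close> by (intro onorm_bound) auto
      then show ?thesis using \<open>e > 0\<close> by simp
    qed
    with d show ?thesis by blast
  qed
  obtain r where "r > 0" "ball a r \<subseteq> S" "inj_on f (ball a r)"
    by (rule has_derivative_locally_injective[OF S(2,1) _ g'(2) D *])
      (use g' linear_conv_bounded_linear in auto)
  then show ?thesis using that by blast
qed

section \<open>Symmetry of the second differential\<close>

lemma second_difference_mvt:
  fixes f :: "'a::euclidean_space \<Rightarrow> real"
  assumes f: "Ck_on 2 A f" and s: "0 < s"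
    and A: "\<And>a b. 0 \<le> a \<Longrightarrow> a \<le> s \<Longrightarrow> 0 \<le> b \<Longrightarrow> b \<le> s \<Longrightarrow> x + a *\<^sub>R v + b *\<^sub>R w \<in> A"
  shows "\<exists>a b. 0 < a \<and> a < s \<and> 0 < b \<and> b < s \<and>
    f (x + s *\<^sub>R v + s *\<^sub>R w) - f (x + s *\<^sub>R v) - f (x + s *\<^sub>R w) + f x
      = s * (s * second_derivative f (x + a *\<^sub>R v + b *\<^sub>R w) v w)"
proof -
  define D where "D y = frechet_derivative f (at y)" for y
  have f2: "Ck_on (Suc (Suc 0)) A f" using f by (simp add: numeral_2_eq_2)
  have df: "(f has_derivative D y) (at y)" if "y \<in> A" for y
    unfolding D_def by (rule Ck_on_Suc_has_derivative[OF f2 that])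
  have line: "((\<lambda>a. g (y + a *\<^sub>R u)) has_real_derivative g' u) (at a)"
    if "(g has_derivative g') (at (y + a *\<^sub>R u))" for g :: "'a \<Rightarrow> real" and g' y u a
  proof -
    have "((\<lambda>a. y + a *\<^sub>R u) has_derivative (\<lambda>h. h *\<^sub>R u)) (at a)" by (auto intro!: derivative_eq_intros)
    from has_derivative_compose[OF this that] show ?thesis
      using linear_scale[OF has_derivative_linear[OF that]] by (simp add: has_field_derivative_def mult_commute_abs)
  qed
  define g where "g a = f (x + s *\<^sub>R w + a *\<^sub>R v) - f (x + a *\<^sub>R v)" for a
  have "(g has_real_derivative D (x + s *\<^sub>R w + a *\<^sub>R v) v - D (x + a *\<^sub>R v) v) (at a)" if "0 \<le> a" "a \<le> s" for a
    unfolding g_def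
    by (intro DERIV_diff line df) (use A[of a s] A[of a 0] that s in \<open>simp_all add: ac_simps\<close>)
  from MVT2[OF s, of g "\<lambda>a. D (x + s *\<^sub>R w + a *\<^sub>R v) v - D (x + a *\<^sub>R v) v", OF this]
  obtain a where a: "0 < a" "a < s"
    "g s - g 0 = s * (D (x + s *\<^sub>R w + a *\<^sub>R v) v - D (x + a *\<^sub>R v) v)" by auto
  have "((\<lambda>b. D (x + a *\<^sub>R v + b *\<^sub>R w) v) has_real_derivative
      second_derivative f (x + a *\<^sub>R v + b *\<^sub>R w) v w) (at b)" if "0 \<le> b" "b \<le> s" for b
    unfolding second_derivative_def D_def
    by (rule line, rule Ck_on_Suc_has_derivative[OF Ck_on_Suc_frechet[OF f2]]) (use A[of a b] a that in auto)
  from MVT2[OF s, of "\<lambda>b. D (x + a *\<^sub>R v + b *\<^sub>R w) v", OF this]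
  obtain b where b: "0 < b" "b < s"
    "D (x + a *\<^sub>R v + s *\<^sub>R w) v - D (x + a *\<^sub>R v + 0 *\<^sub>R w) v =
      (s - 0) * second_derivative f (x + a *\<^sub>R v + b *\<^sub>R w) v w" by auto
  have "f (x + s *\<^sub>R v + s *\<^sub>R w) - f (x + s *\<^sub>R v) - f (x + s *\<^sub>R w) + f x = g s - g 0"
    by (simp add: g_def ac_simps)
  also have "\<dots> = s * (s * second_derivative f (x + a *\<^sub>R v + b *\<^sub>R w) v w)"
    using a(3) b(3) by (simp add: ac_simps)
  finally show ?thesis using a b by blast
qed

text \<open>The second difference over a small parallelogram is symmetric in \<open>v\<close> and
  \<open>w\<close>, and by \<open>second_difference_mvt\<close> it equals either mixed derivative at
  some nearby point, up to the common factor \<open>s * s\<close>.\<close>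

lemma second_derivative_commute_real:
  fixes f :: "'a::euclidean_space \<Rightarrow> real"
  assumes A: "open A" "x \<in> A" and f: "Ck_on 2 A f"
  shows "second_derivative f x v w = second_derivative f x w v"
proof -
  have "\<bar>second_derivative f x v w - second_derivative f x w v\<bar> < e" if "e > 0" for e
  proof -
    have cont: "\<exists>d>0. \<forall>y. dist y x < d \<longrightarrow> dist (second_derivative f y v w) (second_derivative f x v w) < e / 2" for v w
    proof -
      have "Ck_on 0 A (\<lambda>y. second_derivative f y v w)"
        using f by (simp add: numeral_2_eq_2 second_derivative_def)
      then have "isCont (\<lambda>y. second_derivative f y v w) x" using A by (simp add: continuous_on_eq_continuous_at)
      then show ?thesis using \<open>e > 0\<close> unfolding continuous_at_eps_delta by (elim allE[of _ "e / 2"]) simp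
    qed
    obtain d1 where d1: "d1 > 0" "\<And>y. dist y x < d1 \<Longrightarrow> dist (second_derivative f y v w) (second_derivative f x v w) < e / 2"
      using cont by blast
    obtain d2 where d2: "d2 > 0" "\<And>y. dist y x < d2 \<Longrightarrow> dist (second_derivative f y w v) (second_derivative f x w v) < e / 2"
      using cont by blast
    obtain d3 where d3: "d3 > 0" "ball x d3 \<subseteq> A" using A open_contains_ball by blast
    define d where "d = min d1 (min d2 d3)"
    \<comment> \<open>Chosen so that the parallelogram of side parameter \<open>s\<close> stays
      within \<open>d / 2\<close> of \<open>x\<close>; the added 1 keeps \<open>P\<close> positive
      when both directions vanish.\<close>
    define P where "P = norm v + norm w + 1"
    define s where "s = d / 2 / P"
    have pos: "P > 0" by (simp add: P_def add_nonneg_pos)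
    have "d > 0" using d1 d2 d3 by (simp add: d_def)
    then have s: "s > 0" "s * P = d / 2" using pos by (simp_all add: s_def)
    have near: "dist (x + a *\<^sub>R v + b *\<^sub>R w) x < d" if "0 \<le> a" "a \<le> s" "0 \<le> b" "b \<le> s" for a b
    proof -
      have "dist (x + a *\<^sub>R v + b *\<^sub>R w) x = norm (a *\<^sub>R v + b *\<^sub>R w)" by (simp add: dist_norm)
      also have "\<dots> \<le> a * norm v + b * norm w" by (rule norm_triangle_le) (simp add: that)
      also have "\<dots> \<le> s * norm v + s * norm w" by (intro add_mono mult_right_mono that) auto
      also have "\<dots> \<le> s * P" using s(1) by (simp add: P_def algebra_simps)
      finally show ?thesis using s \<open>d > 0\<close> by simp
    qed
    have inA: "x + a *\<^sub>R v + b *\<^sub>R w \<in> A" if "0 \<le> a" "a \<le> s" "0 \<le> b" "b \<le> s" for a b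
      using near[OF that] d3(2) by (auto simp: d_def dist_commute subset_iff)
    obtain a b where ab: "0 < a" "a < s" "0 < b" "b < s"
      "f (x + s *\<^sub>R v + s *\<^sub>R w) - f (x + s *\<^sub>R v) - f (x + s *\<^sub>R w) + f x
        = s * (s * second_derivative f (x + a *\<^sub>R v + b *\<^sub>R w) v w)"
      using second_difference_mvt[OF f s(1) inA] by blast
    have "x + a *\<^sub>R w + b *\<^sub>R v \<in> A" if "0 \<le> a" "a \<le> s" "0 \<le> b" "b \<le> s" for a b
      using inA[of b a] that by (simp add: ac_simps)
    then obtain a' b' where ab': "0 < a'" "a' < s" "0 < b'" "b' < s"
      "f (x + s *\<^sub>R w + s *\<^sub>R v) - f (x + s *\<^sub>R w) - f (x + s *\<^sub>R v) + f x
        = s * (s * second_derivative f (x + a' *\<^sub>R w + b' *\<^sub>R v) w v)"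
      using second_difference_mvt[OF f s(1), of x w v] by blast
    have "s * (s * second_derivative f (x + a *\<^sub>R v + b *\<^sub>R w) v w)
        = s * (s * second_derivative f (x + b' *\<^sub>R v + a' *\<^sub>R w) w v)"
    proof -
      have eq: "x + s *\<^sub>R v + s *\<^sub>R w = x + s *\<^sub>R w + s *\<^sub>R v"
        "x + b' *\<^sub>R v + a' *\<^sub>R w = x + a' *\<^sub>R w + b' *\<^sub>R v" by simp_all
      show ?thesis using ab(5) ab'(5) unfolding eq by linarith
    qed
    then have "second_derivative f (x + a *\<^sub>R v + b *\<^sub>R w) v w = second_derivative f (x + b' *\<^sub>R v + a' *\<^sub>R w) w v"
      using s(1) by simp
    moreover have "dist (second_derivative f (x + a *\<^sub>R v + b *\<^sub>R w) v w) (second_derivative f x v w) < e / 2"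
      using near[of a b] ab by (intro d1(2)) (simp add: d_def)
    moreover have "dist (second_derivative f (x + b' *\<^sub>R v + a' *\<^sub>R w) w v) (second_derivative f x w v) < e / 2"
      using near[of b' a'] ab' by (intro d2(2)) (simp add: d_def)
    ultimately show ?thesis by (simp add: dist_real_def abs_if split: if_splits)
  qed
  then have "\<bar>second_derivative f x v w - second_derivative f x w v\<bar> \<le> 0"
    by (meson less_irrefl not_le)
  then show ?thesis by simp
qed

lemma frechet_derivative_vec_nth:
  fixes f :: "'a::euclidean_space \<Rightarrow> real ^ 'k"
  assumes "f differentiable (at x)"
  shows "frechet_derivative (\<lambda>y. f y $ i) (at x) v = frechet_derivative f (at x) v $ i"
proof -
  have "(f has_derivative frechet_derivative f (at x)) (at x)" using assms frechet_derivative_works by blast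
  from frechet_derivative_at[OF bounded_linear.has_derivative[OF bounded_linear_vec_nth this]]
  show ?thesis by metis
qed

lemma second_derivative_commute:
  fixes f :: "'a::euclidean_space \<Rightarrow> real ^ 'k"
  assumes A: "open A" "x \<in> A" and f: "Ck_on 2 A f"
  shows "second_derivative f x v w = second_derivative f x w v"
proof -
  have f2: "Ck_on (Suc (Suc 0)) A f" using f by (simp add: numeral_2_eq_2)
  have nth: "second_derivative (\<lambda>y. f y $ i) x v w = second_derivative f x v w $ i" for i v w
  proof -
    have "(\<lambda>y. frechet_derivative f (at y) v) differentiable (at x)" using f2 A by simp
    then have D: "((\<lambda>y. frechet_derivative f (at y) v) has_derivative second_derivative f x v) (at x)"
      unfolding second_derivative_def using frechet_derivative_works by blast
    have "((\<lambda>y. frechet_derivative (\<lambda>y. f y $ i) (at y) v) has_derivative (\<lambda>w. second_derivative f x v w $ i)) (at x)"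
    proof (rule has_derivative_transform_within_open[OF bounded_linear.has_derivative[OF bounded_linear_vec_nth D] A])
      show "frechet_derivative f (at y) v $ i = frechet_derivative (\<lambda>y. f y $ i) (at y) v" if "y \<in> A" for y
        by (rule frechet_derivative_vec_nth[symmetric]) (use f2 that in simp)
    qed
    then show ?thesis unfolding second_derivative_def by (metis frechet_derivative_at)
  qed
  have "second_derivative (\<lambda>y. f y $ i) x v w = second_derivative (\<lambda>y. f y $ i) x w v" for i
    by (rule second_derivative_commute_real[OF A Ck_on_vec_nth[OF A(1) f]])
  then show ?thesis by (simp add: vec_eq_iff nth)
qed

section \<open>Determinants along a curve of matrices\<close>

lemma tendsto_det:
  fixes M :: "'a \<Rightarrow> real ^ 'k ^ 'k"
  assumes "\<And>i j. ((\<lambda>t. M t $ i $ j) \<longlongrightarrow> L $ i $ j) F"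
  shows "((\<lambda>t. det (M t)) \<longlongrightarrow> det L) F"
  unfolding det_def by (intro tendsto_sum tendsto_mult tendsto_const tendsto_prod assms)

text \<open>The columns of \<open>N\<close> form a basis of the space that extends a basis of
  \<open>K\<close>, and \<open>J\<close> indexes the columns taken from \<open>K\<close>. Uniqueness
  of coordinates gives the equivalence.\<close>

lemma subspace_spanned_by_columns:
  fixes K :: "(real ^ 'k) set"
  assumes K: "subspace K"
  obtains J :: "'k set" and N :: "real ^ 'k ^ 'k"
  where "card J = dim K" "det N \<noteq> 0" "\<And>x. N *v x \<in> K \<longleftrightarrow> (\<forall>i. i \<notin> J \<longrightarrow> x $ i = 0)"
proof -
  obtain B where B: "B \<subseteq> K" "independent B" "K \<subseteq> span B" "card B = dim K"
    by (rule basis_exists)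
  obtain C where C: "B \<subseteq> C" "C \<subseteq> UNIV" "independent C" "UNIV \<subseteq> span C"
    using maximal_independent_subset_extend[OF subset_UNIV B(2)] .
  have fin: "finite C" using C(3) independent_imp_finite by blast
  have "card C = CARD('k)"
    using dim_unique[OF C(2,4,3) refl] by simp
  then obtain f where f: "bij_betw f (UNIV :: 'k set) C"
    using finite_same_card_bij[OF finite[of "UNIV :: 'k set"] fin] by auto
  define J where "J = {j. f j \<in> B}"
  define N where "N = (\<chi> i j. f j $ i)"
  have cardJ: "card J = dim K"
  proof -
    have "f ` J = B" using f C(1) by (auto simp: J_def bij_betw_def)
    moreover have "inj_on f J" using f by (auto simp: bij_betw_def intro: inj_on_subset)
    ultimately show ?thesis using B(4) card_image by metis
  qed
  have Nx: "N *v x = (\<Sum>j\<in>UNIV. x $ j *\<^sub>R f j)" for x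
    by (simp add: vec_eq_iff N_def matrix_vector_mult_def mult.commute)
  have inj0: "x = 0" if "N *v x = 0" for x
  proof -
    have "(\<Sum>c\<in>C. (x $ inv_into UNIV f c) *\<^sub>R c) = (\<Sum>j\<in>UNIV. x $ j *\<^sub>R f j)"
      using f by (subst sum.reindex_bij_betw[OF f, symmetric]) (auto simp: bij_betw_def intro!: sum.cong)
    then have "(\<Sum>c\<in>C. (x $ inv_into UNIV f c) *\<^sub>R c) = 0" using that Nx by simp
    then have "x $ inv_into UNIV f c = 0" if "c \<in> C" for c
      using fin that independentD[OF C(3) fin order_refl, of "\<lambda>c. x $ inv_into UNIV f c"] by blast
    then have "x $ j = 0" for j
      using f by (metis UNIV_I bij_betwE bij_betw_def inv_into_f_f)
    then show ?thesis by (simp add: vec_eq_iff)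
  qed
  then have "inj ((*v) N)" using linear_injective_0[of "(*v) N"] by simp
  then have det: "det N \<noteq> 0" using det_nz_iff_inj[OF matrix_vector_mul_linear, of N] by simp
  have sup: "N *v x \<in> K" if "\<And>i. i \<notin> J \<Longrightarrow> x $ i = 0" for x
    unfolding Nx
  proof (rule subspace_sum[OF K])
    fix j show "x $ j *\<^sub>R f j \<in> K"
      using that[of j] B(1) K by (cases "j \<in> J") (auto simp: J_def intro: subspace_scale subspace_0)
  qed
  have "x $ i = 0" if "N *v x \<in> K" "i \<notin> J" for x i
  proof -
    have "N *v x \<in> span B" using that B(3) by blast
    then obtain y where y: "N *v x = (\<Sum>b\<in>B. y b *\<^sub>R b)"
      using span_finite[of B] fin C(1) finite_subset by (metis (mono_tags, lifting) rangeE)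
    define z where "z = (\<chi> j. if j \<in> J then y (f j) else 0)"
    have "N *v z = (\<Sum>j\<in>J. y (f j) *\<^sub>R f j)"
      unfolding Nx z_def by (simp add: if_distrib if_distribR sum.If_cases cong: if_cong)
    also have "\<dots> = (\<Sum>b\<in>B. y b *\<^sub>R b)"
      by (rule sum.reindex_bij_betw) (use f C(1) in \<open>auto simp: J_def bij_betw_def intro: inj_on_subset\<close>)
    finally have "N *v (x - z) = 0" using y by (simp add: matrix_vector_mult_diff_distrib)
    then have "x = z" using inj0 by fastforce
    then show ?thesis using that(2) by (simp add: z_def)
  qed
  with sup that[OF cardJ det] show ?thesis by blast
qed

text \<open>Dividing by \<open>t\<close> the columns of \<open>M t\<close> along the kernel of \<open>M 0\<close> gives a matrix with an
  invertible limit, so that \<open>det (M t)\<close> is of exact order \<open>t\<close> to the dimension of the kernel.\<close>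

lemma det_changes_sign:
  fixes M :: "real \<Rightarrow> real ^ 'k ^ 'k"
  assumes dM: "\<And>w. ((\<lambda>t. M t *v w) has_vector_derivative B w) (at 0)"
    and odd: "odd (dim {w. M 0 *v w = 0})"
    and B: "\<And>w. M 0 *v w = 0 \<Longrightarrow> w \<noteq> 0 \<Longrightarrow> B w \<notin> range ((*v) (M 0))"
  shows "\<exists>\<delta>>0. \<forall>t. 0 < t \<and> t < \<delta> \<longrightarrow> det (M t) * det (M (- t)) < 0"
proof -
  define K where "K = {w. M 0 *v w = 0}"
  have "subspace K" unfolding K_def by (rule linear_subspace_kernel) simp
  then obtain J N where J: "card J = dim K" and N: "det N \<noteq> 0"
    and NK: "\<And>x. N *v x \<in> K \<longleftrightarrow> (\<forall>i. i \<notin> J \<longrightarrow> x $ i = 0)"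
    using subspace_spanned_by_columns by blast
  define c where "c j = N *v axis j 1" for j
  have cK: "M 0 *v c j = 0" if "j \<in> J" for j
    using NK[of "axis j 1"] that by (auto simp: c_def K_def axis_def)
  have Nx: "N *v x = (\<Sum>j\<in>UNIV. x $ j *\<^sub>R c j)" for x
    unfolding c_def matrix_vector_mult_basis unfolding matrix_mult_sum by (simp add: scalar_mult_eq_scaleR)
  have Ninj: "x = 0" if "N *v x = 0" for x
    using N that by (metis invertible_det_nz invertible_left_inverse matrix_left_invertible_ker)
  \<comment> \<open>The limit of \<open>C t\<close> as \<open>t\<close> tends to 0: on a kernel
    column the difference quotient of \<open>M t *v c j\<close> is just its quotient by
    \<open>t\<close>.\<close>
  define L where "L = (\<chi> i j. (if j \<in> J then B (c j) else M 0 *v c j) $ i)"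
  define C where "C t = (\<chi> i j. (if j \<in> J then (1 / t) *\<^sub>R (M t *v c j) else M t *v c j) $ i)" for t
  have lim: "((\<lambda>t. det (C t)) \<longlongrightarrow> det L) (at 0)"
  proof (rule tendsto_det)
    fix i j
    show "((\<lambda>t. C t $ i $ j) \<longlongrightarrow> L $ i $ j) (at 0)"
    proof (cases "j \<in> J")
      case True
      have "((\<lambda>t. (M t *v c j) $ i) has_real_derivative B (c j) $ i) (at 0)"
        unfolding has_real_derivative_iff_has_vector_derivative
        by (rule bounded_linear.has_vector_derivative[OF bounded_linear_vec_nth dM])
      then have "((\<lambda>t. (M t *v c j) $ i / t) \<longlongrightarrow> B (c j) $ i) (at 0)"
        using cK[OF True] by (simp add: DERIV_def)
      then show ?thesis using True by (simp add: C_def L_def)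
    next
      case False
      have "isCont (\<lambda>t. M t *v c j) 0" using dM has_vector_derivative_continuous by blast
      then have "((\<lambda>t. M t *v c j) \<longlongrightarrow> M 0 *v c j) (at 0)" by (simp add: isCont_def)
      from tendsto_vec_nth[OF this, of i] show ?thesis using False by (simp add: C_def L_def)
    qed
  qed
  have linB: "linear B"
  proof (rule linearI)
    show "B (v + w) = B v + B w" for v w
      using has_vector_derivative_add[OF dM[of v] dM[of w]] dM[of "v + w"]
      unfolding matrix_vector_right_distrib by (rule vector_derivative_unique_at[symmetric])
    show "B (a *\<^sub>R v) = a *\<^sub>R B v" for a v
      using bounded_linear.has_vector_derivative[OF bounded_linear_scaleR_right dM[of v], of a] dM[of "a *\<^sub>R v"]
      unfolding matrix_vector_mult_scaleR by (rule vector_derivative_unique_at[symmetric])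
  qed
  have detL: "det L \<noteq> 0"
  proof -
    have "x = 0" if x: "L *v x = 0" for x
    proof -
      \<comment> \<open>With \<open>N *v y\<close> in the kernel, \<open>L *v x = 0\<close> puts
        \<open>B (N *v y)\<close> in the range of \<open>M 0\<close>. Nondegeneracy forces
        \<open>N *v y = 0\<close>, which leaves \<open>N *v z\<close> in the kernel and so
        \<open>z = 0\<close>.\<close>
      define y where "y = (\<chi> j. if j \<in> J then x $ j else 0)"
      define z where "z = (\<chi> j. if j \<in> J then 0 else x $ j)"
      have xyz: "x = y + z" by (simp add: y_def z_def vec_eq_iff)
      have "L *v x = (\<Sum>j\<in>UNIV. x $ j *\<^sub>R (if j \<in> J then B (c j) else M 0 *v c j))"
        by (simp add: vec_eq_iff L_def matrix_vector_mult_def mult.commute)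
      also have "\<dots> = (\<Sum>j\<in>UNIV. y $ j *\<^sub>R B (c j) + z $ j *\<^sub>R (M 0 *v c j))"
        by (intro sum.cong) (auto simp: y_def z_def)
      also have "\<dots> = B (N *v y) + M 0 *v (N *v z)"
        unfolding Nx by (simp add: sum.distrib linear_sum[OF linB] linear_scale[OF linB]
          linear_sum[OF matrix_vector_mul_linear] matrix_vector_mult_scaleR)
      finally have Lx: "L *v x = B (N *v y) + M 0 *v (N *v z)" .
      then have "B (N *v y) = M 0 *v (- (N *v z))"
        using x by (simp add: eq_neg_iff_add_eq_0 linear_neg[OF matrix_vector_mul_linear])
      moreover have yK: "N *v y \<in> K" using NK by (simp add: y_def)
      ultimately have Ny: "N *v y = 0" using B[of "N *v y"] by (auto simp: K_def)
      then have "N *v z \<in> K"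
        using Lx x linear_0[OF linB] by (simp add: K_def)
      then have "z = 0" using NK[of z] by (auto simp: z_def vec_eq_iff)
      moreover have "y = 0" using Ninj[OF Ny] .
      ultimately show ?thesis using xyz by simp
    qed
    then have "inj ((*v) L)" using linear_injective_0[of "(*v) L"] by simp
    then show ?thesis using det_nz_iff_inj[OF matrix_vector_mul_linear, of L] by simp
  qed
  \<comment> \<open>\<open>C t\<close> is \<open>M t\<close> in the basis \<open>N\<close>, followed
    by a diagonal matrix that divides the columns in \<open>J\<close> by \<open>t\<close>.\<close>
  have detC: "det (C t) * t ^ card J = det (M t) * det N" if "t \<noteq> 0" for t
  proof -
    define D where "D = (\<chi> i j. if i = j then (if j \<in> J then 1 / t else 1) else 0 :: real ^ 'k ^ 'k)"
    have "(M t ** N ** D) *v axis j 1 = C t *v axis j 1" for j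
    proof -
      have "D *v axis j 1 = (if j \<in> J then 1 / t else 1) *\<^sub>R axis j 1"
        unfolding matrix_vector_mult_basis by (auto simp: column_def D_def axis_def vec_eq_iff)
      then have "(M t ** N ** D) *v axis j 1 = (if j \<in> J then 1 / t else 1) *\<^sub>R (M t *v c j)"
        by (simp add: c_def matrix_vector_mult_scaleR flip: matrix_vector_mul_assoc)
      then show ?thesis by (simp add: matrix_vector_mult_basis column_def C_def vec_eq_iff)
    qed
    then have "C t = M t ** N ** D"
      unfolding matrix_vector_mult_basis by (simp add: column_def vec_eq_iff)
    moreover have "det D = (1 / t) ^ card J"
      by (subst det_diagonal) (auto simp: D_def prod.If_cases)
    ultimately show ?thesis using that by (simp add: det_mul power_divide)
  qed
  have "\<forall>\<^sub>F t in at 0. det (C t) * det L > 0"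
  proof -
    have "((\<lambda>t. det (C t) * det L) \<longlongrightarrow> det L * det L) (at 0)" by (intro tendsto_mult lim tendsto_const)
    moreover have "0 < det L * det L" using detL not_real_square_gt_zero by blast
    ultimately show ?thesis by (rule order_tendstoD(1))
  qed
  then obtain \<delta> where \<delta>: "\<delta> > 0" "\<And>t. t \<noteq> 0 \<Longrightarrow> dist t 0 < \<delta> \<Longrightarrow> det (C t) * det L > 0"
    unfolding eventually_at by auto
  have "det (M t) * det (M (- t)) < 0" if "0 < t" "t < \<delta>" for t
  proof -
    have "det (C t) * det L > 0" "det (C (- t)) * det L > 0" using \<delta>(2)[of t] \<delta>(2)[of "-t"] that by auto
    then have CC: "det (C t) * det (C (- t)) > 0" by (auto simp: zero_less_mult_iff)
    \<comment> \<open>The only place where parity enters: the power of \<open>-t\<close> contributes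
      the minus sign.\<close>
    have "odd (card J)" using odd J by (simp add: K_def)
    then have 2: "- (det (C (- t)) * t ^ card J) = det (M (- t)) * det N" using detC[of "- t"] that by simp
    have 1: "det (C t) * t ^ card J = det (M t) * det N" using detC[of t] that by simp
    \<comment> \<open>The squared factor removes the unknown sign of \<open>det N\<close>.\<close>
    have "(det (M t) * det (M (- t))) * (det N)\<^sup>2 = (det (M t) * det N) * (det (M (- t)) * det N)"
      by (simp add: power2_eq_square)
    also have "\<dots> = - ((det (C t) * det (C (- t))) * (t ^ card J)\<^sup>2)"
      unfolding 1[symmetric] 2[symmetric] by (simp add: power2_eq_square)
    also have "\<dots> < 0" using mult_pos_pos[OF CC, of "(t ^ card J)\<^sup>2"] that by simp
    finally show ?thesis by (simp add: mult_less_0_iff not_less)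
  qed
  with \<delta>(1) show ?thesis by blast
qed

text \<open>Near a zero at which its derivative is invertible, a map never points in the direction
  opposite to that of its derivative.\<close>

lemma homotopic_derivative_on_small_sphere:
  fixes f :: "'a::euclidean_space \<Rightarrow> 'a"
  assumes f: "(f has_derivative D) (at p)" and f0: "f p = 0"
    and D: "\<And>v. D v = 0 \<Longrightarrow> v = 0" and cont: "continuous_on (ball p \<epsilon>) f" "0 < \<epsilon>"
  obtains r0 where "r0 > 0"
    "\<And>r. 0 < r \<Longrightarrow> r < r0 \<Longrightarrow>
       homotopic_with_canon (\<lambda>_. True) (sphere 0 1) (-{0}) (\<lambda>x. f (p + r *\<^sub>R x)) D"
proof -
  have lin: "linear D" using f has_derivative_linear by blast
  obtain c where c: "c > 0" "\<And>v. c * norm v \<le> norm (D v)"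
    using linear_inj_bounded_below_pos[OF lin] linear_injective_0[OF lin] D by blast
  obtain d where d: "d > 0" "\<And>y. norm (y - p) < d \<Longrightarrow> norm (f y - f p - D (y - p)) \<le> c / 2 * norm (y - p)"
    using f c(1) unfolding has_derivative_at_alt by (meson half_gt_zero)
  show ?thesis
  proof (rule that[of "min d \<epsilon>"])
    fix r assume r: "0 < r" "r < min d \<epsilon>"
    show "homotopic_with_canon (\<lambda>_. True) (sphere 0 1) (-{0}) (\<lambda>x. f (p + r *\<^sub>R x)) D"
    proof (rule homotopic_with_linear)
      show "continuous_on (sphere 0 1) (\<lambda>x. f (p + r *\<^sub>R x))"
        by (rule continuous_on_compose2[OF cont(1)]) (use r in \<open>auto intro!: continuous_intros simp: dist_norm\<close>)
      show "continuous_on (sphere 0 1) D" using lin by (simp add: linear_continuous_on linear_conv_bounded_linear)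
      fix x :: 'a assume x: "x \<in> sphere 0 1"
      define y where "y = f (p + r *\<^sub>R x)"
      have "norm (y - r *\<^sub>R D x) \<le> c / 2 * r"
        using d(2)[of "p + r *\<^sub>R x"] r x by (simp add: y_def f0 linear_scale[OF lin])
      also have "\<dots> < c * r" using c r by simp
      also have "\<dots> \<le> norm (r *\<^sub>R D x)" using c(2)[of x] x r by simp
      \<comment> \<open>A vector closer to \<open>r *\<^sub>R D x\<close> than the origin is has
        positive inner product with it.\<close>
      finally have "(norm (y - r *\<^sub>R D x))\<^sup>2 < (norm (r *\<^sub>R D x))\<^sup>2"
        by (intro power_strict_mono) auto
      then have "y \<bullet> y < 2 * r * (y \<bullet> D x)"
        unfolding power2_norm_eq_inner by (simp add: inner_diff_left inner_diff_right inner_commute)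
      then have "0 < r * (y \<bullet> D x)" using inner_ge_zero[of y] by linarith
      then have pos: "0 < y \<bullet> D x" using r by (simp add: zero_less_mult_iff)
      have "D x \<noteq> 0" using D x by force
      show "closed_segment (f (p + r *\<^sub>R x)) (D x) \<subseteq> -{0}"
      proof
        fix q assume "q \<in> closed_segment (f (p + r *\<^sub>R x)) (D x)"
        then obtain s where s: "0 \<le> s" "s \<le> 1" "q = (1 - s) *\<^sub>R y + s *\<^sub>R D x"
          by (auto simp: closed_segment_def y_def)
        \<comment> \<open>The inner product with \<open>D x\<close> remains positive along the
          segment, so the segment misses the origin.\<close>
        have "0 < (1 - s) * (y \<bullet> D x) + s * (D x \<bullet> D x)"
          using s pos \<open>D x \<noteq> 0\<close> by (cases "s = 0") (auto intro!: add_nonneg_pos mult_pos_pos)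
        then show "q \<in> -{0}" using s(3) by (auto simp flip: inner_scaleR_left inner_add_left)
      qed
    qed
  qed (use d cont in auto)
qed

section \<open>The equilibrium manifold\<close>

lemma open_Omega: "open (Omega :: ('n::finite, 'm::finite) endowments set)"
proof -
  have "Omega = (\<Inter>i. {\<omega> :: ('n, 'm) endowments. \<omega> $ i \<in> pos_orthant})" by (auto simp: Omega_def)
  also have "open \<dots>"
    by (intro open_INT ballI open_vimage[OF open_pos_orthant, unfolded vimage_def] finite)
      (auto intro!: continuous_intros)
  finally show ?thesis .
qed

abbreviation price_endowments :: "((real ^ 'n::finite) \<times> ('n, 'm::finite) endowments) set" where
  "price_endowments \<equiv> pos_orthant \<times> Omega"

lemma open_price_endowments: "open price_endowments"
  by (intro open_Times open_pos_orthant open_Omega)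

lemma demand_cong:
  "full_price p \<bullet> a = full_price p \<bullet> a' \<Longrightarrow> demand U p a = demand U p a'"
  by (simp add: demand_def budget_set_def)

definition drop_numeraire :: "'n goods_bundle \<Rightarrow> real ^ 'n::finite" where
  "drop_numeraire y = (\<chi> k. y $ Some k)"

lemma bounded_linear_drop_numeraire: "bounded_linear drop_numeraire"
  unfolding linear_conv_bounded_linear[symmetric]
  by (rule linearI) (auto simp: drop_numeraire_def vec_eq_iff)

text \<open>With numeraire price 1, the last component of a vector of zero value is determined by
  the others. Through Walras' law this makes the reduced system equivalent to market
  clearing.\<close>

lemma eq_0_if_drop_numeraire_0:
  fixes y :: "('n::finite) goods_bundle"
  assumes "drop_numeraire y = 0" "full_price p \<bullet> y = 0"
  shows "y = 0"
proof -
  have k: "y $ Some k = 0" for k using assms(1) by (simp add: drop_numeraire_def vec_eq_iff)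
  have "full_price p \<bullet> y = (\<Sum>j\<in>(UNIV :: 'n option set). if j = None then y $ None else 0)"
    unfolding inner_vec_def full_price_def by (intro sum.cong) (auto simp: k split: option.split)
  then have "y $ None = 0" using assms(2) by simp
  with k show ?thesis by (metis vec_eq_iff zero_index not_None_eq)
qed

context
  fixes u :: "'m::finite \<Rightarrow> ('n::finite) goods_bundle \<Rightarrow> real"
  assumes util: "\<And>i. admissible_utility (u i)"
begin

definition excess :: "(real ^ 'n) \<times> ('n, 'm) endowments \<Rightarrow> 'n goods_bundle" where
  "excess e = excess_demand u (fst e) (snd e)"

definition reduced :: "(real ^ 'n) \<times> ('n, 'm) endowments \<Rightarrow> real ^ 'n" where
  "reduced e = drop_numeraire (excess e)"

lemma reduced_excess_demand_eq: "reduced_excess_demand u \<omega> p = reduced (p, \<omega>)"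
  by (simp add: reduced_excess_demand_def reduced_def excess_def drop_numeraire_def)

lemma equilibria_eq: "equilibria u = {e \<in> price_endowments. excess e = 0}"
  by (auto simp: equilibria_def excess_def)

lemma income_pos:
  assumes "e \<in> price_endowments"
  shows "0 < full_price (fst e) \<bullet> snd e $ i"
  by (intro inner_pos_orthant full_price_pos) (use assms in \<open>auto simp: Omega_def\<close>)

lemma Ck_on_excess: "Ck_on k price_endowments excess"
proof -
  have 1: "Ck_on k price_endowments (\<lambda>e :: (real ^ 'n) \<times> ('n, 'm) endowments. fst e)"
    "Ck_on k price_endowments (\<lambda>e :: (real ^ 'n) \<times> ('n, 'm) endowments. snd e)"
    by (intro Ck_on_linear bounded_linear_fst bounded_linear_snd open_price_endowments)+
  have "Ck_on k price_endowments (\<lambda>e. \<Sum>i\<in>UNIV. demand (u i) (fst e) (snd e $ i) - snd e $ i)"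
    by (intro Ck_on_sum Ck_on_diff Ck_on_demand[OF util] Ck_on_vec_nth open_price_endowments 1 income_pos) auto
  then show ?thesis unfolding excess_def excess_demand_def .
qed

lemma Ck_on_reduced: "Ck_on k price_endowments reduced"
  unfolding reduced_def
  by (rule Ck_on_bounded_linear[OF bounded_linear_drop_numeraire open_price_endowments Ck_on_excess])

lemma Walras_law:
  assumes "e \<in> price_endowments"
  shows "full_price (fst e) \<bullet> excess e = 0"
proof -
  have "full_price (fst e) \<bullet> (demand (u i) (fst e) (snd e $ i) - snd e $ i) = 0" for i
    using demand_budget[OF util _ income_pos[OF assms], of i i] assms
    by (auto simp: inner_diff_right)
  then show ?thesis by (simp add: excess_def excess_demand_def inner_sum_right)
qed

lemma equilibria_iff_reduced:
  "e \<in> equilibria u \<longleftrightarrow> e \<in> price_endowments \<and> reduced e = 0"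
  using eq_0_if_drop_numeraire_0[OF _ Walras_law, of e]
    linear_0[OF bounded_linear.linear[OF bounded_linear_drop_numeraire]]
  by (auto simp: equilibria_eq reduced_def)

section \<open>Tangent space of the equilibrium manifold\<close>

text \<open>Handing the excess demand to one consumer leaves all incomes unchanged, because it has
  zero value, and clears the markets. This retracts a neighbourhood of the equilibrium manifold
  onto it.\<close>

definition clear :: "(real ^ 'n) \<times> ('n, 'm) endowments \<Rightarrow> (real ^ 'n) \<times> ('n, 'm) endowments" where
  "clear e = (fst e, snd e + axis undefined (excess e))"

lemma clear_equilibrium:
  assumes "e \<in> price_endowments" "clear e \<in> price_endowments"
  shows "clear e \<in> equilibria u"
proof -
  \<comment> \<open>An arbitrary but fixed consumer, the one used in \<open>clear\<close>.\<close>
  define j :: 'm where "j = undefined"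
  have W: "full_price (fst e) \<bullet> excess e = 0" using Walras_law[OF assms(1)] .
  have d: "demand (u i) (fst e) ((snd e + axis j (excess e)) $ i) = demand (u i) (fst e) (snd e $ i)" for i
    by (rule demand_cong) (simp add: inner_add_right axis_def W)
  have "excess (clear e) = excess_demand u (fst e) (snd e + axis j (excess e))"
    by (subst excess_def) (simp add: clear_def j_def)
  also have "\<dots> = (\<Sum>i\<in>UNIV. (demand (u i) (fst e) (snd e $ i) - snd e $ i) - axis j (excess e) $ i)"
    unfolding excess_demand_def d by (intro sum.cong) (simp_all add: algebra_simps)
  also have "\<dots> = excess e - excess e"
    by (simp add: sum_subtractf excess_def excess_demand_def axis_def)
  finally show ?thesis using assms(2) by (simp add: equilibria_eq)
qed

lemma clear_id: "e \<in> equilibria u \<Longrightarrow> clear e = e"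
  by (simp add: clear_def equilibria_eq axis_def prod_eq_iff vec_eq_iff)

lemma Ck_on_clear: "Ck_on k price_endowments clear"
proof -
  have eq: "clear e = e + (0, axis undefined (excess e))" for e by (simp add: clear_def prod_eq_iff)
  have "Ck_on k price_endowments (\<lambda>e. e + (0, axis undefined (excess e)))"
  proof (rule Ck_on_add[OF open_price_endowments Ck_on_linear[OF bounded_linear_ident open_price_endowments]])
    have "bounded_linear (\<lambda>y :: 'n goods_bundle. (0 :: real ^ 'n, axis undefined y :: ('n, 'm) endowments))"
      by (intro bounded_linear_Pair bounded_linear_zero bounded_linear_axis)
    from Ck_on_bounded_linear[OF this open_price_endowments Ck_on_excess]
    show "Ck_on k price_endowments (\<lambda>e. (0 :: real ^ 'n, axis undefined (excess e) :: ('n, 'm) endowments))" .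
  qed
  then show ?thesis by (simp flip: eq)
qed

lemma has_derivative_reduced:
  "e \<in> price_endowments \<Longrightarrow> (reduced has_derivative frechet_derivative reduced (at e)) (at e)"
  using Ck_on_Suc_has_derivative[OF Ck_on_reduced] .

lemma has_derivative_excess:
  "e \<in> price_endowments \<Longrightarrow> (excess has_derivative frechet_derivative excess (at e)) (at e)"
  using Ck_on_Suc_has_derivative[OF Ck_on_excess] .

text \<open>Differentiating Walras' law gives a term in the change of prices, which is paired with
  the excess demand and so disappears at an equilibrium. What remains is that the derivative of the
  excess demand has zero value.\<close>

lemma excess_derivative_zero:
  assumes e: "e \<in> equilibria u" and w: "frechet_derivative reduced (at e) w = 0"
  shows "frechet_derivative excess (at e) w = 0"
proof (rule eq_0_if_drop_numeraire_0)
  have eP: "e \<in> price_endowments" using e by (simp add: equilibria_eq)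
  have "(reduced has_derivative (\<lambda>w. drop_numeraire (frechet_derivative excess (at e) w))) (at e)"
    unfolding reduced_def
    by (rule bounded_linear.has_derivative[OF bounded_linear_drop_numeraire has_derivative_excess[OF eP]])
  from has_derivative_unique[OF this has_derivative_reduced[OF eP]]
  show "drop_numeraire (frechet_derivative excess (at e) w) = 0" using w by metis
  have "Ck_on (Suc 0) price_endowments (\<lambda>e :: (real ^ 'n) \<times> ('n, 'm) endowments. full_price (fst e))"
    by (intro Ck_on_full_price Ck_on_linear open_price_endowments bounded_linear_fst)
  from Ck_on_Suc_has_derivative[OF this eP] obtain F where
    F: "((\<lambda>e :: (real ^ 'n) \<times> ('n, 'm) endowments. full_price (fst e)) has_derivative F) (at e)" by blast
  have 1: "((\<lambda>e. full_price (fst e) \<bullet> excess e) has_derivative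
      (\<lambda>w. full_price (fst e) \<bullet> frechet_derivative excess (at e) w + F w \<bullet> excess e)) (at e)"
    by (rule has_derivative_inner[OF F has_derivative_excess[OF eP]])
  have "((\<lambda>e. full_price (fst e) \<bullet> excess e) has_derivative (\<lambda>w. 0)) (at e)"
    by (rule has_derivative_transform_within_open[OF has_derivative_const open_price_endowments eP])
      (simp add: Walras_law)
  from has_derivative_unique[OF 1 this]
  have "full_price (fst e) \<bullet> frechet_derivative excess (at e) w + F w \<bullet> excess e = 0" by metis
  then show "full_price (fst e) \<bullet> frechet_derivative excess (at e) w = 0"
    using e by (simp add: equilibria_eq)
qed

text \<open>On the kernel of the reduced differential the correction made by \<open>clear\<close>
  vanishes to first order, so clearing a straight line leaves its velocity intact.\<close>

lemma has_derivative_clear: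
  assumes e: "e \<in> equilibria u"
  obtains C where "(clear has_derivative C) (at e)" "\<And>w. frechet_derivative reduced (at e) w = 0 \<Longrightarrow> C w = w"
proof
  have eP: "e \<in> price_endowments" using e by (simp add: equilibria_eq)
  have eq: "clear = (\<lambda>e. e + (0, axis undefined (excess e)))" by (auto simp: clear_def prod_eq_iff)
  show "(clear has_derivative (\<lambda>w. w + (0, axis undefined (frechet_derivative excess (at e) w)))) (at e)"
    unfolding eq
    by (intro has_derivative_add has_derivative_ident has_derivative_Pair has_derivative_const
        bounded_linear.has_derivative[OF bounded_linear_axis] has_derivative_excess eP)
  show "w + (0, axis undefined (frechet_derivative excess (at e) w)) = w"
    if "frechet_derivative reduced (at e) w = 0" for w
    using excess_derivative_zero[OF e that] by (simp add: prod_eq_iff axis_def vec_eq_iff)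
qed

text \<open>Curves in the manifold annihilate the reduced excess demand, which gives one inclusion.
  For the other, a kernel vector \<open>w\<close> is realized by the curve that clears the points
  \<open>e + t *\<^sub>R w\<close>.\<close>

lemma tangent_space_equilibria:
  assumes e: "e \<in> equilibria u"
  shows "tangent_space (equilibria u) e = {w. frechet_derivative reduced (at e) w = 0}"
proof (intro equalityI subsetI CollectI)
  have eP: "e \<in> price_endowments" using e by (simp add: equilibria_eq)
  fix w assume "w \<in> tangent_space (equilibria u) e"
  then obtain c \<epsilon> where c: "0 < (\<epsilon>::real)" "c ` {-\<epsilon><..<\<epsilon>} \<subseteq> equilibria u" "c 0 = e"
    "(c has_vector_derivative w) (at 0)"
    unfolding tangent_space_def by blast
  have "(reduced has_derivative frechet_derivative reduced (at e)) (at (c 0))"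
    using has_derivative_reduced[OF eP] c(3) by simp
  from has_derivative_compose[OF c(4)[unfolded has_vector_derivative_def] this]
  have 1: "((\<lambda>t. reduced (c t)) has_derivative (\<lambda>h. frechet_derivative reduced (at e) (h *\<^sub>R w))) (at 0)" .
  have "((\<lambda>t. reduced (c t)) has_derivative (\<lambda>h. 0)) (at 0)"
  proof (rule has_derivative_transform_within_open[OF has_derivative_const])
    show "0 = reduced (c t)" if "t \<in> {-\<epsilon><..<\<epsilon>}" for t
      using c(2) that equilibria_iff_reduced[of "c t"] by (simp add: image_subset_iff)
  qed (use c in auto)
  from has_derivative_unique[OF 1 this] have "frechet_derivative reduced (at e) (1 *\<^sub>R w) = 0" by metis
  then show "frechet_derivative reduced (at e) w = 0" by simp
next
  have eP: "e \<in> price_endowments" using e by (simp add: equilibria_eq)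
  fix w assume "w \<in> {w. frechet_derivative reduced (at e) w = 0}"
  then have w: "frechet_derivative reduced (at e) w = 0" by simp
  define c where "c t = clear (e + t *\<^sub>R w)" for t
  have "\<forall>\<^sub>F t in nhds 0. e + t *\<^sub>R w \<in> price_endowments"
  proof -
    have "open {t. e + t *\<^sub>R w \<in> price_endowments}"
      by (rule open_vimage[OF open_price_endowments, unfolded vimage_def]) (intro continuous_intros)
    then show ?thesis using eP by (auto simp: eventually_nhds intro!: exI[of _ "{t. e + t *\<^sub>R w \<in> price_endowments}"])
  qed
  moreover have "\<forall>\<^sub>F t in nhds 0. c t \<in> price_endowments"
  proof -
    have "isCont clear e"
      using Ck_on_imp_continuous_on[OF Ck_on_clear[of 0]] eP continuous_on_eq_continuous_at[OF open_price_endowments]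
      by blast
    moreover have "isCont (\<lambda>t. e + t *\<^sub>R w) 0" by (intro continuous_intros)
    ultimately have "isCont c 0"
      using isCont_o2[of 0 "\<lambda>t. e + t *\<^sub>R w" clear] unfolding c_def[abs_def] by simp
    then have "(c \<longlongrightarrow> c 0) (nhds 0)"
      unfolding isCont_def using tendsto_at_iff_tendsto_nhds[of c 0] by blast
    moreover have "c 0 = e" using clear_id[OF e] by (simp add: c_def)
    ultimately show ?thesis using topological_tendstoD[OF _ open_price_endowments, of c e] eP by simp
  qed
  ultimately have "\<forall>\<^sub>F t in nhds 0. e + t *\<^sub>R w \<in> price_endowments \<and> c t \<in> price_endowments"
    by eventually_elim simp
  then obtain \<epsilon> where \<epsilon>: "\<epsilon> > 0"
    "\<And>t. dist t 0 < \<epsilon> \<Longrightarrow> e + t *\<^sub>R w \<in> price_endowments \<and> c t \<in> price_endowments"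
    unfolding eventually_nhds_metric by blast
  have near: "e + t *\<^sub>R w \<in> price_endowments" "c t \<in> price_endowments" if "t \<in> {-\<epsilon><..<\<epsilon>}" for t
    using \<epsilon>(2)[of t] that by (auto simp del: mem_Sigma_iff)
  have "smooth_on {-\<epsilon><..<\<epsilon>} c"
    unfolding smooth_on_def c_def
  proof
    fix k
    show "Ck_on k {-\<epsilon><..<\<epsilon>} (\<lambda>t. clear (e + t *\<^sub>R w))"
    proof (rule Ck_on_compose[OF open_greaterThanLessThan open_price_endowments _ _ Ck_on_clear])
      show "Ck_on k {-\<epsilon><..<\<epsilon>} (\<lambda>t. e + t *\<^sub>R w)"
        by (intro Ck_on_add Ck_on_const Ck_on_scaleR Ck_on_linear[OF bounded_linear_ident] open_greaterThanLessThan)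
    qed (use near in blast)
  qed
  moreover have "c ` {-\<epsilon><..<\<epsilon>} \<subseteq> equilibria u"
    using clear_equilibrium near unfolding c_def by blast
  moreover have "c 0 = e" using clear_id[OF e] by (simp add: c_def)
  moreover have "(c has_vector_derivative w) (at 0)"
  proof -
    obtain C where C: "(clear has_derivative C) (at e)" "\<And>w. frechet_derivative reduced (at e) w = 0 \<Longrightarrow> C w = w"
      by (rule has_derivative_clear[OF e]) blast
    have "((\<lambda>t. e + t *\<^sub>R w) has_derivative (\<lambda>h. h *\<^sub>R w)) (at 0)" by (auto intro!: derivative_eq_intros)
    from has_derivative_compose[OF this, of clear C] C(1)
    have "(c has_derivative (\<lambda>h. C (h *\<^sub>R w))) (at 0)" by (simp add: c_def[abs_def])
    then show ?thesis using linear_scale[OF has_derivative_linear[OF C(1)]] C(2)[OF w]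
      by (simp add: has_vector_derivative_def)
  qed
  ultimately show "w \<in> tangent_space (equilibria u) e"
    unfolding tangent_space_def using \<epsilon>(1) by blast
qed

section \<open>Differential in the prices and regular equilibria\<close>

lemma price_derivative:
  assumes "(p, \<omega>) \<in> price_endowments"
  shows "(reduced_excess_demand u \<omega> has_derivative (\<lambda>v. frechet_derivative reduced (at (p, \<omega>)) (v, 0))) (at p)"
    "frechet_derivative (reduced_excess_demand u \<omega>) (at p) v = frechet_derivative reduced (at (p, \<omega>)) (v, 0)"
proof -
  have "((\<lambda>p. (p, \<omega>)) has_derivative (\<lambda>v. (v, 0))) (at p)" by (auto intro!: derivative_eq_intros)
  from has_derivative_compose[OF this has_derivative_reduced[OF assms]]
  show 1: "(reduced_excess_demand u \<omega> has_derivative (\<lambda>v. frechet_derivative reduced (at (p, \<omega>)) (v, 0))) (at p)"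
    unfolding reduced_excess_demand_eq[abs_def] .
  from frechet_derivative_at[OF 1]
  show "frechet_derivative (reduced_excess_demand u \<omega>) (at p) v = frechet_derivative reduced (at (p, \<omega>)) (v, 0)"
    by metis
qed

lemma linear_price_derivative:
  assumes "(p, \<omega>) \<in> price_endowments"
  shows "linear (frechet_derivative (reduced_excess_demand u \<omega>) (at p))"
  using has_derivative_linear[OF price_derivative(1)[OF assms]]
  by (simp add: price_derivative(2)[OF assms, abs_def])

text \<open>When the price part of the full differential is invertible, the kernel is the graph of a
  linear map over the endowment directions, and the projection is bijective on it.\<close>

lemma regular_equilibriumI:
  assumes e: "(p, \<omega>) \<in> equilibria u"
    and inj: "\<And>v. frechet_derivative (reduced_excess_demand u \<omega>) (at p) v = 0 \<Longrightarrow> v = 0"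
  shows "regular_equilibrium u (p, \<omega>)"
proof -
  have eP: "(p, \<omega>) \<in> price_endowments" using e by (simp add: equilibria_eq)
  define L where "L = frechet_derivative reduced (at (p, \<omega>))"
  have lin: "linear L" unfolding L_def using has_derivative_reduced[OF eP] has_derivative_linear by blast
  have injL: "v = 0" if "L (v, 0) = 0" for v
    using inj price_derivative(2)[OF eP] that by (simp add: L_def)
  have linA: "linear (\<lambda>v. L (v, 0))"
    by (rule linear_compose[of "\<lambda>v. (v, 0)" L, unfolded o_def]) (auto intro!: linearI lin)
  then have surj: "surj (\<lambda>v. L (v, 0))"
    using injL linear_injective_0[OF linA] linear_injective_imp_surjective by blast
  have snd: "frechet_derivative snd (at (p, \<omega>)) = snd"
    using frechet_derivative_at[OF has_derivative_snd[OF has_derivative_ident]] by (metis (no_types))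
  have "bij_betw snd {w. L w = 0} UNIV"
  proof (rule bij_betw_imageI)
    show "inj_on snd {w. L w = 0}"
    proof (rule inj_onI)
      fix w w' assume "w \<in> {w. L w = 0}" "w' \<in> {w. L w = 0}" and eq: "snd w = snd w'"
      then have "L (w - w') = 0" using linear_diff[OF lin] by simp
      moreover have "w - w' = (fst w - fst w', 0)" using eq by (simp add: prod_eq_iff)
      ultimately show "w = w'" using injL[of "fst w - fst w'"] eq by (simp add: prod_eq_iff)
    qed
    show "snd ` {w. L w = 0} = UNIV"
    proof (intro equalityI subsetI UNIV_I)
      fix \<eta>
      obtain v where v: "- L (0, \<eta>) = L (v, 0)" using surjD[OF surj] by blast
      then have "L ((v, 0) + (0, \<eta>)) = 0" using linear_add[OF lin, of "(v, 0)" "(0, \<eta>)"] by (simp flip: v)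
      then show "\<eta> \<in> snd ` {w. L w = 0}" by (intro image_eqI[of _ _ "(v, \<eta>)"]) auto
    qed
  qed
  then show ?thesis
    unfolding regular_equilibrium_def snd tangent_space_equilibria[OF e] using e by (simp add: L_def)
qed

text \<open>The map sending \<open>(p, \<omega>)\<close> to the pair of reduced excess demand and
  endowments is locally injective, hence by invariance of domain a homeomorphism onto an open set.
  Its inverse on the slice of zero excess demand is the selection.\<close>

lemma not_crisisI:
  assumes e: "(p, \<omega>) \<in> equilibria u"
    and inj: "\<And>v. frechet_derivative (reduced_excess_demand u \<omega>) (at p) v = 0 \<Longrightarrow> v = 0"
  shows "(p, \<omega>) \<notin> crises u"
proof -
  have eP: "(p, \<omega>) \<in> price_endowments" using e by (simp add: equilibria_eq)
  define f where "f e = (reduced e, snd e)" for e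
  have Df: "(f has_derivative (\<lambda>w. (frechet_derivative reduced (at e) w, snd w))) (at e)" if "e \<in> price_endowments" for e
    unfolding f_def by (intro has_derivative_Pair has_derivative_reduced that has_derivative_snd has_derivative_ident)
  have f1: "Ck_on (Suc 0) price_endowments f"
  proof (rule Ck_on_SucI[OF open_price_endowments Df])
    show "Ck_on 0 price_endowments (\<lambda>x. (frechet_derivative reduced (at x) v, snd v))" for v
      using Ck_on_Suc_frechet[OF Ck_on_reduced[of "Suc 0"], of v] by (auto intro!: continuous_intros)
  qed
  have "w = 0" if "frechet_derivative f (at (p, \<omega>)) w = 0" for w
  proof -
    have "frechet_derivative f (at (p, \<omega>)) = (\<lambda>w. (frechet_derivative reduced (at (p, \<omega>)) w, snd w))"
      using frechet_derivative_at[OF Df[OF eP]] by simp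
    then have w: "frechet_derivative reduced (at (p, \<omega>)) w = 0" "snd w = 0"
      using that by (simp_all add: prod_eq_iff)
    then have "frechet_derivative reduced (at (p, \<omega>)) (fst w, 0) = 0" by (metis prod.collapse)
    then have "fst w = 0" using inj price_derivative(2)[OF eP] by simp
    with w(2) show ?thesis by (simp add: prod_eq_iff)
  qed
  then obtain r where r: "r > 0" "ball (p, \<omega>) r \<subseteq> price_endowments" "inj_on f (ball (p, \<omega>) r)"
    using C1_locally_injective[OF open_price_endowments eP f1] by blast
  have contf: "continuous_on (ball (p, \<omega>) r) f"
    using Ck_on_imp_continuous_on[OF f1] r(2) continuous_on_subset by blast
  obtain g where g: "homeomorphism (ball (p, \<omega>) r) (f ` ball (p, \<omega>) r) f g"
    using Further_Topology.invariance_of_domain_homeomorphism[OF open_ball contf _ r(3)] by auto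
  define W where "W = f ` ball (p, \<omega>) r"
  have openW: "open W"
    unfolding W_def by (rule Further_Topology.invariance_of_domain[OF contf open_ball r(3)])
  define V where "V = {\<omega>'. (0, \<omega>') \<in> W}"
  have fe: "f (p, \<omega>) = (0, \<omega>)" using e by (simp add: f_def equilibria_iff_reduced)
  define s where "s \<omega>' = fst (g (0, \<omega>'))" for \<omega>'
  have gf: "g (f x) = x" if "x \<in> ball (p, \<omega>) r" for x using g that by (auto simp: homeomorphism_def)
  have fg: "f (g y) = y" "g y \<in> ball (p, \<omega>) r" if "y \<in> W" for y
    using g that by (auto simp: homeomorphism_def W_def)
  have "open V" unfolding V_def
    by (rule open_vimage[OF openW, unfolded vimage_def]) (intro continuous_intros)
  moreover have "\<omega> \<in> V" unfolding V_def W_def using fe r(1) by (force intro: image_eqI[of _ f "(p, \<omega>)"])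
  moreover have sE: "(s \<omega>', \<omega>') \<in> equilibria u" if "\<omega>' \<in> V" for \<omega>'
  proof -
    have "(0, \<omega>') \<in> W" using that by (simp add: V_def)
    note x = fg[OF this]
    then have "g (0, \<omega>') = (s \<omega>', \<omega>')" "reduced (g (0, \<omega>')) = 0" by (auto simp: f_def s_def prod_eq_iff)
    then show ?thesis using x(2) r(2) by (auto simp: equilibria_iff_reduced)
  qed
  moreover from this have "V \<subseteq> Omega" by (auto simp: equilibria_eq)
  moreover have "continuous_on V s"
  proof -
    have "continuous_on W g" using g by (simp add: homeomorphism_def W_def)
    then have "continuous_on V (\<lambda>\<omega>'. g (0, \<omega>'))"
      by (rule continuous_on_compose2) (auto intro!: continuous_intros simp: V_def)
    then show ?thesis unfolding s_def by (rule continuous_on_fst)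
  qed
  moreover have "s \<omega> = p" using gf[of "(p, \<omega>)"] r(1) fe by (simp add: s_def)
  ultimately show ?thesis unfolding crises_def by blast
qed

section \<open>Separation by the crisis set\<close>

text \<open>By Walras' law an equilibrium is determined by the prices, one consumer's income and the
  endowments of the others. In these coordinates a continuous selection of equilibrium prices has,
  by invariance of domain, an open image, so that all nearby equilibria lie on its graph.\<close>

lemma equilibria_near_selection:
  assumes V: "open V" "\<omega> \<in> V" and s: "continuous_on V s"
    and sE: "\<And>\<omega>'. \<omega>' \<in> V \<Longrightarrow> (s \<omega>', \<omega>') \<in> equilibria u"
  obtains N where "open N" "(s \<omega>, \<omega>) \<in> N" "N \<subseteq> price_endowments"
    "N \<inter> equilibria u \<subseteq> (\<lambda>\<omega>'. (s \<omega>', \<omega>')) ` V"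
proof -
  define j :: 'm where "j = undefined"
  \<comment> \<open>Normalized prices and one income have as many coordinates as one endowment. So
    the target is again the endowment space, and invariance of domain applies to \<open>g\<close>
    below.\<close>
  define \<theta> :: "(real ^ 'n) \<times> ('n, 'm) endowments \<Rightarrow> ('n, 'm) endowments" where
    "\<theta> e = (\<chi> i. if i = j then budget (fst e) (snd e $ i) else snd e $ i)" for e
  have theta_inj: "e = e'" if e: "e \<in> equilibria u" and e': "e' \<in> equilibria u" and eq: "\<theta> e = \<theta> e'" for e e'
  proof -
    have nth: "\<theta> e $ i = \<theta> e' $ i" for i using eq by simp
    have b: "budget (fst e) (snd e $ j) = budget (fst e') (snd e' $ j)" using nth[of j] by (simp add: \<theta>_def)
    have "budget (fst e) (snd e $ j) $ Some k = budget (fst e') (snd e' $ j) $ Some k" for k using b by simp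
    then have p: "fst e = fst e'" by (simp add: budget_def vec_eq_iff)
    have "budget (fst e) (snd e $ j) $ None = budget (fst e') (snd e' $ j) $ None" using b by simp
    then have inc: "full_price (fst e) \<bullet> snd e $ j = full_price (fst e) \<bullet> snd e' $ j" by (simp add: budget_def p)
    have other: "snd e $ i = snd e' $ i" if "i \<noteq> j" for i using nth[of i] that by (simp add: \<theta>_def)
    have d: "demand (u i) (fst e) (snd e $ i) = demand (u i) (fst e) (snd e' $ i)" for i
      using demand_cong[OF inc] other by (cases "i = j") auto
    \<comment> \<open>Equal demands and market clearing make the total endowments agree, which
      determines the endowment of consumer \<open>j\<close>.\<close>
    have "excess e = excess e'" using e e' by (simp add: equilibria_eq)
    then have "(\<Sum>i\<in>UNIV. snd e $ i) = (\<Sum>i\<in>UNIV. snd e' $ i)"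
      unfolding excess_def excess_demand_def p[symmetric] d sum_subtractf by simp
    then have "snd e $ j + (\<Sum>i\<in>UNIV - {j}. snd e $ i) = snd e' $ j + (\<Sum>i\<in>UNIV - {j}. snd e' $ i)"
      by (simp add: sum.remove[of UNIV j])
    moreover have "(\<Sum>i\<in>UNIV - {j}. snd e $ i) = (\<Sum>i\<in>UNIV - {j}. snd e' $ i)"
      by (intro sum.cong) (auto simp: other)
    ultimately have "snd e $ j = snd e' $ j" by simp
    with other have "snd e = snd e'" unfolding vec_eq_iff[of "snd e" "snd e'"] by metis
    with p show ?thesis by (simp add: prod_eq_iff)
  qed
  have theta_cont: "continuous_on UNIV \<theta>"
  proof -
    have fst: "Ck_on 0 UNIV (\<lambda>e :: (real ^ 'n) \<times> ('n, 'm) endowments. fst e)"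
      and snd: "Ck_on 0 UNIV (\<lambda>e :: (real ^ 'n) \<times> ('n, 'm) endowments. snd e)"
      by (intro Ck_on_linear bounded_linear_fst bounded_linear_snd open_UNIV)+
    have "Ck_on 0 UNIV \<theta>"
    proof (rule Ck_on_vecI[OF open_UNIV])
      fix i show "Ck_on 0 UNIV (\<lambda>e. \<theta> e $ i)"
        using Ck_on_budget[OF open_UNIV fst Ck_on_vec_nth[OF open_UNIV snd]] Ck_on_vec_nth[OF open_UNIV snd]
        by (cases "i = j") (simp_all add: \<theta>_def)
    qed
    then show ?thesis by simp
  qed
  define g where "g \<omega>' = \<theta> (s \<omega>', \<omega>')" for \<omega>'
  have "continuous_on V g"
    unfolding g_def by (rule continuous_on_compose2[OF theta_cont]) (auto intro!: continuous_intros s)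
  moreover have "inj_on g V"
    using theta_inj[OF sE sE] by (auto intro!: inj_onI simp: g_def)
  ultimately have "open (g ` V)" using Further_Topology.invariance_of_domain V(1) by blast
  then have "open (price_endowments \<inter> \<theta> -` (g ` V))"
    by (intro open_Int open_price_endowments open_vimage theta_cont)
  moreover have "(s \<omega>, \<omega>) \<in> price_endowments \<inter> \<theta> -` (g ` V)"
    using sE[OF V(2)] V(2) by (auto simp: equilibria_eq g_def)
  moreover have "(price_endowments \<inter> \<theta> -` (g ` V)) \<inter> equilibria u \<subseteq> (\<lambda>\<omega>'. (s \<omega>', \<omega>')) ` V"
  proof
    fix e assume e: "e \<in> (price_endowments \<inter> \<theta> -` (g ` V)) \<inter> equilibria u"
    then obtain \<eta> where "\<eta> \<in> V" "\<theta> e = \<theta> (s \<eta>, \<eta>)" by (auto simp: g_def)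
    then show "e \<in> (\<lambda>\<omega>'. (s \<omega>', \<omega>')) ` V" using theta_inj[OF _ sE] e by blast
  qed
  ultimately show ?thesis using that by blast
qed

text \<open>Each point of \<open>K\<close> has a neighbourhood whose equilibria lie on the graph of
  a selection, so that an economy has at most one equilibrium price there. A Lebesgue number of this
  cover makes the radius uniform.\<close>

lemma isolated_price_near_path:
  assumes K: "compact K" "K \<subseteq> equilibria u - crises u"
  obtains \<epsilon> where "\<epsilon> > 0"
    "\<And>p \<omega> q. (p, \<omega>) \<in> K \<Longrightarrow> dist q p < \<epsilon> \<Longrightarrow> (q, \<omega>) \<in> price_endowments \<and> (reduced (q, \<omega>) = 0 \<longrightarrow> q = p)"
proof -
  define G where "G = {N. open N \<and> N \<subseteq> price_endowments \<and>
    (\<forall>p q \<omega>. (p, \<omega>) \<in> N \<inter> equilibria u \<and> (q, \<omega>) \<in> N \<inter> equilibria u \<longrightarrow> q = p)}"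
  have cover: "K \<subseteq> \<Union>G"
  proof
    fix e assume "e \<in> K"
    then have "e \<in> equilibria u" "e \<notin> crises u" using K by auto
    then obtain V s where V: "open V" "snd e \<in> V" "continuous_on V s" "s (snd e) = fst e"
      "\<And>\<omega>'. \<omega>' \<in> V \<Longrightarrow> (s \<omega>', \<omega>') \<in> equilibria u"
      unfolding crises_def by (cases e) auto
    obtain N where N: "open N" "(s (snd e), snd e) \<in> N" "N \<subseteq> price_endowments"
      "N \<inter> equilibria u \<subseteq> (\<lambda>\<omega>'. (s \<omega>', \<omega>')) ` V"
      using equilibria_near_selection[OF V(1,2,3,5)] by blast
    have "\<forall>p q \<omega>. (p, \<omega>) \<in> N \<inter> equilibria u \<and> (q, \<omega>) \<in> N \<inter> equilibria u \<longrightarrow> q = p"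
      using N(4) by blast
    with N(1,3) have "N \<in> G" unfolding G_def by blast
    then show "e \<in> \<Union>G" using N(2) V(4) by auto
  qed
  obtain \<epsilon> where \<epsilon>: "0 < \<epsilon>" "\<And>x. x \<in> K \<Longrightarrow> \<exists>N\<in>G. ball x \<epsilon> \<subseteq> N"
    using Heine_Borel_lemma[OF K(1) cover] unfolding G_def by blast
  show ?thesis
  proof (rule that[OF \<epsilon>(1)])
    fix p \<omega> q assume pK: "(p, \<omega>) \<in> K" and q: "dist q p < \<epsilon>"
    obtain N where N: "N \<in> G" "ball (p, \<omega>) \<epsilon> \<subseteq> N" using \<epsilon>(2)[OF pK] by blast
    have NP: "N \<subseteq> price_endowments" and uniq: "\<And>p q \<omega>. (p, \<omega>) \<in> N \<inter> equilibria u \<Longrightarrow> (q, \<omega>) \<in> N \<inter> equilibria u \<Longrightarrow> q = p"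
      using N(1) unfolding G_def by blast+
    have qN: "(q, \<omega>) \<in> N" and pN: "(p, \<omega>) \<in> N"
      using N(2) q \<epsilon>(1) by (auto simp: subset_iff dist_Pair_Pair dist_commute)
    have "(p, \<omega>) \<in> equilibria u" using pK K by blast
    moreover have qP: "(q, \<omega>) \<in> price_endowments" using qN NP by blast
    ultimately show "(q, \<omega>) \<in> price_endowments \<and> (reduced (q, \<omega>) = 0 \<longrightarrow> q = p)"
      using uniq[of p \<omega> q] qN pN equilibria_iff_reduced[of "(q, \<omega>)"] by blast
  qed
qed

text \<open>Along a path of equilibria that avoids the crises, the equilibrium prices remain isolated
  uniformly, so the excess demands on small spheres around them are homotopic; at the endpoints
  they have the homotopy type of the derivative.\<close>

lemma orientation_preserved_along_path:
  assumes path: "path_component (equilibria u - crises u) (p1, \<omega>1) (p2, \<omega>2)"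
    and neg: "det (matrix (frechet_derivative (reduced_excess_demand u \<omega>1) (at p1))) < 0"
    and pos: "0 < det (matrix (frechet_derivative (reduced_excess_demand u \<omega>2) (at p2)))"
  shows False
proof -
  obtain g where g: "path g" "path_image g \<subseteq> equilibria u - crises u"
    "pathstart g = (p1, \<omega>1)" "pathfinish g = (p2, \<omega>2)"
    using path unfolding path_component_def by blast
  obtain \<epsilon> where \<epsilon>: "\<epsilon> > 0" "\<And>p \<omega> q. (p, \<omega>) \<in> path_image g \<Longrightarrow> dist q p < \<epsilon> \<Longrightarrow>
      (q, \<omega>) \<in> price_endowments \<and> (reduced (q, \<omega>) = 0 \<longrightarrow> q = p)"
    using isolated_price_near_path[OF compact_path_image[OF g(1)] g(2)] by blast
  \<comment> \<open>A nonsingular derivative fixes the homotopy type on all sufficiently small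
    spheres; the common radius is chosen only after both ends have been treated.\<close>
  have endpoint: "\<exists>r0>0. \<forall>r. 0 < r \<and> r < r0 \<longrightarrow>
      homotopic_with_canon (\<lambda>_. True) (sphere 0 1) (-{0}) (\<lambda>x. reduced (p + r *\<^sub>R x, \<omega>))
        ((*v) (matrix (frechet_derivative (reduced_excess_demand u \<omega>) (at p))))"
    if pw: "(p, \<omega>) \<in> path_image g"
      and det: "det (matrix (frechet_derivative (reduced_excess_demand u \<omega>) (at p))) \<noteq> 0" for p \<omega>
  proof -
    have E: "(p, \<omega>) \<in> equilibria u" using pw g(2) by blast
    then have P: "(p, \<omega>) \<in> price_endowments" by (simp add: equilibria_eq)
    define A where "A = frechet_derivative (reduced_excess_demand u \<omega>) (at p)"
    have A: "(reduced_excess_demand u \<omega> has_derivative A) (at p)"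
      unfolding A_def using price_derivative(1)[OF P] frechet_derivative_at by metis
    have lin: "linear A" using A has_derivative_linear by blast
    have mat: "(*v) (matrix A) = A" by (simp add: matrix_works lin fun_eq_iff)
    have inj: "v = 0" if "A v = 0" for v
      using det_nz_iff_inj[OF lin] det linear_injective_0[OF lin] that by (auto simp: A_def)
    have "continuous_on (ball p \<epsilon>) (\<lambda>q. reduced (q, \<omega>))"
      by (rule continuous_on_compose2[OF Ck_on_imp_continuous_on[OF Ck_on_reduced[of 0]]])
        (use \<epsilon>(2)[OF pw] P in \<open>auto intro!: continuous_intros simp: dist_commute\<close>)
    then have cont: "continuous_on (ball p \<epsilon>) (reduced_excess_demand u \<omega>)"
      by (simp add: reduced_excess_demand_eq[abs_def])
    have "reduced_excess_demand u \<omega> p = 0" using E by (simp add: reduced_excess_demand_eq equilibria_iff_reduced)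
    from homotopic_derivative_on_small_sphere[OF A this inj cont \<epsilon>(1)]
    obtain r0 where "r0 > 0" "\<And>r. 0 < r \<Longrightarrow> r < r0 \<Longrightarrow>
       homotopic_with_canon (\<lambda>_. True) (sphere 0 1) (-{0}) (\<lambda>x. reduced_excess_demand u \<omega> (p + r *\<^sub>R x)) A"
      by blast
    then show ?thesis unfolding A_def[symmetric] mat reduced_excess_demand_eq by blast
  qed
  have ends: "(p1, \<omega>1) \<in> path_image g" "(p2, \<omega>2) \<in> path_image g"
    using pathstart_in_path_image[of g] pathfinish_in_path_image[of g] g(3,4) by auto
  obtain r1 where r1: "r1 > 0" "\<And>r. 0 < r \<Longrightarrow> r < r1 \<Longrightarrow>
      homotopic_with_canon (\<lambda>_. True) (sphere 0 1) (-{0}) (\<lambda>x. reduced (p1 + r *\<^sub>R x, \<omega>1))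
        ((*v) (matrix (frechet_derivative (reduced_excess_demand u \<omega>1) (at p1))))"
    using endpoint[OF ends(1)] neg by (metis less_irrefl)
  obtain r2 where r2: "r2 > 0" "\<And>r. 0 < r \<Longrightarrow> r < r2 \<Longrightarrow>
      homotopic_with_canon (\<lambda>_. True) (sphere 0 1) (-{0}) (\<lambda>x. reduced (p2 + r *\<^sub>R x, \<omega>2))
        ((*v) (matrix (frechet_derivative (reduced_excess_demand u \<omega>2) (at p2))))"
    using endpoint[OF ends(2)] pos by (metis less_irrefl)
  \<comment> \<open>Below \<open>\<epsilon>\<close>, the sphere around each price on the path
    contains no other equilibrium price; below \<open>r1\<close> and \<open>r2\<close>, the end maps
    are homotopic to the derivatives.\<close>
  define r where "r = min \<epsilon> (min r1 r2) / 2"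
  have r: "0 < r" "r < \<epsilon>" "r < r1" "r < r2" using \<epsilon>(1) r1(1) r2(1) by (auto simp: r_def min_def)
  \<comment> \<open>The sphere of radius \<open>r\<close> travels with the equilibrium price along
    the path.\<close>
  define c where "c z = (fst (g (fst z)) + r *\<^sub>R snd z, snd (g (fst z)))" for z :: "real \<times> (real ^ 'n)"
  have cz: "c (t, x) \<in> price_endowments" "reduced (c (t, x)) \<noteq> 0" if "t \<in> {0..1}" "norm x = 1" for t x
  proof -
    have "(fst (g t), snd (g t)) \<in> path_image g" using that(1) by (auto simp: path_image_def)
    from \<epsilon>(2)[OF this, of "fst (g t) + r *\<^sub>R x"] show "c (t, x) \<in> price_endowments" "reduced (c (t, x)) \<noteq> 0"
      using r that(2) by (auto simp: c_def dist_norm)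
  qed
  have "continuous_on ({0..1} \<times> sphere 0 1) (\<lambda>z. reduced (c z))"
  proof (rule continuous_on_compose2[OF Ck_on_imp_continuous_on[OF Ck_on_reduced[of 0]]])
    have "continuous_on ({0..1} \<times> sphere 0 1) (\<lambda>z :: real \<times> (real ^ 'n). g (fst z))"
      by (rule continuous_on_compose2[OF g(1)[unfolded path_def]]) (auto intro!: continuous_intros)
    then show "continuous_on ({0..1} \<times> sphere 0 1) c" unfolding c_def by (intro continuous_intros)
    show "c ` ({0..1} \<times> sphere 0 1) \<subseteq> price_endowments"
    proof (rule image_subsetI, elim SigmaE)
      fix z :: "real \<times> (real ^ 'n)" and t x assume "t \<in> {0..1}" "x \<in> sphere 0 1" "z = (t, x)"
      then show "c z \<in> price_endowments" using cz(1)[of t x] by simp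
    qed
  qed
  moreover have "(\<lambda>z. reduced (c z)) \<in> {0..1} \<times> sphere 0 1 \<rightarrow> -{0}" using cz by auto
  ultimately have "continuous_map (prod_topology (top_of_set {0..1}) (top_of_set (sphere 0 1))) (top_of_set (-{0}))
      (\<lambda>z. reduced (c z))"
    by (simp only: prod_topology_subtopology_eu continuous_map_subtopology_eu)
  moreover have "reduced (c (0, x)) = reduced (p1 + r *\<^sub>R x, \<omega>1)" "reduced (c (1, x)) = reduced (p2 + r *\<^sub>R x, \<omega>2)" for x
    using g(3,4) by (auto simp: c_def pathstart_def pathfinish_def)
  ultimately have "homotopic_with_canon (\<lambda>_. True) (sphere 0 1) (-{0})
      (\<lambda>x. reduced (p1 + r *\<^sub>R x, \<omega>1)) (\<lambda>x. reduced (p2 + r *\<^sub>R x, \<omega>2))"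
    unfolding homotopic_with_def by blast
  with r1(2)[of r] r2(2)[of r] r have "homotopic_with_canon (\<lambda>_. True) (sphere 0 1) (-{0})
      ((*v) (matrix (frechet_derivative (reduced_excess_demand u \<omega>1) (at p1))))
      ((*v) (matrix (frechet_derivative (reduced_excess_demand u \<omega>2) (at p2))))"
    by (meson homotopic_with_symD homotopic_with_trans)
  then show False using homotopic_linear_sphere_imp_same_orientation neg pos by blast
qed

section \<open>Sign change of the Jacobian and the crisis\<close>

definition jacobian :: "(real ^ 'n) \<times> ('n, 'm) endowments \<Rightarrow> real" where
  "jacobian e = det (matrix (frechet_derivative (reduced_excess_demand u (snd e)) (at (fst e))))"

lemma jacobian_nonzero_imp_inj:
  assumes e: "(p, \<omega>) \<in> equilibria u" and det: "jacobian (p, \<omega>) \<noteq> 0"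
    and v: "frechet_derivative (reduced_excess_demand u \<omega>) (at p) v = 0"
  shows "v = 0"
proof -
  have P: "(p, \<omega>) \<in> price_endowments" using e by (simp add: equilibria_eq)
  note lin = linear_price_derivative[OF P]
  show ?thesis
    using det_nz_iff_inj[OF lin] det linear_injective_0[OF lin] v by (auto simp: jacobian_def)
qed

text \<open>Follow a curve of equilibria with velocity \<open>(v, 0)\<close>: since its endowments are stationary to
  first order, the derivative of the Jacobian matrix along it is the second differential of the
  excess demand at the fixed economy \<open>\<omega>\<close>.\<close>

lemma jacobian_changes_sign:
  assumes e: "(p, \<omega>) \<in> equilibria u"
    and odd_ker: "odd (dim {v. frechet_derivative (reduced_excess_demand u \<omega>) (at p) v = 0})"
    and v: "frechet_derivative (reduced_excess_demand u \<omega>) (at p) v = 0"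
    and nondeg: "\<forall>w. frechet_derivative (reduced_excess_demand u \<omega>) (at p) w = 0 \<and> w \<noteq> 0 \<longrightarrow>
      second_derivative (reduced_excess_demand u \<omega>) p v w \<notin> range (frechet_derivative (reduced_excess_demand u \<omega>) (at p))"
    and T: "open T" "(p, \<omega>) \<in> T"
  obtains e1 e2 where "e1 \<in> T \<inter> equilibria u" "e2 \<in> T \<inter> equilibria u" "jacobian e1 < 0" "0 < jacobian e2"
proof -
  define f where "f = reduced_excess_demand u \<omega>"
  have P: "(p, \<omega>) \<in> price_endowments" using e by (simp add: equilibria_eq)
  have pP: "p \<in> pos_orthant" and \<omega>P: "\<omega> \<in> Omega" using P by auto
  have "frechet_derivative reduced (at (p, \<omega>)) (v, 0) = 0" using v price_derivative(2)[OF P] by simp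
  then have "(v, 0) \<in> tangent_space (equilibria u) (p, \<omega>)" by (simp add: tangent_space_equilibria[OF e])
  then obtain c \<epsilon> where \<epsilon>: "0 < (\<epsilon>::real)" and cE: "c ` {-\<epsilon><..<\<epsilon>} \<subseteq> equilibria u" and c0: "c 0 = (p, \<omega>)"
    and dc: "(c has_vector_derivative (v, 0)) (at 0)"
    unfolding tangent_space_def by blast
  define M where "M t = matrix (frechet_derivative (reduced_excess_demand u (snd (c t))) (at (fst (c t))))" for t
  have Mw: "M t *v w = frechet_derivative reduced (at (c t)) (w, 0)" if "t \<in> {-\<epsilon><..<\<epsilon>}" for t w
  proof -
    have "c t \<in> equilibria u" using cE that by blast
    then have P': "(fst (c t), snd (c t)) \<in> price_endowments" by (simp add: equilibria_eq)
    from linear_price_derivative[OF this] show ?thesis unfolding M_def using price_derivative(2)[OF P', of w] by (simp add: matrix_works)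
  qed
  have M0: "M 0 *v w = frechet_derivative f (at p) w" for w
    using Mw[of 0 w] \<epsilon> price_derivative(2)[OF P, of w] by (simp add: c0 f_def)
  have dM: "((\<lambda>t. M t *v w) has_vector_derivative second_derivative f p v w) (at 0)" for w
  proof -
    define H where "H = frechet_derivative (\<lambda>y. frechet_derivative reduced (at y) (w, 0)) (at (p, \<omega>))"
    have H: "((\<lambda>y. frechet_derivative reduced (at y) (w, 0)) has_derivative H) (at (p, \<omega>))"
      unfolding H_def by (rule Ck_on_Suc_has_derivative[OF Ck_on_Suc_frechet[OF Ck_on_reduced] P])
    have "((\<lambda>q. (q, \<omega>)) has_derivative (\<lambda>v. (v, 0))) (at p)" by (auto intro!: derivative_eq_intros)
    from has_derivative_compose[OF this, of "\<lambda>y. frechet_derivative reduced (at y) (w, 0)" H] H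
    have "((\<lambda>q. frechet_derivative reduced (at (q, \<omega>)) (w, 0)) has_derivative (\<lambda>v. H (v, 0))) (at p)" by blast
    then have "((\<lambda>q. frechet_derivative f (at q) w) has_derivative (\<lambda>v. H (v, 0))) (at p)"
    proof (rule has_derivative_transform_within_open[OF _ open_pos_orthant pP])
      show "frechet_derivative reduced (at (q, \<omega>)) (w, 0) = frechet_derivative f (at q) w" if "q \<in> pos_orthant" for q
        using price_derivative(2)[of q \<omega> w] that \<omega>P by (simp add: f_def)
    qed
    from frechet_derivative_at[OF this] have "second_derivative f p w v = H (v, 0)"
      unfolding second_derivative_def by (rule fun_cong[OF sym])
    \<comment> \<open>Moving the base point along \<open>v\<close> differentiates the map that
      applies the matrix to \<open>w\<close>, whereas \<open>nondeg\<close> has the two directions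
      in the other order.\<close>
    moreover have "second_derivative f p v w = second_derivative f p w v"
    proof (rule second_derivative_commute[OF open_pos_orthant pP])
      have "Ck_on 2 pos_orthant (\<lambda>q :: real ^ 'n. (q, \<omega>))"
      proof -
        have "bounded_linear (\<lambda>q :: real ^ 'n. (q, 0 :: ('n, 'm) endowments))"
          by (intro bounded_linear_Pair bounded_linear_ident bounded_linear_zero)
        from Ck_on_add[OF open_pos_orthant Ck_on_linear[OF this open_pos_orthant] Ck_on_const[of 2 pos_orthant "(0, \<omega>)"]]
        show ?thesis by simp
      qed
      from Ck_on_compose[OF open_pos_orthant open_price_endowments _ this Ck_on_reduced]
      show "Ck_on 2 pos_orthant f" using \<omega>P by (auto simp: f_def reduced_excess_demand_eq[abs_def])
    qed
    ultimately have Hv: "H (v, 0) = second_derivative f p v w" by simp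
    have "((\<lambda>y. frechet_derivative reduced (at y) (w, 0)) has_derivative H) (at (c 0))" using H c0 by simp
    with has_derivative_compose[OF dc[unfolded has_vector_derivative_def],
        of "\<lambda>y. frechet_derivative reduced (at y) (w, 0)" H]
    have "((\<lambda>t. frechet_derivative reduced (at (c t)) (w, 0)) has_derivative (\<lambda>h. H (h *\<^sub>R (v, 0)))) (at 0)"
      by blast
    then have "((\<lambda>t. M t *v w) has_derivative (\<lambda>h. H (h *\<^sub>R (v, 0)))) (at 0)"
      by (rule has_derivative_transform_within_open[of _ _ _ _ "{-\<epsilon><..<\<epsilon>}"]) (use \<epsilon> Mw in auto)
    then show ?thesis
      unfolding has_vector_derivative_def
      using linear_scale[OF has_derivative_linear[OF H], of _ "(v, 0)"] Hv by simp
  qed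
  have "\<exists>\<delta>>0. \<forall>t. 0 < t \<and> t < \<delta> \<longrightarrow> det (M t) * det (M (- t)) < 0"
  proof (rule det_changes_sign[OF dM])
    show "odd (dim {w. M 0 *v w = 0})" using odd_ker by (simp add: M0 f_def)
    have "range ((*v) (M 0)) = range (frechet_derivative f (at p))" using M0 by auto
    then show "second_derivative f p v w \<notin> range ((*v) (M 0))" if "M 0 *v w = 0" "w \<noteq> 0" for w
      using nondeg that by (simp add: M0 f_def)
  qed
  then obtain \<delta> where \<delta>: "\<delta> > 0" "\<And>t. 0 < t \<Longrightarrow> t < \<delta> \<Longrightarrow> det (M t) * det (M (- t)) < 0" by blast
  have "isCont c 0" using has_vector_derivative_continuous[OF dc] .
  then have "(c \<longlongrightarrow> (p, \<omega>)) (nhds 0)"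
    unfolding isCont_def using tendsto_at_iff_tendsto_nhds[of c 0] c0 by simp
  from topological_tendstoD[OF this T]
  obtain \<rho> where \<rho>: "\<rho> > 0" "\<And>t. dist t 0 < \<rho> \<Longrightarrow> c t \<in> T" unfolding eventually_nhds_metric by blast
  define t where "t = min \<epsilon> (min \<delta> \<rho>) / 2"
  have t: "0 < t" "t < \<epsilon>" "t < \<delta>" "t < \<rho>" using \<epsilon> \<delta>(1) \<rho>(1) by (auto simp: t_def min_def)
  have in_TE: "c t \<in> T \<inter> equilibria u" "c (- t) \<in> T \<inter> equilibria u"
    using \<rho>(2)[of t] \<rho>(2)[of "- t"] cE t by (auto simp: image_subset_iff)
  have jac: "jacobian (c s) = det (M s)" for s by (simp add: jacobian_def M_def)
  have "jacobian (c t) < 0 \<and> 0 < jacobian (c (- t)) \<or> jacobian (c (- t)) < 0 \<and> 0 < jacobian (c t)"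
    using \<delta>(2)[OF t(1,3)] unfolding jac by (auto simp: mult_less_0_iff)
  then show ?thesis using that in_TE by blast
qed

lemma jacobian_opposite_imp_not_path_component:
  assumes "jacobian e1 < 0" "0 < jacobian e2"
  shows "\<not> path_component (equilibria u - crises u) e1 e2"
  using orientation_preserved_along_path[of "fst e1" "snd e1" "fst e2" "snd e2"] assms
  by (auto simp: jacobian_def)

text \<open>The sign change supplies the two regular equilibria in every neighbourhood. It also
  excludes a selection at the point itself: its graph over a small ball would join equilibria of
  opposite signs without meeting a crisis.\<close>

lemma unavoidable_crisisI:
  assumes e: "(p, \<omega>) \<in> equilibria u"
    and odd_ker: "odd (dim {v. frechet_derivative (reduced_excess_demand u \<omega>) (at p) v = 0})"
    and v: "frechet_derivative (reduced_excess_demand u \<omega>) (at p) v = 0"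
    and nondeg: "\<forall>w. frechet_derivative (reduced_excess_demand u \<omega>) (at p) w = 0 \<and> w \<noteq> 0 \<longrightarrow>
      second_derivative (reduced_excess_demand u \<omega>) p v w \<notin> range (frechet_derivative (reduced_excess_demand u \<omega>) (at p))"
  shows "unavoidable_crisis u (p, \<omega>)"
proof -
  note sign_change = jacobian_changes_sign[OF e odd_ker v nondeg]
  have "(p, \<omega>) \<in> crises u"
  proof (rule ccontr)
    assume "(p, \<omega>) \<notin> crises u"
    then obtain V s where V: "open V" "\<omega> \<in> V" "V \<subseteq> Omega" "continuous_on V s" "s \<omega> = p"
      "\<And>\<omega>'. \<omega>' \<in> V \<Longrightarrow> (s \<omega>', \<omega>') \<in> equilibria u"
      using e unfolding crises_def by auto
    obtain N where N: "open N" "(s \<omega>, \<omega>) \<in> N" and "N \<subseteq> price_endowments"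
      and graph: "N \<inter> equilibria u \<subseteq> (\<lambda>\<omega>'. (s \<omega>', \<omega>')) ` V"
      using equilibria_near_selection[OF V(1,2,4,6)] .
    obtain \<rho> where \<rho>: "\<rho> > 0" "ball \<omega> \<rho> \<subseteq> V" using V(1,2) open_contains_ball by blast
    \<comment> \<open>Restricting the endowments to a ball makes the relevant piece of the graph
      path connected.\<close>
    have "open (N \<inter> UNIV \<times> ball \<omega> \<rho>)" using N(1) by (intro open_Int open_Times) auto
    moreover have "(p, \<omega>) \<in> N \<inter> UNIV \<times> ball \<omega> \<rho>" using N(2) V(5) \<rho>(1) by simp
    ultimately obtain e1 e2 where e12: "e1 \<in> (N \<inter> UNIV \<times> ball \<omega> \<rho>) \<inter> equilibria u"
      "e2 \<in> (N \<inter> UNIV \<times> ball \<omega> \<rho>) \<inter> equilibria u" "jacobian e1 < 0" "0 < jacobian e2"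
      using sign_change by blast
    define G where "G = (\<lambda>\<omega>'. (s \<omega>', \<omega>')) ` ball \<omega> \<rho>"
    have "e' \<in> G" if "e' \<in> (N \<inter> UNIV \<times> ball \<omega> \<rho>) \<inter> equilibria u" for e'
      using graph that unfolding G_def by blast
    then have "e1 \<in> G" "e2 \<in> G" using e12 by blast+
    moreover have "path_connected G"
      unfolding G_def
      by (rule path_connected_continuous_image[OF _ convex_imp_path_connected[OF convex_ball]])
        (auto intro!: continuous_intros continuous_on_subset[OF V(4) \<rho>(2)])
    ultimately have "path_component G e1 e2" by (simp add: path_connected_component)
    \<comment> \<open>The selection \<open>s\<close> on \<open>V\<close> is a witness at every point
      of its graph, not only at \<open>(p, \<omega>)\<close>.\<close>
    moreover have "G \<subseteq> equilibria u - crises u"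
      using V \<rho>(2) unfolding G_def crises_def by blast
    ultimately have "path_component (equilibria u - crises u) e1 e2" using path_component_of_subset by blast
    then show False using jacobian_opposite_imp_not_path_component e12 by blast
  qed
  moreover have "\<exists>e1\<in>N. \<exists>e2\<in>N. regular_equilibrium u e1 \<and> regular_equilibrium u e2 \<and>
      e1 \<in> equilibria u - crises u \<and> e2 \<in> equilibria u - crises u \<and>
      \<not> path_component (equilibria u - crises u) e1 e2"
    if N: "openin (top_of_set (equilibria u)) N" "(p, \<omega>) \<in> N" for N
  proof -
    obtain T where T: "open T" "N = equilibria u \<inter> T" using N(1) openin_open by blast
    then have "(p, \<omega>) \<in> T" using N(2) by blast
    then obtain e1 e2 where e12: "e1 \<in> T \<inter> equilibria u" "e2 \<in> T \<inter> equilibria u" "jacobian e1 < 0" "0 < jacobian e2"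
      using sign_change[OF T(1)] by blast
    have reg: "regular_equilibrium u e' \<and> e' \<in> equilibria u - crises u"
      if "e' \<in> equilibria u" "jacobian e' \<noteq> 0" for e'
    proof -
      obtain q \<eta> where e': "e' = (q, \<eta>)" by (cases e')
      have E: "(q, \<eta>) \<in> equilibria u" and J: "jacobian (q, \<eta>) \<noteq> 0" using that e' by simp_all
      note inj = jacobian_nonzero_imp_inj[OF E J]
      show ?thesis using regular_equilibriumI[OF E inj] not_crisisI[OF E inj] E by (simp add: e')
    qed
    have "e1 \<in> N" "e2 \<in> N" using e12 T(2) by blast+
    moreover have "regular_equilibrium u e1 \<and> e1 \<in> equilibria u - crises u"
      "regular_equilibrium u e2 \<and> e2 \<in> equilibria u - crises u"
      using e12 by (auto intro!: reg simp del: Diff_iff)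
    ultimately show ?thesis using jacobian_opposite_imp_not_path_component[OF e12(3,4)] by blast
  qed
  ultimately show ?thesis unfolding unavoidable_crisis_def by blast
qed

end

theorem theorem1p7:
  fixes u :: "'m::finite \<Rightarrow> ('n::finite) goods_bundle \<Rightarrow> real"
    and p :: "real ^ 'n" and \<omega> :: "('n, 'm) endowments"
  assumes util: "\<And>i. admissible_utility (u i)"
    and eq: "(p, \<omega>) \<in> equilibria u"
    and odd_ker: "odd (dim {v. frechet_derivative (reduced_excess_demand u \<omega>) (at p) v = 0})"
    and nondeg: "\<exists>v. frechet_derivative (reduced_excess_demand u \<omega>) (at p) v = 0 \<and>
      (\<forall>w. frechet_derivative (reduced_excess_demand u \<omega>) (at p) w = 0 \<and> w \<noteq> 0 \<longrightarrow>
         second_derivative (reduced_excess_demand u \<omega>) p v w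
           \<notin> range (frechet_derivative (reduced_excess_demand u \<omega>) (at p)))"
  shows "unavoidable_crisis u (p, \<omega>)"
  using nondeg unavoidable_crisisI[OF util eq odd_ker] by blast

end
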